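(* Let $\mathcal X$ be a space of homogeneous type with degree $(\alpha_0,n_0,N_0)$, and let $\varphi$ be a growth function on $\mathcal X\times[0,\infty)$ for which there exists a positive constant $C$ such that, for all balls $B_1\subset B_2$ in $\mathcal X$, $$\frac{\|\chi_{B_1}\|_{L^\varphi(\mathcal X)}}{\mu(B_1)}\le C\,\frac{\|\chi_{B_2}\|_{L^\varphi(\mathcal X)}}{\mu(B_2)}.$$ Let $\{A_t\}_{t>0}$ satisfy Assumption A. Then, for different $\widetilde p\in[1,\infty)$, the spaces $\mathrm{BMO}^{\varphi,\,\widetilde p}_A(\mathcal X)$ coincide with equivalent norms.
   Context: **Spaces of homogeneous type.** $(\mathcal X,d,\mu)$: $d:\mathcal X\times\mathcal X\to[0,\infty)$ is a quasi-metric ($d(x,y)=0$ iff $x=y$; $d(x,y)=d(y,x)$; $d(x,y)\le C_1[d(x,z)+d(z,y)]$ for a constant $C_1\in[1,\infty)$), and $\mu$ is a nonnegative Borel measure for which there is $C_2\in[1,\infty)$ with $\mu(B(x,2r))\le C_2\mu(B(x,r))<\infty$ for all balls $B(x,r)=\{y: d(y,x)<r\}$ (balls have positive measure). Consider the conditions: ($D_n$), $n\in(0,\infty)$: $\exists C$ with $\mu(B(x,\lambda r))\le C\lambda^n\mu(B(x,r))$ for all $x\in\mathcal X$, $r>0$, $\lambda\ge1$; ($E_N$), $N\in[0,\infty)$: $\exists C$ with $\mu(B(y,r))\le C[1+d(x,y)/r]^N\mu(B(x,r))$ for all $x,y\in\mathcal X$, $r>0$; ($R_\alpha$), $\alpha\in[0,n]$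 with $n$ as in ($D_n$): $\exists C\ge1$ with $C^{-1}\lambda^\alpha\mu(B(x,r))\le\mu(B(x,\lambda r))$ for all $x\in\mathcal X$, $r\in(0,2\,\mathrm{diam}(\mathcal X))$, $\lambda\in[1,2\,\mathrm{diam}(\mathcal X)/r)$. Set $n_0=\inf\{n:(D_n)\}$, $N_0=\inf\{N:(E_N)\}$, $\alpha_0=\sup\{\alpha:(R_\alpha)\}$; $(\alpha_0,n_0,N_0)$ is the degree of $\mathcal X$. **Growth functions.** $\varphi:\mathcal X\times[0,\infty)\to[0,\infty)$ is of uniformly upper type $p$ (resp. uniformly lower type $p$) if $\exists C$ with $\varphi(x,st)\le Cs^p\varphi(x,t)$ for all $x\in\mathcal X$, $t\ge0$ and $s\ge1$ (resp. $s\in(0,1)$). For $p\in(1,\infty)$, $\varphi\in\mathbb A_p(\mathcal X)$ means $\sup_{t>0}\sup_{B}\frac1{\mu(B)}\int_B\varphi(x,t)\,d\mu(x)\{\frac1{\mu(B)}\int_B[\varphi(x,t)]^{-1/(p-1)}d\mu(x)\}^{p-1}<\infty$; $\varphi\in\mathbb A_1(\mathcal X)$ means $\sup_{t>0}\sup_B\frac1{\mu(B)}\int_B\varphi(x,t)d\mu(x)\,\{\mathrm{ess\,sup}_{y\in B}[\varphi(y,t)]^{-1}\}<\infty$; $\mathbb A_\infty=\bigcup_{p\in[1,\infty)}\mathbb A_p$. For $q\in(1,\infty)$, $\varphi\in\mathbb{RH}_q(\mathcal X)$ means $\sup_{t>0}\sup_B\{\frac1{\mu(B)}\int_B[\varphi(x,t)]^qd\mu(x)\}^{1/q}\{\frac1{\mu(B)}\int_B\varphi(x,t)d\mu(x)\}^{-1}<\infty$;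 for $q=\infty$ the first factor is replaced by $\mathrm{ess\,sup}_{y\in B}\varphi(y,t)$. (Suprema over all balls $B$.) $\varphi$ is a growth function if: for each $x$, $\varphi(x,\cdot)$ is an Orlicz function (nondecreasing, $\varphi(x,0)=0$, $\varphi(x,t)>0$ for $t>0$, $\lim_{t\to\infty}\varphi(x,t)=\infty$; not necessarily convex); $\varphi(\cdot,t)$ is measurable for each $t$; $\varphi\in\mathbb A_\infty(\mathcal X)$; and $\varphi$ is of uniformly upper type $1$ and of uniformly lower type $p$ for some $p\in(0,1]$. Indices: $i(\varphi)=\sup\{p\in(0,\infty):\varphi$ is of uniformly lower type $p\}$, $p(\varphi)=\inf\{p\in[1,\infty):\varphi\in\mathbb A_p(\mathcal X)\}$, $r(\varphi)=\sup\{q\in(1,\infty]:\varphi\in\mathbb{RH}_q(\mathcal X)\}$, with $(r-1)/r:=1$ if $r=\infty$. $\|f\|_{L^\varphi(\mathcal X)}=\inf\{\lambda>0:\int_{\mathcal X}\varphi(x,|f(x)|/\lambda)\,d\mu(x)\le1\}$; $\chi_B$ is the characteristic function of $B$. **Generalized approximation to the identity.** Fix $M>n_0[1+p(\varphi)/i(\varphi)]-\alpha_0$, a constant $m>0$, and a positive, bounded, decreasing function $g$ on $[0,\infty)$ with $\lim_{r\to\infty}r^Mg(r^m)=0$. The operators are $A_tf(x)=\int_{\mathcal X}a_t(x,y)f(y)\,d\mu(y)$, $t>0$, with $|a_t(x,y)|\le h_t(x,y):=\frac1{\mu(B(x,t^{1/m}))}g\big(\frac{[d(x,y)]^m}{t}\big)$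 for all $x,y\in\mathcal X$. They act on $f\in\mathcal M(\mathcal X):=\bigcup_{x_0\in\mathcal X}\bigcup_\beta\mathcal M_{(x_0,\beta)}(\mathcal X)$, the union over $0<\beta<M-n_0[1+p(\varphi)/i(\varphi)]+\alpha_0$, where $\mathcal M_{(x_0,\beta)}(\mathcal X)$ is the set of $f\in L^1_{\rm loc}(\mathcal X)$ with $\int_{\mathcal X}\frac{|f(x)|}{[1+d(x_0,x)]^{n_0p(\varphi)/i(\varphi)-\alpha_0+\beta}\,\mu(B(x_0,1+d(x_0,x)))}\,d\mu(x)<\infty$. **Assumption A.** $\{A_t\}_{t>0}$ is a generalized approximation to the identity, that is, $A_tf(x)=\int_{\mathcal X}a_t(x,y)f(y)\,d\mu(y)$ with $|a_t(x,y)|\le\frac1{\mu(B(x,t^{1/m}))}g\big(\frac{[d(x,y)]^m}{t}\big)$ for all $t>0$ and $x,y\in\mathcal X$, where $g$ is positive, bounded, decreasing and $\lim_{r\to\infty}r^Mg(r^m)=0$; $A_0:=I$ (identity), $A_tA_sf=A_{t+s}f$ almost everywhere for all $s,t\in[0,\infty)$ and $f\in\mathcal M(\mathcal X)$, and in addition $M>n_0+\frac{2n_0p(\varphi)}{i(\varphi)}+N_0-\frac{n_0[r(\varphi)-1]}{r(\varphi)}-\alpha_0.$ **Spaces.** For $\widetilde p\in[1,\infty)$, $\mathrm{BMO}^{\varphi,\,\widetilde p}_A(\mathcal X)$ is the set of $f\in\mathcal M(\mathcal X)$ with $$\|f\|_{\mathrm{BMO}^{\varphi,\,\widetilde p}_A(\mathcal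 X)}=\sup_{B}\frac{\mu(B)}{\|\chi_B\|_{L^\varphi(\mathcal X)}}\left\{\frac1{\mu(B)}\int_B|f(x)-A_{t_B}f(x)|^{\widetilde p}\,d\mu(x)\right\}^{1/\widetilde p}<\infty,$$ the supremum over all balls $B\subset\mathcal X$, $t_B:=r_B^m$, $r_B$ the radius of $B$. (For $\widetilde p=1$ this is the space $\mathrm{BMO}^\varphi_A(\mathcal X)$.) *)

theory Defs
  imports "HOL-Analysis.Analysis" "HOL-Probability.Essential_Supremum"
begin

text \<open>The underlying set is the whole type. A ball is always understood together with its
  centre and radius; suprema over balls are suprema over all centres and all radii.\<close>

definition qball :: "('a \<Rightarrow> 'a \<Rightarrow> real) \<Rightarrow> 'a \<Rightarrow> real \<Rightarrow> 'a set" where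
  "qball d x r = {y. d y x < r}"

text \<open>The topology of a quasi-metric. Balls need not be open in it, nor even Borel.\<close>

definition qopen :: "('a \<Rightarrow> 'a \<Rightarrow> real) \<Rightarrow> 'a set \<Rightarrow> bool" where
  "qopen d U \<longleftrightarrow> (\<forall>x\<in>U. \<exists>r>0. qball d x r \<subseteq> U)"

definition qdiam :: "('a \<Rightarrow> 'a \<Rightarrow> real) \<Rightarrow> ereal" where
  "qdiam d = (SUP x. SUP y. ereal (d x y))"

locale homogeneous_type_space =
  fixes d :: "'a \<Rightarrow> 'a \<Rightarrow> real" and \<mu> :: "'a measure"
  assumes dist_nonneg: "d x y \<ge> 0"
    and dist_eq_0: "d x y = 0 \<longleftrightarrow> x = y"
    and dist_sym: "d x y = d y x"
    and quasi_triangle: "\<exists>C1\<ge>1. \<forall>x y z. d x y \<le> C1 * (d x z + d z y)"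
    and sets_borel: "sets \<mu> = sigma_sets UNIV {U. qopen d U}"
    and ball_measurable: "r > 0 \<Longrightarrow> qball d x r \<in> sets \<mu>"
    and ball_positive: "r > 0 \<Longrightarrow> emeasure \<mu> (qball d x r) > 0"
    and ball_finite: "r > 0 \<Longrightarrow> emeasure \<mu> (qball d x r) < \<infinity>"
    and doubling: "\<exists>C2\<ge>1. \<forall>x r. r > 0 \<longrightarrow>
      emeasure \<mu> (qball d x (2 * r)) \<le> ennreal C2 * emeasure \<mu> (qball d x r)"

definition cond_D :: "('a \<Rightarrow> 'a \<Rightarrow> real) \<Rightarrow> 'a measure \<Rightarrow> real \<Rightarrow> bool" where
  "cond_D d \<mu> n \<longleftrightarrow> (\<exists>C. \<forall>x r l. r > 0 \<longrightarrow> l \<ge> 1 \<longrightarrow>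
     measure \<mu> (qball d x (l * r)) \<le> C * l powr n * measure \<mu> (qball d x r))"

definition cond_E :: "('a \<Rightarrow> 'a \<Rightarrow> real) \<Rightarrow> 'a measure \<Rightarrow> real \<Rightarrow> bool" where
  "cond_E d \<mu> N \<longleftrightarrow> (\<exists>C. \<forall>x y r. r > 0 \<longrightarrow>
     measure \<mu> (qball d y r) \<le> C * (1 + d x y / r) powr N * measure \<mu> (qball d x r))"

definition cond_R :: "('a \<Rightarrow> 'a \<Rightarrow> real) \<Rightarrow> 'a measure \<Rightarrow> real \<Rightarrow> bool" where
  "cond_R d \<mu> \<alpha> \<longleftrightarrow> (\<exists>C\<ge>1. \<forall>x r l.
     0 < r \<and> ereal r < 2 * qdiam d \<and> 1 \<le> l \<and> ereal l < 2 * qdiam d / ereal r \<longrightarrow>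
     inverse C * l powr \<alpha> * measure \<mu> (qball d x r) \<le> measure \<mu> (qball d x (l * r)))"

definition dim_n0 :: "('a \<Rightarrow> 'a \<Rightarrow> real) \<Rightarrow> 'a measure \<Rightarrow> real" where
  "dim_n0 d \<mu> = Inf {n. 0 < n \<and> cond_D d \<mu> n}"

definition dim_N0 :: "('a \<Rightarrow> 'a \<Rightarrow> real) \<Rightarrow> 'a measure \<Rightarrow> real" where
  "dim_N0 d \<mu> = Inf {N. 0 \<le> N \<and> cond_E d \<mu> N}"

text \<open>The requirement \<open>\<alpha> \<in> [0, n]\<close> is imposed for every \<open>n\<close> admissible in \<open>cond_D\<close>. It follows from
  \<open>cond_R\<close> unless the space is a single point; there \<open>cond_R\<close> is vacuous and the
  requirement keeps the supremum finite (namely \<open>0\<close>).\<close>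

definition dim_alpha0 :: "('a \<Rightarrow> 'a \<Rightarrow> real) \<Rightarrow> 'a measure \<Rightarrow> real" where
  "dim_alpha0 d \<mu> =
     Sup {\<alpha>. 0 \<le> \<alpha> \<and> (\<forall>n. 0 < n \<and> cond_D d \<mu> n \<longrightarrow> \<alpha> \<le> n) \<and> cond_R d \<mu> \<alpha>}"

text \<open>A function \<open>\<X> \<times> [0,\<infinity>) \<rightarrow> [0,\<infinity>)\<close> is a function \<open>'a \<Rightarrow> real \<Rightarrow> real\<close>, of which only the values
  at nonnegative second arguments are ever used.\<close>

definition uniformly_upper_type :: "('a \<Rightarrow> real \<Rightarrow> real) \<Rightarrow> real \<Rightarrow> bool" where
  "uniformly_upper_type \<phi> p \<longleftrightarrow>
     (\<exists>C. \<forall>x t s. t \<ge> 0 \<longrightarrow> s \<ge> 1 \<longrightarrow> \<phi> x (s * t) \<le> C * s powr p * \<phi> x t)"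

definition uniformly_lower_type :: "('a \<Rightarrow> real \<Rightarrow> real) \<Rightarrow> real \<Rightarrow> bool" where
  "uniformly_lower_type \<phi> p \<longleftrightarrow>
     (\<exists>C. \<forall>x t s. t \<ge> 0 \<longrightarrow> 0 < s \<longrightarrow> s < 1 \<longrightarrow> \<phi> x (s * t) \<le> C * s powr p * \<phi> x t)"

text \<open>Real powers of extended nonnegative reals, meant for positive exponents only.\<close>

definition epowr :: "ennreal \<Rightarrow> real \<Rightarrow> ennreal" where
  "epowr x a = (if x = \<infinity> then \<infinity> else ennreal (enn2real x powr a))"

definition average :: "'a measure \<Rightarrow> 'a set \<Rightarrow> ('a \<Rightarrow> ennreal) \<Rightarrow> ennreal" where
  "average \<mu> B F = (\<integral>\<^sup>+x\<in>B. F x \<partial>\<mu>) / emeasure \<mu> B"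

definition esssup_on :: "'a measure \<Rightarrow> 'a set \<Rightarrow> ('a \<Rightarrow> ennreal) \<Rightarrow> ennreal" where
  "esssup_on \<mu> B F = esssup (restrict_space \<mu> B) F"

definition class_A :: "('a \<Rightarrow> 'a \<Rightarrow> real) \<Rightarrow> 'a measure \<Rightarrow> real \<Rightarrow> ('a \<Rightarrow> real \<Rightarrow> real) \<Rightarrow> bool" where
  "class_A d \<mu> p \<phi> \<longleftrightarrow>
     (SUP t\<in>{0<..}. SUP x. SUP r\<in>{0<..}.
        average \<mu> (qball d x r) (\<lambda>y. ennreal (\<phi> y t)) *
        (if p = 1 then esssup_on \<mu> (qball d x r) (\<lambda>y. ennreal (inverse (\<phi> y t)))
         else epowr (average \<mu> (qball d x r) (\<lambda>y. ennreal (\<phi> y t powr (- 1 / (p - 1))))) (p - 1)))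
     < \<infinity>"

definition class_A_infty :: "('a \<Rightarrow> 'a \<Rightarrow> real) \<Rightarrow> 'a measure \<Rightarrow> ('a \<Rightarrow> real \<Rightarrow> real) \<Rightarrow> bool" where
  "class_A_infty d \<mu> \<phi> \<longleftrightarrow> (\<exists>p\<ge>1. class_A d \<mu> p \<phi>)"

definition class_RH :: "('a \<Rightarrow> 'a \<Rightarrow> real) \<Rightarrow> 'a measure \<Rightarrow> ereal \<Rightarrow> ('a \<Rightarrow> real \<Rightarrow> real) \<Rightarrow> bool" where
  "class_RH d \<mu> q \<phi> \<longleftrightarrow>
     (SUP t\<in>{0<..}. SUP x. SUP r\<in>{0<..}.
        (if q = \<infinity> then esssup_on \<mu> (qball d x r) (\<lambda>y. ennreal (\<phi> y t))
         else epowr (average \<mu> (qball d x r) (\<lambda>y. ennreal (\<phi> y t powr real_of_ereal q)))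
                (1 / real_of_ereal q)) *
        inverse (average \<mu> (qball d x r) (\<lambda>y. ennreal (\<phi> y t))))
     < \<infinity>"

definition orlicz_function :: "(real \<Rightarrow> real) \<Rightarrow> bool" where
  "orlicz_function \<Phi> \<longleftrightarrow> mono_on {0..} \<Phi> \<and> \<Phi> 0 = 0 \<and> (\<forall>t>0. \<Phi> t > 0) \<and> filterlim \<Phi> at_top at_top"

definition growth_function :: "('a \<Rightarrow> 'a \<Rightarrow> real) \<Rightarrow> 'a measure \<Rightarrow> ('a \<Rightarrow> real \<Rightarrow> real) \<Rightarrow> bool" where
  "growth_function d \<mu> \<phi> \<longleftrightarrow>
     (\<forall>x. orlicz_function (\<phi> x)) \<and>
     (\<forall>t\<ge>0. (\<lambda>x. \<phi> x t) \<in> borel_measurable \<mu>) \<and>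
     class_A_infty d \<mu> \<phi> \<and>
     uniformly_upper_type \<phi> 1 \<and>
     (\<exists>p. 0 < p \<and> p \<le> 1 \<and> uniformly_lower_type \<phi> p)"

definition index_i :: "('a \<Rightarrow> real \<Rightarrow> real) \<Rightarrow> real" where
  "index_i \<phi> = Sup {p. 0 < p \<and> uniformly_lower_type \<phi> p}"

definition index_p :: "('a \<Rightarrow> 'a \<Rightarrow> real) \<Rightarrow> 'a measure \<Rightarrow> ('a \<Rightarrow> real \<Rightarrow> real) \<Rightarrow> real" where
  "index_p d \<mu> \<phi> = Inf {p. 1 \<le> p \<and> class_A d \<mu> p \<phi>}"

definition index_r :: "('a \<Rightarrow> 'a \<Rightarrow> real) \<Rightarrow> 'a measure \<Rightarrow> ('a \<Rightarrow> real \<Rightarrow> real) \<Rightarrow> ereal" where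
  "index_r d \<mu> \<phi> = Sup {q. 1 < q \<and> class_RH d \<mu> q \<phi>}"

text \<open>The quotient \<open>(r - 1) / r\<close>, equal to \<open>1\<close> at \<open>r = \<infinity>\<close>.\<close>

definition rh_quotient :: "ereal \<Rightarrow> real" where
  "rh_quotient r = (if r = \<infinity> then 1 else (real_of_ereal r - 1) / real_of_ereal r)"

text \<open>The Luxemburg functional, with value \<open>\<infinity>\<close> if no \<open>\<lambda>\<close> is admissible.\<close>

definition lux_norm ::
  "'a measure \<Rightarrow> ('a \<Rightarrow> real \<Rightarrow> real) \<Rightarrow> ('a \<Rightarrow> 'b::real_normed_vector) \<Rightarrow> ennreal" where
  "lux_norm \<mu> \<phi> f =
     Inf {ennreal l |l. l > 0 \<and> (\<integral>\<^sup>+x. ennreal (\<phi> x (norm (f x) / l)) \<partial>\<mu>) \<le> 1}"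

definition chi_norm :: "'a measure \<Rightarrow> ('a \<Rightarrow> real \<Rightarrow> real) \<Rightarrow> 'a set \<Rightarrow> ennreal" where
  "chi_norm \<mu> \<phi> B = lux_norm \<mu> \<phi> (indicator B :: 'a \<Rightarrow> real)"

definition test_space_at :: "('a \<Rightarrow> 'a \<Rightarrow> real) \<Rightarrow> 'a measure \<Rightarrow> ('a \<Rightarrow> real \<Rightarrow> real) \<Rightarrow>
    'a \<Rightarrow> real \<Rightarrow> ('a \<Rightarrow> complex) set" where
  "test_space_at d \<mu> \<phi> x0 \<beta> = {f. f \<in> borel_measurable \<mu> \<and>
     (\<forall>x r. r > 0 \<longrightarrow> set_integrable \<mu> (qball d x r) f) \<and>
     (\<integral>\<^sup>+x. ennreal (norm (f x) /
        ((1 + d x0 x) powr (dim_n0 d \<mu> * index_p d \<mu> \<phi> / index_i \<phi> - dim_alpha0 d \<mu> + \<beta>) *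
         measure \<mu> (qball d x0 (1 + d x0 x)))) \<partial>\<mu>) < \<infinity>}"

definition test_space :: "('a \<Rightarrow> 'a \<Rightarrow> real) \<Rightarrow> 'a measure \<Rightarrow> ('a \<Rightarrow> real \<Rightarrow> real) \<Rightarrow>
    real \<Rightarrow> ('a \<Rightarrow> complex) set" where
  "test_space d \<mu> \<phi> M =
     (\<Union>x0. \<Union>\<beta>\<in>{0 <..< M - dim_n0 d \<mu> * (1 + index_p d \<mu> \<phi> / index_i \<phi>) + dim_alpha0 d \<mu>}.
        test_space_at d \<mu> \<phi> x0 \<beta>)"

definition kernel_op :: "'a measure \<Rightarrow> (real \<Rightarrow> 'a \<Rightarrow> 'a \<Rightarrow> complex) \<Rightarrow> real \<Rightarrow>
    ('a \<Rightarrow> complex) \<Rightarrow> 'a \<Rightarrow> complex" where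
  "kernel_op \<mu> a t f x = (if t = 0 then f x else (\<integral>y. a t x y * f y \<partial>\<mu>))"

text \<open>Joint measurability of the kernels is the standing convention under which the integral
  operators are defined and map into measurable functions.\<close>

definition generalized_approximation_identity ::
  "('a \<Rightarrow> 'a \<Rightarrow> real) \<Rightarrow> 'a measure \<Rightarrow> ('a \<Rightarrow> real \<Rightarrow> real) \<Rightarrow>
   real \<Rightarrow> real \<Rightarrow> (real \<Rightarrow> real) \<Rightarrow> (real \<Rightarrow> 'a \<Rightarrow> 'a \<Rightarrow> complex) \<Rightarrow> bool" where
  "generalized_approximation_identity d \<mu> \<phi> M m g a \<longleftrightarrow>
     M > dim_n0 d \<mu> * (1 + index_p d \<mu> \<phi> / index_i \<phi>) - dim_alpha0 d \<mu> \<and>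
     m > 0 \<and>
     (\<forall>r\<ge>0. g r > 0) \<and> bounded (g ` {0..}) \<and> antimono_on {0..} g \<and>
     ((\<lambda>r. r powr M * g (r powr m)) \<longlongrightarrow> 0) at_top \<and>
     (\<forall>t>0. (\<lambda>(x, y). a t x y) \<in> borel_measurable (\<mu> \<Otimes>\<^sub>M \<mu>)) \<and>
     (\<forall>t>0. \<forall>x y. norm (a t x y) \<le>
        1 / measure \<mu> (qball d x (t powr (1 / m))) * g (d x y powr m / t))"

definition assumption_A ::
  "('a \<Rightarrow> 'a \<Rightarrow> real) \<Rightarrow> 'a measure \<Rightarrow> ('a \<Rightarrow> real \<Rightarrow> real) \<Rightarrow>
   real \<Rightarrow> real \<Rightarrow> (real \<Rightarrow> real) \<Rightarrow> (real \<Rightarrow> 'a \<Rightarrow> 'a \<Rightarrow> complex) \<Rightarrow> bool" where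
  "assumption_A d \<mu> \<phi> M m g a \<longleftrightarrow>
     generalized_approximation_identity d \<mu> \<phi> M m g a \<and>
     (\<forall>s\<ge>0. \<forall>t\<ge>0. \<forall>f\<in>test_space d \<mu> \<phi> M.
        AE x in \<mu>. kernel_op \<mu> a t (kernel_op \<mu> a s f) x = kernel_op \<mu> a (t + s) f x) \<and>
     M > dim_n0 d \<mu> + 2 * dim_n0 d \<mu> * index_p d \<mu> \<phi> / index_i \<phi> + dim_N0 d \<mu>
         - dim_n0 d \<mu> * rh_quotient (index_r d \<mu> \<phi>) - dim_alpha0 d \<mu>"

definition BMO_norm :: "('a \<Rightarrow> 'a \<Rightarrow> real) \<Rightarrow> 'a measure \<Rightarrow> ('a \<Rightarrow> real \<Rightarrow> real) \<Rightarrow>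
    real \<Rightarrow> (real \<Rightarrow> 'a \<Rightarrow> 'a \<Rightarrow> complex) \<Rightarrow> real \<Rightarrow> ('a \<Rightarrow> complex) \<Rightarrow> ennreal" where
  "BMO_norm d \<mu> \<phi> m a p f = (SUP x. SUP r\<in>{0<..}.
     emeasure \<mu> (qball d x r) / chi_norm \<mu> \<phi> (qball d x r) *
     epowr (average \<mu> (qball d x r)
              (\<lambda>y. ennreal (norm (f y - kernel_op \<mu> a (r powr m) f y) powr p))) (1 / p))"

definition BMO_space :: "('a \<Rightarrow> 'a \<Rightarrow> real) \<Rightarrow> 'a measure \<Rightarrow> ('a \<Rightarrow> real \<Rightarrow> real) \<Rightarrow>
    real \<Rightarrow> real \<Rightarrow> (real \<Rightarrow> 'a \<Rightarrow> 'a \<Rightarrow> complex) \<Rightarrow> real \<Rightarrow> ('a \<Rightarrow> complex) set" where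
  "BMO_space d \<mu> \<phi> M m a p = {f \<in> test_space d \<mu> \<phi> M. BMO_norm d \<mu> \<phi> m a p f < \<infinity>}"

end

(*
The passage from a larger exponent to exponent 1 is elementary; the converse is a John-Nirenberg
inequality. Put psi(B) = ||chi_B|| / mu(B). By hypothesis psi is almost increasing, and a
Muckenhoupt class together with a lower type gives mu psi(l B) <= C l^kappa mu psi(B) with
kappa = n p / i < M. Hence the kernel of A_t decays faster than psi grows, and with
A_t f - A_(t+s) f = A_t (f - A_s f) the averages of |f - A_(t_B) f| up to a stopping radius
control |A_(t_B') f - A_(t_B) f| on the stopping balls B'. The stopping balls of B cover, up to a
null set, the part of B where |f - A_(t_B) f| is large, and their total measure is at most
mu(B) / 2; so iterating gives exponential decay of the distribution function of |f - A_(t_B) f| / psi(B).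
*)

theory Submission
  imports Defs "HOL-Real_Asymp.Real_Asymp"
begin

section \<open>Coverings\<close>

text \<open>Two scales are never compared directly: both operators are compared with the one at the
  sum t + s of the times, which leaves A_t (f - A_s f) and A_s (f - A_t f). With t the time of a
  stopping ball and s that of B, the first sets a fine kernel against a coarse oscillation and is
  the one that needs the stopping rule; the second sets a coarse kernel against a fine oscillation
  and is bounded by covering alone. Stopping balls stick out of B. The stopping height is therefore
  so large that stopping radii are below r / (4 K^2); the 2 K dilates produced by the covering then
  have radius at most r / (2 K), all generations stay inside one ball, and a single number \<Lambda>
  bounds N \<psi> in all of them. Balls need not be open, so differentiation of integrals is
  replaced by a covering argument with outer regularity, for which radii are restricted to r / 2^k.
  The critical indices are infima and suprema that need not be attained. So \<kappa> is formed with
  admissible n, p, i close to them, for which the strict lower bound on M leaves room.\<close>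

text \<open>Greedy choice in order of increasing rank, made by Zorn's lemma. The invariant
  \<open>good\<close> speaks only of members of \<open>F\<close> that already meet the family, so it
  passes to unions of chains. A maximal family meets every member, since an unmet index of least
  rank could be added.\<close>

lemma disjoint_subfamily_by_rank:
  fixes S :: "'i \<Rightarrow> 'b set" and rank :: "'i \<Rightarrow> nat"
  assumes ne: "\<And>j. j \<in> F \<Longrightarrow> S j \<noteq> {}"
  obtains I where "I \<subseteq> F" "disjoint_family_on S I"
    "\<And>j. j \<in> F \<Longrightarrow> \<exists>i\<in>I. rank i \<le> rank j \<and> S i \<inter> S j \<noteq> {}"
proof -
  define good where "good I \<longleftrightarrow> I \<subseteq> F \<and> disjoint_family_on S I \<and>
    (\<forall>j\<in>F. (\<exists>i\<in>I. S i \<inter> S j \<noteq> {}) \<longrightarrow> (\<exists>i\<in>I. rank i \<le> rank j \<and> S i \<inter> S j \<noteq> {}))" for I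
  have "\<exists>I\<in>Collect good. \<forall>J\<in>Collect good. I \<subseteq> J \<longrightarrow> J = I"
  proof (rule subset_Zorn')
    fix \<C> assume "subset.chain (Collect good) \<C>"
    then have sub: "\<C> \<subseteq> Collect good" and tot: "\<And>X Y. X \<in> \<C> \<Longrightarrow> Y \<in> \<C> \<Longrightarrow> X \<subseteq> Y \<or> Y \<subseteq> X"
      by (auto simp: subset_chain_def)
    have "disjoint_family_on S (\<Union>\<C>)"
      unfolding disjoint_family_on_def
    proof (intro ballI impI)
      fix i j assume "i \<in> \<Union>\<C>" "j \<in> \<Union>\<C>" "i \<noteq> j"
      then obtain X where "X \<in> \<C>" "i \<in> X" "j \<in> X" using tot by blast
      then show "S i \<inter> S j = {}"
        using sub \<open>i \<noteq> j\<close> unfolding good_def disjoint_family_on_def by blast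
    qed
    moreover have "\<Union>\<C> \<subseteq> F" using sub unfolding good_def by blast
    moreover have "\<exists>i\<in>\<Union>\<C>. rank i \<le> rank j \<and> S i \<inter> S j \<noteq> {}"
      if j: "j \<in> F" "\<exists>i\<in>\<Union>\<C>. S i \<inter> S j \<noteq> {}" for j
    proof -
      obtain X i where X: "X \<in> \<C>" "i \<in> X" "S i \<inter> S j \<noteq> {}" using j by blast
      then have "good X" using sub by blast
      then have "\<exists>i\<in>X. rank i \<le> rank j \<and> S i \<inter> S j \<noteq> {}"
        using j(1) X(2,3) unfolding good_def by blast
      then show ?thesis using X(1) by blast
    qed
    ultimately show "\<Union>\<C> \<in> Collect good" by (simp add: good_def)
  qed
  then obtain I where I: "good I" and max: "\<And>J. good J \<Longrightarrow> I \<subseteq> J \<Longrightarrow> J = I" by auto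
  have meets: "\<exists>i\<in>I. S i \<inter> S j \<noteq> {}" if "j \<in> F" for j
  proof (rule ccontr)
    assume "\<not> ?thesis"
    with that have ex: "\<exists>j. j \<in> F \<and> (\<forall>i\<in>I. S i \<inter> S j = {})" by blast
    obtain j0 where j0: "j0 \<in> F" "\<forall>i\<in>I. S i \<inter> S j0 = {}"
      and least: "\<And>k. k \<in> F \<Longrightarrow> (\<forall>i\<in>I. S i \<inter> S k = {}) \<Longrightarrow> rank j0 \<le> rank k"
      using exists_least_lemma[of "\<lambda>_. False"] ex
        ex_has_least_nat[of "\<lambda>j. j \<in> F \<and> (\<forall>i\<in>I. S i \<inter> S j = {})" _ rank]
      by metis
    have "good (insert j0 I)"
      unfolding good_def
    proof (intro conjI ballI impI)
      show "insert j0 I \<subseteq> F" using I j0 by (auto simp: good_def)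
      show "disjoint_family_on S (insert j0 I)"
        using I j0 by (auto simp: good_def disjoint_family_on_def)
      fix k assume k: "k \<in> F" "\<exists>i\<in>insert j0 I. S i \<inter> S k \<noteq> {}"
      show "\<exists>i\<in>insert j0 I. rank i \<le> rank k \<and> S i \<inter> S k \<noteq> {}"
      proof (cases "\<exists>i\<in>I. S i \<inter> S k \<noteq> {}")
        case True
        then show ?thesis using I k(1) unfolding good_def by blast
      next
        case False
        then show ?thesis using k least[OF k(1)] by blast
      qed
    qed
    then have "j0 \<in> I" using max[of "insert j0 I"] by blast
    then show False using j0 ne by blast
  qed
  show ?thesis
    by (rule that[of I]) (use I meets in \<open>auto simp: good_def\<close>)
qed

text \<open>With \<open>sum_disjoint_le_nn_integral\<close> this brackets the covering arguments:
  dilated balls cover, the original ones are disjoint. Sums over the countable index set are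
  integrals against \<open>count_space\<close>, so that Tonelli applies without an
  enumeration.\<close>

lemma nn_integral_le_sum_cover:
  fixes h :: "'a \<Rightarrow> ennreal"
  assumes "countable I" and S: "\<And>i. i \<in> I \<Longrightarrow> S i \<in> sets M" and [measurable]: "h \<in> borel_measurable M"
    and cov: "A \<subseteq> (\<Union>i\<in>I. S i)"
  shows "(\<integral>\<^sup>+x\<in>A. h x \<partial>M) \<le> (\<integral>\<^sup>+i. (\<integral>\<^sup>+x\<in>S i. h x \<partial>M) \<partial>count_space I)"
proof -
  have "(\<integral>\<^sup>+x\<in>A. h x \<partial>M) \<le> (\<integral>\<^sup>+x. \<integral>\<^sup>+i. h x * indicator (S i) x \<partial>count_space I \<partial>M)"
  proof (intro nn_integral_mono)
    fix x
    show "h x * indicator A x \<le> (\<integral>\<^sup>+i. h x * indicator (S i) x \<partial>count_space I)"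
    proof (cases "x \<in> A")
      case True
      then obtain i where "i \<in> I" "x \<in> S i" using cov by blast
      then have "h x * indicator A x \<le> h x * indicator (S i) x" using True by simp
      also have "\<dots> \<le> (\<integral>\<^sup>+i. h x * indicator (S i) x \<partial>count_space I)"
        using \<open>i \<in> I\<close> by (rule nn_integral_ge_point)
      finally show ?thesis .
    qed simp
  qed
  also have "\<dots> = (\<integral>\<^sup>+i. (\<integral>\<^sup>+x. h x * indicator (S i) x \<partial>M) \<partial>count_space I)"
    using assms by (intro nn_integral_count_space_nn_integral) auto
  finally show ?thesis .
qed

lemma sum_disjoint_le_nn_integral:
  fixes h :: "'a \<Rightarrow> ennreal"
  assumes "countable I" and S: "\<And>i. i \<in> I \<Longrightarrow> S i \<in> sets M" and [measurable]: "h \<in> borel_measurable M"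
    and disj: "disjoint_family_on S I" and sub: "\<And>i. i \<in> I \<Longrightarrow> S i \<subseteq> A"
  shows "(\<integral>\<^sup>+i. (\<integral>\<^sup>+x\<in>S i. h x \<partial>M) \<partial>count_space I) \<le> (\<integral>\<^sup>+x\<in>A. h x \<partial>M)"
proof -
  have "(\<integral>\<^sup>+i. (\<integral>\<^sup>+x. h x * indicator (S i) x \<partial>M) \<partial>count_space I) =
      (\<integral>\<^sup>+x. \<integral>\<^sup>+i. h x * indicator (S i) x \<partial>count_space I \<partial>M)"
    using assms by (intro nn_integral_count_space_nn_integral[symmetric]) auto
  also have "\<dots> \<le> (\<integral>\<^sup>+x\<in>A. h x \<partial>M)"
  proof (intro nn_integral_mono)
    fix x
    show "(\<integral>\<^sup>+i. h x * indicator (S i) x \<partial>count_space I) \<le> h x * indicator A x"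
    proof (cases "\<exists>i\<in>I. x \<in> S i")
      case True
      then obtain i where i: "i \<in> I" "x \<in> S i" by blast
      have "(\<integral>\<^sup>+j. h x * indicator (S j) x \<partial>count_space I) = (\<integral>\<^sup>+j. h x * indicator {i} j \<partial>count_space I)"
        using i disj by (intro nn_integral_cong) (auto simp: disjoint_family_on_def indicator_def)
      also have "\<dots> = h x"
        using i by (simp add: nn_integral_cmult_indicator)
      finally show ?thesis using sub[OF i(1)] i(2) by auto
    next
      case False
      then have "(\<integral>\<^sup>+i. h x * indicator (S i) x \<partial>count_space I) = (\<integral>\<^sup>+i. 0 \<partial>count_space I)"
        by (intro nn_integral_cong) auto
      then show ?thesis by simp
    qed
  qed
  finally show ?thesis .
qed

text \<open>The measures have bounded finite partial sums, hence are summable, and a summable family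
  has only countably many nonzero terms.\<close>

lemma countable_disjoint_family_pos:
  assumes S: "\<And>i. i \<in> I \<Longrightarrow> S i \<in> sets M" and pos: "\<And>i. i \<in> I \<Longrightarrow> emeasure M (S i) > 0"
    and disj: "disjoint_family_on S I" and sub: "\<And>i. i \<in> I \<Longrightarrow> S i \<subseteq> A"
    and A: "A \<in> fmeasurable M"
  shows "countable I"
proof -
  have fm: "S i \<in> fmeasurable M" if "i \<in> I" for i
    using fmeasurableI2[OF A sub[OF that] S[OF that]] .
  have mpos: "measure M (S i) > 0" if "i \<in> I" for i
    using pos[OF that] fm[OF that] by (metis emeasure_eq_measure2 ennreal_less_zero_iff)
  have "(\<lambda>i. measure M (S i)) summable_on I"
  proof (rule nonneg_bdd_above_summable_on)
    show "bdd_above (sum (\<lambda>i. measure M (S i)) ` {F. F \<subseteq> I \<and> finite F})"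
    proof (rule bdd_aboveI2)
      fix F assume "F \<in> {F. F \<subseteq> I \<and> finite F}"
      then have F: "F \<subseteq> I" "finite F" by auto
      have "(\<Sum>i\<in>F. measure M (S i)) = measure M (\<Union>i\<in>F. S i)"
        using F fm by (intro measure_finite_Union[symmetric] disjoint_family_on_mono[OF _ disj])
          (auto simp: fmeasurable_def less_top)
      also have "\<dots> \<le> measure M A"
        using F fm sub by (intro measure_mono_fmeasurable[OF _ _ A]) (auto intro!: sets.finite_UN S)
      finally show "(\<Sum>i\<in>F. measure M (S i)) \<le> measure M A" .
    qed
  qed simp
  then have "countable {i\<in>I. measure M (S i) \<noteq> 0}"
    by (rule summable_countable_real)
  moreover have "{i\<in>I. measure M (S i) \<noteq> 0} = I" using mpos by (force)
  ultimately show ?thesis by simp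
qed

section \<open>Quasi-metric balls and their measures\<close>

context homogeneous_type_space
begin

abbreviation vol :: "'a \<Rightarrow> real \<Rightarrow> real" where
  "vol x r \<equiv> measure \<mu> (qball d x r)"

lemma space_eq_UNIV: "space \<mu> = UNIV"
proof -
  have "UNIV \<in> sets \<mu>"
    unfolding sets_borel by (intro sigma_sets.Basic) (auto simp: qopen_def intro!: exI[of _ 1])
  then show ?thesis using sets.sets_into_space by blast
qed

lemma sets_qopen: "qopen d U \<Longrightarrow> U \<in> sets \<mu>"
  unfolding sets_borel by (intro sigma_sets.Basic) auto

lemma mem_qball: "y \<in> qball d x r \<longleftrightarrow> d y x < r"
  by (simp add: qball_def)

lemma dist_self [simp]: "d x x = 0"
  by (simp add: dist_eq_0)

lemma centre_in_qball: "r > 0 \<Longrightarrow> x \<in> qball d x r"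
  by (simp add: mem_qball)

lemma qball_mono: "r \<le> s \<Longrightarrow> qball d x r \<subseteq> qball d x s"
  by (auto simp: mem_qball)

lemma qball_nonpos: "r \<le> 0 \<Longrightarrow> qball d x r = {}"
proof -
  assume "r \<le> 0"
  then have "\<not> d y x < r" for y using dist_nonneg[of y x] by linarith
  then show ?thesis by (auto simp: mem_qball)
qed

lemma sets_qball [measurable, simp]: "qball d x r \<in> sets \<mu>"
  using ball_measurable[of r x] qball_nonpos[of r x] by (cases "r > 0") auto

lemma emeasure_qball_finite: "emeasure \<mu> (qball d x r) < \<infinity>"
  using ball_finite[of r x] qball_nonpos[of r x] by (cases "r > 0") auto

lemma fmeasurable_qball [simp]: "qball d x r \<in> fmeasurable \<mu>"
  using emeasure_qball_finite[of x r] by (intro fmeasurableI) auto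

lemma emeasure_qball: "emeasure \<mu> (qball d x r) = ennreal (vol x r)"
  using emeasure_qball_finite[of x r] by (intro emeasure_eq_ennreal_measure) auto

lemma vol_pos: "r > 0 \<Longrightarrow> vol x r > 0"
  using ball_positive[of r x] by (simp add: emeasure_qball)

lemma vol_mono: "qball d x r \<subseteq> qball d y s \<Longrightarrow> vol x r \<le> vol y s"
  by (intro measure_mono_fmeasurable) auto

lemma sigma_finite: "sigma_finite_measure \<mu>"
proof
  fix x0 :: 'a
  show "\<exists>A. countable A \<and> A \<subseteq> sets \<mu> \<and> \<Union>A = space \<mu> \<and> (\<forall>a\<in>A. emeasure \<mu> a \<noteq> \<infinity>)"
  proof (intro exI conjI)
    show "countable (range (\<lambda>n::nat. qball d x0 (real n)))" by simp
    show "\<Union>(range (\<lambda>n::nat. qball d x0 (real n))) = space \<mu>"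
      using reals_Archimedean2 by (auto simp: mem_qball space_eq_UNIV)
    show "\<forall>a\<in>range (\<lambda>n::nat. qball d x0 (real n)). emeasure \<mu> a \<noteq> \<infinity>"
      using emeasure_qball_finite by (auto simp: less_top)
  qed auto
qed

end

locale homogeneous_type_quasi_constant = homogeneous_type_space +
  fixes K :: real
  assumes K_ge_1: "K \<ge> 1" and quasi_triangle_K: "d x y \<le> K * (d x z + d z y)"
begin

lemma K_pos: "K > 0"
  using K_ge_1 by simp

lemma dist_less_quasi: "d x z < r \<Longrightarrow> d z y < s \<Longrightarrow> d x y < K * (r + s)"
  using quasi_triangle_K[of x y z] K_pos
  by (smt (verit) mult_less_cancel_left_pos)

lemma qball_subset_qball:
  assumes "d x y < s"
  shows "qball d x r \<subseteq> qball d y (K * (r + s))"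
  using dist_less_quasi assms by (auto simp: mem_qball)

text \<open>Two steps of length \<open>s / (2 * K)\<close> stay within \<open>s\<close>, so an
  interior point has a ball of interior points. This supplies open sets where balls may fail to be
  open, and closures as complements of interiors.\<close>

lemma qopen_interior:
  "qopen d {y. \<exists>s>0. qball d y s \<subseteq> A}"
  unfolding qopen_def
proof safe
  fix x s assume s: "s > 0" "qball d x s \<subseteq> A"
  have *: "K * (s / (2 * K) + s / (2 * K)) = s" using K_pos by (simp add: field_simps)
  have sub: "qball d y (s / (2 * K)) \<subseteq> A" if "y \<in> qball d x (s / (2 * K))" for y
    using qball_subset_qball[of y x "s / (2 * K)" "s / (2 * K)"] that s(2) unfolding mem_qball * by blast
  show "\<exists>r>0. qball d x r \<subseteq> {y. \<exists>s>0. qball d y s \<subseteq> A}"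
  proof (rule exI[of _ "s / (2 * K)"], intro conjI subsetI CollectI)
    show pos: "0 < s / (2 * K)" using s K_pos by auto
    show "\<exists>s>0. qball d y s \<subseteq> A" if "y \<in> qball d x (s / (2 * K))" for y
      using sub[OF that] pos by blast
  qed
qed

lemma qopen_Union: "(\<And>U. U \<in> \<U> \<Longrightarrow> qopen d U) \<Longrightarrow> qopen d (\<Union>\<U>)"
  unfolding qopen_def by (meson UnionE Union_upper order_trans)

lemma qopen_Int: "qopen d U \<Longrightarrow> qopen d V \<Longrightarrow> qopen d (U \<inter> V)"
  unfolding qopen_def
proof safe
  fix x assume "\<forall>x\<in>U. \<exists>r>0. qball d x r \<subseteq> U" "\<forall>x\<in>V. \<exists>r>0. qball d x r \<subseteq> V" "x \<in> U" "x \<in> V"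
  then obtain r s where "r > 0" "qball d x r \<subseteq> U" "s > 0" "qball d x s \<subseteq> V" by blast
  then show "\<exists>r>0. qball d x r \<subseteq> U \<inter> V"
    by (intro exI[of _ "min r s"]) (auto simp: mem_qball subset_iff)
qed

text \<open>Stand-in for the Vitali \<open>5r\<close>-covering lemma; the discrete scales \<open>\<rho> / 2 ^ k y\<close> make a
  greedy choice of radii possible.\<close>

lemma vitali_cover:
  assumes "\<rho> > 0" and E: "E \<subseteq> qball d x0 R"
  obtains I where "I \<subseteq> E" "countable I" "disjoint_family_on (\<lambda>y. qball d y (\<rho> / 2 ^ k y)) I"
    "E \<subseteq> (\<Union>y\<in>I. qball d y (2 * K * (\<rho> / 2 ^ k y)))"
proof -
  have ne: "qball d y (\<rho> / 2 ^ k y) \<noteq> {}" for y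
    using centre_in_qball[of "\<rho> / 2 ^ k y" y] \<open>\<rho> > 0\<close> by auto
  obtain I where I: "I \<subseteq> E" "disjoint_family_on (\<lambda>y. qball d y (\<rho> / 2 ^ k y)) I"
    "\<And>j. j \<in> E \<Longrightarrow> \<exists>i\<in>I. k i \<le> k j \<and> qball d i (\<rho> / 2 ^ k i) \<inter> qball d j (\<rho> / 2 ^ k j) \<noteq> {}"
    by (rule disjoint_subfamily_by_rank[of E "\<lambda>y. qball d y (\<rho> / 2 ^ k y)" k, OF ne]) (rule that)
  have "countable I"
  proof (rule countable_disjoint_family_pos[OF _ _ I(2), where A = "qball d x0 (K * (\<rho> + R))" and M = \<mu>])
    fix i assume "i \<in> I"
    then have "d i x0 < R" using I(1) E by (auto simp: mem_qball)
    moreover have "\<rho> / 2 ^ k i \<le> \<rho>" using \<open>\<rho> > 0\<close> by (simp add: field_simps)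
    ultimately show "qball d i (\<rho> / 2 ^ k i) \<subseteq> qball d x0 (K * (\<rho> + R))"
      using qball_subset_qball[of i x0 R \<rho>] qball_mono[of "\<rho> / 2 ^ k i" \<rho> i] by blast
  qed (use \<open>\<rho> > 0\<close> in \<open>auto intro!: ball_positive\<close>)
  \<comment> \<open>Only centres have to be covered, so one use of the quasi-triangle inequality is
    enough and the dilation is by 2 K. The selected ball that meets the ball of \<open>j\<close> has
    no smaller radius, as its exponent is no larger.\<close>
  moreover have "E \<subseteq> (\<Union>y\<in>I. qball d y (2 * K * (\<rho> / 2 ^ k y)))"
  proof
    fix j assume "j \<in> E"
    then obtain i z where i: "i \<in> I" "k i \<le> k j" "d z i < \<rho> / 2 ^ k i" "d z j < \<rho> / 2 ^ k j"
      using I(3)[of j] by (auto simp: mem_qball)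
    have "\<rho> / 2 ^ k j \<le> \<rho> / 2 ^ k i"
      using i(2) \<open>\<rho> > 0\<close> by (intro divide_left_mono power_increasing) auto
    then have "d j z < \<rho> / 2 ^ k i" using i dist_sym by (metis order_less_le_trans)
    from dist_less_quasi[OF this i(3)] show "j \<in> (\<Union>y\<in>I. qball d y (2 * K * (\<rho> / 2 ^ k y)))"
      using i(1) by (auto simp: mem_qball mult_ac intro!: bexI[of _ i])
  qed
  ultimately show ?thesis using that I by blast
qed

section \<open>Outer regularity\<close>

lemma decseq_emeasure_small:
  assumes "decseq A" "\<And>i. A i \<in> sets \<mu>" "(\<Inter>i. A i) = {}" and \<epsilon>: "\<epsilon> > (0::real)"
  shows "\<exists>i. emeasure \<mu> (A i \<inter> qball d x0 R) < ennreal \<epsilon>"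
proof -
  have "(\<lambda>i. emeasure \<mu> (A i \<inter> qball d x0 R)) \<longlonglongrightarrow> emeasure \<mu> (\<Inter>i. A i \<inter> qball d x0 R)"
  proof (rule Lim_emeasure_decseq)
    show "decseq (\<lambda>i. A i \<inter> qball d x0 R)"
      using assms(1) by (auto simp: decseq_def)
    fix i
    have "emeasure \<mu> (A i \<inter> qball d x0 R) \<le> emeasure \<mu> (qball d x0 R)"
      by (intro emeasure_mono) auto
    then show "emeasure \<mu> (A i \<inter> qball d x0 R) \<noteq> \<infinity>"
      using emeasure_qball_finite[of x0 R] by (auto simp: top_unique)
  qed (use assms in auto)
  also have "(\<Inter>i. A i \<inter> qball d x0 R) = {}" using assms(3) by auto
  finally have "\<forall>\<^sub>F i in sequentially. emeasure \<mu> (A i \<inter> qball d x0 R) < ennreal \<epsilon>"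
    using \<epsilon> by (intro order_tendstoD(2)) auto
  then show ?thesis unfolding eventually_sequentially by blast
qed

text \<open>Two-sided approximation, by an open and a closed set, so that the property passes to
  complements. Only the part in \<open>B\<close> is measured, since \<open>\<mu>\<close> may be
  infinite while balls have finite measure. Closed sets appear as sets with a \<open>qopen\<close>
  complement.\<close>

definition approximable :: "'a set \<Rightarrow> 'a set \<Rightarrow> bool" where
  "approximable B A \<longleftrightarrow> A \<in> sets \<mu> \<and>
     (\<forall>\<epsilon>>0. \<exists>U F. qopen d U \<and> qopen d (- F) \<and> F \<subseteq> A \<and> A \<subseteq> U \<and>
        emeasure \<mu> ((U - F) \<inter> B) < ennreal \<epsilon>)"

lemma sets_qclosed: "qopen d (- F) \<Longrightarrow> F \<in> sets \<mu>"
  using sets_qopen[of "- F"] sets.compl_sets[of "- F" \<mu>] by (simp add: space_eq_UNIV Compl_eq_Diff_UNIV[symmetric])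

lemma sets_Compl: "A \<in> sets \<mu> \<Longrightarrow> - A \<in> sets \<mu>"
  using sets.compl_sets[of A \<mu>] by (simp add: space_eq_UNIV Compl_eq_Diff_UNIV)

text \<open>A \<open>qopen\<close> set is a countable union of closed sets: the points whose \<open>1 / k\<close>-ball stays
  inside have their closure still inside.\<close>

lemma approximable_qopen:
  assumes U: "qopen d U"
  shows "approximable (qball d x0 R) U"
  unfolding approximable_def
proof (intro conjI allI impI)
  show "U \<in> sets \<mu>" using U by (rule sets_qopen)
  fix \<epsilon> :: real assume \<epsilon>: "\<epsilon> > 0"
  define G where "G k = {x. qball d x (1 / Suc k) \<subseteq> U}" for k
  define F where "F k = - {y. \<exists>s>0. qball d y s \<subseteq> - G k}" for k
  have clF: "qopen d (- F k)" for k
    using qopen_interior[of "- G k"] by (simp add: F_def)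
  have GF: "G k \<subseteq> F k" for k
    using centre_in_qball by (auto simp: F_def)
  \<comment> \<open>A point of the closure has a point of \<open>G k\<close> at distance below 1 /
    (k + 1), and by symmetry lies in the ball about that point, which is inside
    \<open>U\<close>.\<close>
  have FU: "F k \<subseteq> U" for k
  proof
    fix y assume "y \<in> F k"
    then have "\<not> qball d y (1 / Suc k) \<subseteq> - G k" by (auto simp: F_def)
    then obtain x where "x \<in> G k" "d x y < 1 / Suc k" by (auto simp: mem_qball)
    then have "y \<in> qball d x (1 / Suc k)" using dist_sym[of x y] by (simp add: mem_qball)
    then show "y \<in> U" using \<open>x \<in> G k\<close> by (auto simp: G_def)
  qed
  have "mono G"
  proof (rule monoI)
    fix i j :: nat assume "i \<le> j"
    then have "1 / Suc j \<le> 1 / Suc i" by (simp add: field_simps)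
    then show "G i \<subseteq> G j" unfolding G_def using qball_mono by blast
  qed
  then have "decseq (\<lambda>k. U - F k)"
    unfolding F_def decseq_def mono_def by blast
  moreover have "(\<Inter>k. U - F k) = {}"
  proof -
    have "\<exists>k. x \<in> F k" if x: "x \<in> U" for x
    proof -
      obtain r where r: "r > 0" "qball d x r \<subseteq> U" using U x unfolding qopen_def by blast
      obtain k where "1 / Suc k < r" using nat_approx_posE[OF r(1)] by blast
      then have "x \<in> G k" using r qball_mono[of "1 / Suc k" r x] by (auto simp: G_def)
      then show ?thesis using GF by blast
    qed
    then show ?thesis by auto
  qed
  ultimately obtain k where "emeasure \<mu> ((U - F k) \<inter> qball d x0 R) < ennreal \<epsilon>"
    using decseq_emeasure_small[of "\<lambda>k. U - F k" \<epsilon> x0 R] \<epsilon> sets_qopen[OF U] sets_qclosed[OF clF] by blast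
  then show "\<exists>U' F. qopen d U' \<and> qopen d (- F) \<and> F \<subseteq> U \<and> U \<subseteq> U' \<and>
      emeasure \<mu> ((U' - F) \<inter> qball d x0 R) < ennreal \<epsilon>"
    using U clF FU by blast
qed

lemma approximable_Compl: "approximable B A \<Longrightarrow> approximable B (- A)"
  unfolding approximable_def
proof (intro conjI allI impI)
  fix \<epsilon> :: real
  assume A: "A \<in> sets \<mu> \<and> (\<forall>\<epsilon>>0. \<exists>U F. qopen d U \<and> qopen d (- F) \<and> F \<subseteq> A \<and> A \<subseteq> U \<and>
        emeasure \<mu> ((U - F) \<inter> B) < ennreal \<epsilon>)" and "\<epsilon> > 0"
  then obtain U F where UF: "qopen d U" "qopen d (- F)" "F \<subseteq> A" "A \<subseteq> U"
    "emeasure \<mu> ((U - F) \<inter> B) < ennreal \<epsilon>" by blast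
  have "- F - - U = U - F" by auto
  with UF show "\<exists>U F. qopen d U \<and> qopen d (- F) \<and> F \<subseteq> - A \<and> - A \<subseteq> U \<and> emeasure \<mu> ((U - F) \<inter> B) < ennreal \<epsilon>"
    by (intro exI[of _ "- F"] exI[of _ "- U"]) auto
qed (auto intro: sets_Compl)

text \<open>The individual errors \<epsilon> / 2^(i + 2) add up to \<epsilon> / 2. A countable union
  of closed sets need not be closed, so it is cut off after finitely many sets, at a further cost
  below \<epsilon> / 2.\<close>

lemma approximable_UN:
  fixes A :: "nat \<Rightarrow> 'a set"
  assumes "\<And>i. approximable (qball d x0 R) (A i)"
  shows "approximable (qball d x0 R) (\<Union>i. A i)"
  unfolding approximable_def
proof (intro conjI allI impI)
  show "(\<Union>i. A i) \<in> sets \<mu>" using assms unfolding approximable_def by blast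
  fix \<epsilon> :: real assume \<epsilon>: "\<epsilon> > 0"
  let ?B = "qball d x0 R"
  have "\<forall>i. \<exists>U F. qopen d U \<and> qopen d (- F) \<and> F \<subseteq> A i \<and> A i \<subseteq> U \<and>
        emeasure \<mu> ((U - F) \<inter> ?B) < ennreal (\<epsilon> / 2 * (1 / 2) ^ Suc i)"
    using assms \<epsilon> unfolding approximable_def by simp
  then obtain U F where UF: "\<And>i. qopen d (U i)" "\<And>i. qopen d (- F i)" "\<And>i. F i \<subseteq> A i" "\<And>i. A i \<subseteq> U i"
    "\<And>i. emeasure \<mu> ((U i - F i) \<inter> ?B) < ennreal (\<epsilon> / 2 * (1 / 2) ^ Suc i)"
    by metis
  have sF: "F i \<in> sets \<mu>" and sU: "U i \<in> sets \<mu>" for i using sets_qclosed sets_qopen UF by auto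
  have "\<exists>n. emeasure \<mu> (((\<Union>i. F i) - (\<Union>i<n. F i)) \<inter> ?B) < ennreal (\<epsilon> / 2)"
  proof (rule decseq_emeasure_small)
    show "decseq (\<lambda>n. (\<Union>i. F i) - (\<Union>i<n. F i))" by (force simp: decseq_def)
  qed (use sF \<epsilon> in auto)
  then obtain n where n: "emeasure \<mu> (((\<Union>i. F i) - (\<Union>i<n. F i)) \<inter> ?B) < ennreal (\<epsilon> / 2)" ..
  have cl: "qopen d (- (\<Union>i<n. F i))"
  proof (induction n)
    case 0
    show ?case by (auto simp: qopen_def intro!: exI[of _ 1])
  next
    case (Suc n)
    have "- (\<Union>i<Suc n. F i) = - F n \<inter> - (\<Union>i<n. F i)" by (auto simp: less_Suc_eq)
    then show ?case using qopen_Int[OF UF(2)[of n] Suc] by simp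
  qed
  have "emeasure \<mu> (((\<Union>i. U i) - (\<Union>i<n. F i)) \<inter> ?B)
      \<le> emeasure \<mu> ((\<Union>i. (U i - F i) \<inter> ?B) \<union> ((\<Union>i. F i) - (\<Union>i<n. F i)) \<inter> ?B)"
    using sF sU by (intro emeasure_mono) auto
  also have "\<dots> \<le> emeasure \<mu> (\<Union>i. (U i - F i) \<inter> ?B) + emeasure \<mu> (((\<Union>i. F i) - (\<Union>i<n. F i)) \<inter> ?B)"
    using sF sU by (intro emeasure_subadditive) auto
  also have "emeasure \<mu> (\<Union>i. (U i - F i) \<inter> ?B) \<le> (\<Sum>i. emeasure \<mu> ((U i - F i) \<inter> ?B))"
    using sF sU by (intro emeasure_subadditive_countably) auto
  also have "\<dots> \<le> (\<Sum>i. ennreal (\<epsilon> / 2 * (1 / 2) ^ Suc i))"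
    using UF(5) by (intro suminf_le) (auto intro: less_imp_le)
  also have "\<dots> = ennreal (\<epsilon> / 2)"
  proof -
    have "(\<lambda>i. \<epsilon> / 2 * (1 / 2) ^ Suc i) sums (\<epsilon> / 2 * 1)"
      by (intro sums_mult power_half_series)
    then show ?thesis using \<epsilon> by (intro suminf_ennreal_eq) auto
  qed
  finally have "emeasure \<mu> (((\<Union>i. U i) - (\<Union>i<n. F i)) \<inter> ?B)
      \<le> ennreal (\<epsilon> / 2) + emeasure \<mu> (((\<Union>i. F i) - (\<Union>i<n. F i)) \<inter> ?B)" by simp
  also have "\<dots> < ennreal (\<epsilon> / 2) + ennreal (\<epsilon> / 2)"
    using n by (intro ennreal_add_left_cancel_less[THEN iffD2]) auto
  also have "\<dots> = ennreal \<epsilon>" using \<epsilon> by (simp flip: ennreal_plus)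
  finally show "\<exists>V F. qopen d V \<and> qopen d (- F) \<and> F \<subseteq> (\<Union>i. A i) \<and> (\<Union>i. A i) \<subseteq> V \<and>
      emeasure \<mu> ((V - F) \<inter> ?B) < ennreal \<epsilon>"
    using cl UF(3,4) qopen_Union[of "range U"] UF(1)
    by (intro exI[of _ "\<Union>i. U i"] exI[of _ "\<Union>i<n. F i"]) blast
qed

lemma approximable_sets:
  assumes "A \<in> sets \<mu>"
  shows "approximable (qball d x0 R) A"
proof -
  have "A \<in> sigma_sets UNIV {U. qopen d U}" using assms by (simp add: sets_borel)
  then show ?thesis
  proof induction
    case (Basic U)
    then show ?case using approximable_qopen by simp
  next
    case Empty
    show ?case using approximable_qopen[of "{}"] by (simp add: qopen_def)
  next
    case (Compl A)
    then show ?case using approximable_Compl by (simp add: Compl_eq_Diff_UNIV)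
  next
    case (Union A)
    then show ?case using approximable_UN by simp
  qed
qed

lemma outer_regular:
  assumes E: "E \<in> sets \<mu>" "E \<subseteq> qball d x0 R" and "R > 0" "\<epsilon> > (0::real)"
  obtains U where "qopen d U" "E \<subseteq> U" "emeasure \<mu> (U - E) \<le> ennreal \<epsilon>"
proof -
  let ?B = "qball d x0 (K * (R + R))"
  obtain U F where UF: "qopen d U" "E \<subseteq> U" "F \<subseteq> E" "qopen d (- F)" "emeasure \<mu> ((U - F) \<inter> ?B) < ennreal \<epsilon>"
    using approximable_sets[OF E(1)] \<open>\<epsilon> > 0\<close> unfolding approximable_def by meson
  \<comment> \<open>\<open>approximable\<close> controls the excess of \<open>U\<close> only inside
    \<open>?B\<close>, so \<open>U\<close> is cut down to the interior of \<open>?B\<close>. The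
    radius K (R + R) leaves room for a ball of radius R about each point of
    \<open>qball d x0 R\<close>, hence the interior contains \<open>E\<close>.\<close>
  define W where "W = {y. \<exists>s>0. qball d y s \<subseteq> ?B}"
  have W: "qopen d W" "W \<subseteq> ?B"
    using qopen_interior[of ?B] centre_in_qball by (auto simp: W_def)
  have EW: "E \<subseteq> W"
  proof
    fix y assume "y \<in> E"
    then have "d y x0 < R" using E by (auto simp: mem_qball)
    then show "y \<in> W" using qball_subset_qball[of y x0 R R] \<open>R > 0\<close> by (auto simp: W_def)
  qed
  show ?thesis
  proof (rule that[of "U \<inter> W"])
    have "emeasure \<mu> (U \<inter> W - E) \<le> emeasure \<mu> ((U - F) \<inter> ?B)"
      using UF W sets_qopen sets_qclosed by (intro emeasure_mono) auto
    then show "emeasure \<mu> (U \<inter> W - E) \<le> ennreal \<epsilon>" using UF(5) by simp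
  qed (use UF W EW qopen_Int in auto)
qed

end

section \<open>Doubling and differentiation of integrals\<close>

locale doubling_space = homogeneous_type_quasi_constant +
  fixes D n :: real
  assumes D_ge_1: "D \<ge> 1" and n_pos: "n > 0"
    and vol_growth: "r > 0 \<Longrightarrow> l \<ge> 1 \<Longrightarrow> vol x (l * r) \<le> D * l powr n * vol x r"
begin

lemma vol_dilate: "r > 0 \<Longrightarrow> vol x (2 * K * r) \<le> D * (2 * K) powr n * vol x r"
  using vol_growth[of r "2 * K" x] K_ge_1 by simp

text \<open>Consequence of the Lebesgue differentiation theorem, obtained from outer regularity alone.\<close>

lemma null_if_small_averages:
  assumes E: "E \<in> sets \<mu>" "E \<subseteq> qball d x0 R" and pos: "R > 0" "\<rho> > 0" "c > 0"
    and [measurable]: "h \<in> borel_measurable \<mu>"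
    and large: "\<And>x. x \<in> E \<Longrightarrow> ennreal (2 * c) \<le> h x"
    and small: "\<And>x k. x \<in> E \<Longrightarrow> (\<integral>\<^sup>+y\<in>qball d x (\<rho> / 2 ^ k). h y \<partial>\<mu>) \<le> ennreal (c * vol x (\<rho> / 2 ^ k))"
  shows "emeasure \<mu> E = 0"
proof (rule ccontr)
  assume nz: "emeasure \<mu> E \<noteq> 0"
  note [measurable] = E(1)
  define e where "e = measure \<mu> E"
  have "E \<in> fmeasurable \<mu>" using E by (intro fmeasurableI2[OF fmeasurable_qball]) auto
  then have e: "emeasure \<mu> E = ennreal e" by (simp add: e_def emeasure_eq_measure2)
  with nz have "e > 0" by (metis ennreal_neg linorder_not_less)
  define Cd where "Cd = D * (2 * K) powr n"
  have Cd: "Cd > 0" using D_ge_1 K_ge_1 by (simp add: Cd_def)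
  \<comment> \<open>The excess is tuned to the final contradiction: the covering bounds
    \<open>e\<close> by 2 Cd times the measure of \<open>U - E\<close>, that is by e / 2.\<close>
  have "e / (4 * Cd) > 0" using \<open>e > 0\<close> Cd by simp
  then obtain U where U: "qopen d U" "E \<subseteq> U" "emeasure \<mu> (U - E) \<le> ennreal (e / (4 * Cd))"
    using outer_regular[OF E \<open>R > 0\<close>] by metis
  have "\<exists>k. qball d x (\<rho> / 2 ^ k) \<subseteq> U" if "x \<in> E" for x
  proof -
    have "x \<in> U" using \<open>x \<in> E\<close> U by blast
    then obtain r where r: "r > 0" "qball d x r \<subseteq> U" using U(1) unfolding qopen_def by blast
    obtain k where "(1 / 2) ^ k < r / \<rho>" using real_arch_pow_inv[of "r / \<rho>" "1 / 2"] r pos by auto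
    then have "\<rho> / 2 ^ k \<le> r" using pos by (simp add: field_simps power_divide)
    then show ?thesis using qball_mono r by blast
  qed
  then obtain k where k: "\<And>x. x \<in> E \<Longrightarrow> qball d x (\<rho> / 2 ^ k x) \<subseteq> U" by metis
  obtain I where I: "I \<subseteq> E" "countable I" "disjoint_family_on (\<lambda>y. qball d y (\<rho> / 2 ^ k y)) I"
    "E \<subseteq> (\<Union>y\<in>I. qball d y (2 * K * (\<rho> / 2 ^ k y)))"
    using vitali_cover[OF \<open>\<rho> > 0\<close> E(2)] by metis
  \<comment> \<open>\<open>h\<close> is at least 2 c on \<open>E\<close> but has average at most c,
    so \<open>E\<close> fills at most half of the ball and its complement at least half.\<close>
  have half: "ennreal (vol y (\<rho> / 2 ^ k y)) \<le> 2 * (\<integral>\<^sup>+z\<in>qball d y (\<rho> / 2 ^ k y). indicator (- E) z \<partial>\<mu>)"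
    if "y \<in> I" for y
  proof -
    let ?B = "qball d y (\<rho> / 2 ^ k y)"
    have fm: "?B \<inter> E \<in> fmeasurable \<mu>" "?B - E \<in> fmeasurable \<mu>"
      by (auto intro: fmeasurableI2[OF fmeasurable_qball])
    have "ennreal (2 * c * measure \<mu> (?B \<inter> E)) = ennreal (2 * c) * emeasure \<mu> (?B \<inter> E)"
      using pos fm by (simp add: emeasure_eq_measure2 ennreal_mult)
    also have "\<dots> = (\<integral>\<^sup>+z. ennreal (2 * c) * indicator (?B \<inter> E) z \<partial>\<mu>)"
      by (intro nn_integral_cmult_indicator[symmetric]) auto
    also have "\<dots> \<le> (\<integral>\<^sup>+z\<in>?B. h z \<partial>\<mu>)"
      using large by (intro nn_integral_mono) (auto simp: indicator_def)
    also have "\<dots> \<le> ennreal (c * vol y (\<rho> / 2 ^ k y))" using that I(1) by (intro small) auto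
    finally have "2 * c * measure \<mu> (?B \<inter> E) \<le> c * vol y (\<rho> / 2 ^ k y)"
      using pos by (simp add: ennreal_le_iff)
    then have "2 * measure \<mu> (?B \<inter> E) \<le> measure \<mu> ?B"
      using pos by (simp add: field_simps)
    moreover have "measure \<mu> ?B = measure \<mu> (?B \<inter> E) + measure \<mu> (?B - E)"
      using measure_Un2[OF fm(1) fmeasurable_qball[of y "\<rho> / 2 ^ k y"]]
      by (simp add: Un_absorb1 Diff_Int)
    ultimately have "measure \<mu> ?B \<le> 2 * measure \<mu> (?B - E)" by simp
    then have "ennreal (vol y (\<rho> / 2 ^ k y)) \<le> ennreal (2 * measure \<mu> (?B - E))"
      by (intro ennreal_leI)
    also have "\<dots> = 2 * emeasure \<mu> (?B - E)"
      using fm by (simp add: emeasure_eq_measure2 ennreal_mult)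
    also have "emeasure \<mu> (?B - E) = (\<integral>\<^sup>+z. indicator (?B - E) z \<partial>\<mu>)"
      by simp
    also have "\<dots> = (\<integral>\<^sup>+z\<in>?B. indicator (- E) z \<partial>\<mu>)"
      by (intro nn_integral_cong) (auto simp: indicator_def)
    finally show ?thesis .
  qed
  have [measurable]: "- E \<in> sets \<mu>" using sets_Compl E by simp
  have "ennreal e = (\<integral>\<^sup>+z\<in>E. 1 \<partial>\<mu>)" using e by simp
  also have "\<dots> \<le> (\<integral>\<^sup>+y. (\<integral>\<^sup>+z\<in>qball d y (2 * K * (\<rho> / 2 ^ k y)). 1 \<partial>\<mu>) \<partial>count_space I)"
    by (intro nn_integral_le_sum_cover I) auto
  also have "\<dots> \<le> (\<integral>\<^sup>+y. ennreal (2 * Cd) * (\<integral>\<^sup>+z\<in>qball d y (\<rho> / 2 ^ k y). indicator (- E) z \<partial>\<mu>) \<partial>count_space I)"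
  proof (rule nn_integral_mono)
    fix y assume "y \<in> space (count_space I)"
    then have "y \<in> I" by simp
    have "(\<integral>\<^sup>+z\<in>qball d y (2 * K * (\<rho> / 2 ^ k y)). 1 \<partial>\<mu>) = ennreal (vol y (2 * K * (\<rho> / 2 ^ k y)))"
      by (simp add: emeasure_qball)
    also have "\<dots> \<le> ennreal (Cd * vol y (\<rho> / 2 ^ k y))"
      using vol_dilate[of "\<rho> / 2 ^ k y" y] pos by (intro ennreal_leI) (simp add: Cd_def)
    also have "\<dots> = ennreal Cd * ennreal (vol y (\<rho> / 2 ^ k y))"
      using Cd by (simp add: ennreal_mult)
    also have "\<dots> \<le> ennreal Cd * (2 * (\<integral>\<^sup>+z\<in>qball d y (\<rho> / 2 ^ k y). indicator (- E) z \<partial>\<mu>))"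
      by (intro mult_left_mono half \<open>y \<in> I\<close>) auto
    also have "\<dots> = ennreal (2 * Cd) * (\<integral>\<^sup>+z\<in>qball d y (\<rho> / 2 ^ k y). indicator (- E) z \<partial>\<mu>)"
      using Cd by (simp add: ennreal_mult mult_ac)
    finally show "(\<integral>\<^sup>+z\<in>qball d y (2 * K * (\<rho> / 2 ^ k y)). 1 \<partial>\<mu>) \<le> \<dots>" .
  qed
  also have "\<dots> = ennreal (2 * Cd) * (\<integral>\<^sup>+y. (\<integral>\<^sup>+z\<in>qball d y (\<rho> / 2 ^ k y). indicator (- E) z \<partial>\<mu>) \<partial>count_space I)"
    by (intro nn_integral_cmult) auto
  also have "\<dots> \<le> ennreal (2 * Cd) * (\<integral>\<^sup>+z\<in>U. indicator (- E) z \<partial>\<mu>)"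
    using I k by (intro mult_left_mono sum_disjoint_le_nn_integral) auto
  also have "(\<integral>\<^sup>+z\<in>U. indicator (- E) z \<partial>\<mu>) = (\<integral>\<^sup>+z. indicator (U - E) z \<partial>\<mu>)"
    by (intro nn_integral_cong) (auto simp: indicator_def)
  also have "\<dots> = emeasure \<mu> (U - E)"
    using sets_qopen[OF U(1)] by simp
  also have "ennreal (2 * Cd) * emeasure \<mu> (U - E) \<le> ennreal (2 * Cd) * ennreal (e / (4 * Cd))"
    by (intro mult_left_mono U) auto
  also have "\<dots> = ennreal (e / 2)"
    using Cd \<open>e > 0\<close> by (simp flip: ennreal_mult)
  finally show False using \<open>e > 0\<close> by (simp add: ennreal_le_iff)
qed

end

section \<open>Abstract setting of the John-Nirenberg argument\<close>

lemma summable_powr_half: "summable (\<lambda>j. (real j + 1) powr p * (1 / 2) ^ j)"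
proof (rule summable_comparison_test_bigo)
  show "summable (\<lambda>j. norm ((3 / 4 :: real) ^ j))" by (simp add: summable_geometric)
  show "(\<lambda>j. (real j + 1) powr p * (1 / 2) ^ j) \<in> O(\<lambda>j. (3 / 4) ^ j)" by real_asymp
qed

text \<open>Layer-cake series: the j-th level set has relative measure at most 2^(-j), and on its
  layer the p-th power is at most (j + 1)^p in units of the step.\<close>

definition jn_sum :: "real \<Rightarrow> real" where
  "jn_sum p = (\<Sum>j. (real j + 1) powr p * (1 / 2) ^ j)"

lemma jn_sum_pos: "jn_sum p > 0"
  unfolding jn_sum_def by (intro suminf_pos summable_powr_half) auto

text \<open>In the application \<open>\<psi> x r\<close> is \<open>\<parallel>\<chi>\<^sub>B\<parallel> / \<mu>(B)\<close> for the ball \<open>B\<close> of centre \<open>x\<close> and radius \<open>r\<close>, and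
  \<open>\<kappa> = n p / i\<close>. Times are written \<open>\<rho> powr m\<close>, as only the radius \<open>\<rho>\<close> matters.\<close>

locale campanato_space = doubling_space +
  fixes \<kappa> C\<^sub>m C\<^sub>g :: real and \<psi> :: "'a \<Rightarrow> real \<Rightarrow> real"
    and a :: "real \<Rightarrow> 'a \<Rightarrow> 'a \<Rightarrow> complex" and m M G :: real
  assumes n_le_\<kappa>: "n \<le> \<kappa>" and \<kappa>_less_M: "\<kappa> < M" and m_pos: "m > 0"
    and C\<^sub>m_ge_1: "C\<^sub>m \<ge> 1" and C\<^sub>g_ge_1: "C\<^sub>g \<ge> 1" and G_pos: "G > 0"
    and \<psi>_pos: "r > 0 \<Longrightarrow> \<psi> x r > 0"
    and \<psi>_mono: "r > 0 \<Longrightarrow> s > 0 \<Longrightarrow> qball d x r \<subseteq> qball d y s \<Longrightarrow> \<psi> x r \<le> C\<^sub>m * \<psi> y s"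
    and \<psi>_growth: "r > 0 \<Longrightarrow> l \<ge> 1 \<Longrightarrow>
      \<psi> x (l * r) * vol x (l * r) \<le> C\<^sub>g * l powr \<kappa> * (\<psi> x r * vol x r)"
    and kernel_measurable: "t > 0 \<Longrightarrow> (\<lambda>(x, y). a t x y) \<in> borel_measurable (\<mu> \<Otimes>\<^sub>M \<mu>)"
    and kernel_bound: "\<rho> > 0 \<Longrightarrow>
      norm (a (\<rho> powr m) x y) \<le> G / vol x \<rho> * (1 + d x y / \<rho>) powr (- M)"
begin

definition osc :: "('a \<Rightarrow> complex) \<Rightarrow> real \<Rightarrow> 'a \<Rightarrow> real" where
  "osc f r x = norm (f x - kernel_op \<mu> a (r powr m) f x)"

text \<open>What the iteration uses of \<open>f\<close>: absolutely convergent integrals, the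
  semigroup law for each pair of times off a null set that may depend on the pair, and the exponent
  1 bound with constant \<open>N\<close>. Positivity of \<open>N\<close> keeps the stopping
  thresholds positive.\<close>

definition campanato_bounded :: "('a \<Rightarrow> complex) \<Rightarrow> real \<Rightarrow> bool" where
  "campanato_bounded f N \<longleftrightarrow> f \<in> borel_measurable \<mu> \<and>
     (\<forall>x. \<forall>t>0. integrable \<mu> (\<lambda>y. a t x y * f y)) \<and>
     (\<forall>s>0. \<forall>t>0. AE x in \<mu>. kernel_op \<mu> a t (kernel_op \<mu> a s f) x = kernel_op \<mu> a (t + s) f x) \<and>
     N > 0 \<and> (\<forall>x. \<forall>r>0. (\<integral>\<^sup>+y\<in>qball d x r. ennreal (osc f r y) \<partial>\<mu>) \<le> ennreal (N * \<psi> x r * vol x r))"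

lemma osc_nonneg: "osc f r x \<ge> 0"
  by (simp add: osc_def)

lemma \<kappa>_pos: "\<kappa> > 0" and M_pos: "M > 0"
  using n_le_\<kappa> n_pos \<kappa>_less_M by auto

text \<open>Growth is assumed for \<open>\<psi> x r * vol x r\<close>, which stands for the norm of
  the characteristic function. Replacing the larger volume by the smaller one on the left frees
  \<open>\<psi>\<close>.\<close>

lemma \<psi>_dilate:
  assumes "r > 0" "l \<ge> 1"
  shows "\<psi> x (l * r) \<le> C\<^sub>g * l powr \<kappa> * \<psi> x r"
proof -
  have "r \<le> l * r" using assms by simp
  then have "vol x r \<le> vol x (l * r)" by (intro vol_mono qball_mono)
  moreover have "\<psi> x (l * r) > 0" using assms by (intro \<psi>_pos) auto
  ultimately have "\<psi> x (l * r) * vol x r \<le> \<psi> x (l * r) * vol x (l * r)"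
    by (intro mult_left_mono) auto
  also have "\<dots> \<le> C\<^sub>g * l powr \<kappa> * (\<psi> x r * vol x r)" by (rule \<psi>_growth[OF assms])
  finally show ?thesis using vol_pos[OF assms(1), of x] by simp
qed

lemma kernel_op_measurable:
  assumes "t > 0" and [measurable]: "f \<in> borel_measurable \<mu>"
  shows "kernel_op \<mu> a t f \<in> borel_measurable \<mu>"
proof -
  interpret sigma_finite_measure \<mu> by (rule sigma_finite)
  note [measurable] = kernel_measurable[OF assms(1)]
  have "(\<lambda>x. \<integral>y. a t x y * f y \<partial>\<mu>) \<in> borel_measurable \<mu>"
    by (rule borel_measurable_lebesgue_integral) measurable
  then show ?thesis using assms(1) by (simp add: kernel_op_def[abs_def])
qed

lemma kernel_measurable_snd:
  assumes "t > 0"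
  shows "a t x \<in> borel_measurable \<mu>"
  using measurable_compose[OF measurable_Pair1'[of x \<mu> \<mu>] kernel_measurable[OF assms]]
  by (simp add: space_eq_UNIV)

lemma osc_measurable:
  assumes "r > 0" and [measurable]: "f \<in> borel_measurable \<mu>"
  shows "osc f r \<in> borel_measurable \<mu>"
proof -
  have "r powr m > 0" using assms by simp
  note [measurable] = kernel_op_measurable[OF this assms(2)]
  show ?thesis unfolding osc_def[abs_def] by measurable
qed

section \<open>Kernel estimates\<close>

lemma campanato_bounded_pos: "campanato_bounded f N \<Longrightarrow> N > 0"
  by (simp add: campanato_bounded_def)

lemma campanato_bounded_measurable: "campanato_bounded f N \<Longrightarrow> f \<in> borel_measurable \<mu>"
  by (simp add: campanato_bounded_def)

lemma campanato_bounded_osc_measurable: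
  "campanato_bounded f N \<Longrightarrow> r > 0 \<Longrightarrow> (\<lambda>x. ennreal (osc f r x)) \<in> borel_measurable \<mu>"
  using osc_measurable[of r f] campanato_bounded_measurable by simp

text \<open>\<open>C\<^sub>m\<close> moves \<open>\<psi>\<close> to the enlarged ball,
  \<open>D * (2 * K) powr n\<close> pays for dilating the disjoint balls, and
  \<open>C\<^sub>g * (2 * K) powr \<kappa>\<close> brings the radius 2 K R back to R.\<close>

definition C_cover :: real where
  "C_cover = C\<^sub>m * D * (2 * K) powr n * C\<^sub>g * (2 * K) powr \<kappa>"

lemma C_cover_pos: "C_cover > 0"
  using C\<^sub>m_ge_1 D_ge_1 C\<^sub>g_ge_1 K_ge_1 by (simp add: C_cover_def)

text \<open>The hypothesis controls \<open>osc f s\<close> only on balls of radius \<open>s\<close>.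
  The large ball is covered by such balls whose shrunken copies are disjoint; almost monotonicity
  replaces each \<open>\<psi> y s\<close> by one value at radius 2 K R, so that the bounds add up
  like volumes.\<close>

lemma osc_small_radius_le:
  assumes f: "campanato_bounded f N" and s: "0 < s" "s \<le> R"
  shows "(\<integral>\<^sup>+y\<in>qball d x R. ennreal (osc f s y) \<partial>\<mu>) \<le> ennreal (C_cover * N * \<psi> x R * vol x R)"
proof -
  note [measurable] = campanato_bounded_osc_measurable[OF f s(1)]
  have N: "N > 0" using f by (rule campanato_bounded_pos)
  define \<sigma> where "\<sigma> = s / (2 * K)"
  have \<sigma>: "\<sigma> > 0" "2 * K * \<sigma> = s" using s K_pos by (auto simp: \<sigma>_def)
  \<comment> \<open>With all exponents 0 the disjoint balls have the common radius \<sigma> and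
    their dilates exactly the radius s.\<close>
  obtain I where I: "I \<subseteq> qball d x R" "countable I" "disjoint_family_on (\<lambda>y. qball d y \<sigma>) I"
    "qball d x R \<subseteq> (\<Union>y\<in>I. qball d y s)"
    using vitali_cover[OF \<sigma>(1), of "qball d x R" x R "\<lambda>_. 0"] \<sigma>(2) by auto
  have sub: "qball d y s \<subseteq> qball d x (2 * K * R)" if "y \<in> I" for y
  proof -
    have "d y x < R" using that I(1) by (auto simp: mem_qball)
    moreover have "K * (s + R) \<le> 2 * K * R" using s K_pos by simp
    ultimately show ?thesis using qball_subset_qball[of y x R s] qball_mono by blast
  qed
  have "\<sigma> \<le> s" using s K_ge_1 by (simp add: \<sigma>_def field_simps mult_le_cancel_left)
  then have sub': "qball d y \<sigma> \<subseteq> qball d x (2 * K * R)" if "y \<in> I" for y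
    using sub[OF that] qball_mono[of \<sigma> s y] by blast
  have R': "2 * K * R > 0" "R > 0" using s K_pos by auto
  define c where "c = N * C\<^sub>m * \<psi> x (2 * K * R) * D * (2 * K) powr n"
  have c: "c \<ge> 0" using N C\<^sub>m_ge_1 \<psi>_pos[OF R'(1), of x] D_ge_1 by (simp add: c_def)
  have "(\<integral>\<^sup>+y\<in>qball d x R. ennreal (osc f s y) \<partial>\<mu>) \<le>
      (\<integral>\<^sup>+y. (\<integral>\<^sup>+z\<in>qball d y s. ennreal (osc f s z) \<partial>\<mu>) \<partial>count_space I)"
    by (intro nn_integral_le_sum_cover I) auto
  also have "\<dots> \<le> (\<integral>\<^sup>+y. ennreal c * (\<integral>\<^sup>+z\<in>qball d y \<sigma>. 1 \<partial>\<mu>) \<partial>count_space I)"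
  proof (rule nn_integral_mono)
    fix y assume "y \<in> space (count_space I)"
    then have "y \<in> I" by simp
    have "(\<integral>\<^sup>+z\<in>qball d y s. ennreal (osc f s z) \<partial>\<mu>) \<le> ennreal (N * \<psi> y s * vol y s)"
      using f s unfolding campanato_bounded_def by blast
    also have "\<dots> \<le> ennreal (c * vol y \<sigma>)"
    proof (rule ennreal_leI)
      have "\<psi> y s \<le> C\<^sub>m * \<psi> x (2 * K * R)" using sub[OF \<open>y \<in> I\<close>] R' s by (intro \<psi>_mono) auto
      moreover have "vol y s \<le> D * (2 * K) powr n * vol y \<sigma>" using vol_dilate[OF \<sigma>(1), of y] \<sigma>(2) by simp
      moreover have "\<psi> y s > 0" using s by (intro \<psi>_pos)
      ultimately have "\<psi> y s * vol y s \<le> C\<^sub>m * \<psi> x (2 * K * R) * (D * (2 * K) powr n * vol y \<sigma>)"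
        by (intro mult_mono) auto
      then show "N * \<psi> y s * vol y s \<le> c * vol y \<sigma>"
        using N by (simp add: c_def mult_ac)
    qed
    also have "\<dots> = ennreal c * (\<integral>\<^sup>+z\<in>qball d y \<sigma>. 1 \<partial>\<mu>)"
      using c by (simp add: emeasure_qball ennreal_mult)
    finally show "(\<integral>\<^sup>+z\<in>qball d y s. ennreal (osc f s z) \<partial>\<mu>) \<le> \<dots>" .
  qed
  also have "\<dots> = ennreal c * (\<integral>\<^sup>+y. (\<integral>\<^sup>+z\<in>qball d y \<sigma>. 1 \<partial>\<mu>) \<partial>count_space I)"
    by (intro nn_integral_cmult) auto
  also have "\<dots> \<le> ennreal c * (\<integral>\<^sup>+z\<in>qball d x (2 * K * R). 1 \<partial>\<mu>)"
    using I sub' by (intro mult_left_mono sum_disjoint_le_nn_integral) auto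
  also have "\<dots> = ennreal (c * vol x (2 * K * R))"
    using c by (simp add: emeasure_qball ennreal_mult)
  also have "\<dots> \<le> ennreal (C_cover * N * \<psi> x R * vol x R)"
  proof (rule ennreal_leI)
    have "\<psi> x (2 * K * R) * vol x (2 * K * R) \<le> C\<^sub>g * (2 * K) powr \<kappa> * (\<psi> x R * vol x R)"
      using \<psi>_growth[of R "2 * K" x] R' K_ge_1 by simp
    then have "N * C\<^sub>m * D * (2 * K) powr n * (\<psi> x (2 * K * R) * vol x (2 * K * R))
        \<le> N * C\<^sub>m * D * (2 * K) powr n * (C\<^sub>g * (2 * K) powr \<kappa> * (\<psi> x R * vol x R))"
      using N C\<^sub>m_ge_1 D_ge_1 by (intro mult_left_mono) auto
    then show "c * vol x (2 * K * R) \<le> C_cover * N * \<psi> x R * vol x R"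
      by (simp add: c_def C_cover_def mult_ac)
  qed
  finally show ?thesis .
qed

text \<open>Only the term of the smallest dyadic ball containing \<open>y\<close> is used. For k > 0
  the point lies outside the ball before it, where the decay is 2^(-(k - 1) M), whence the factor
  \<open>2 powr M\<close>. A sum of indicators can then be integrated against any function term by
  term.\<close>

lemma kernel_dyadic_le:
  assumes \<rho>: "\<rho> > 0"
  shows "ennreal (norm (a (\<rho> powr m) x y)) \<le>
    (\<Sum>k. ennreal (G * 2 powr M / vol x \<rho> * (2 powr (- M)) ^ k) * indicator (qball d x (2 ^ k * \<rho>)) y)"
proof -
  define k where "k = (LEAST k. d y x < 2 ^ k * \<rho>)"
  have "\<exists>k. d y x < 2 ^ k * \<rho>"
    using real_arch_pow[of 2 "d y x / \<rho>"] \<rho> by (auto simp: field_simps)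
  then have k: "d y x < 2 ^ k * \<rho>" unfolding k_def by (rule LeastI_ex)
  have least: "2 ^ j * \<rho> \<le> d y x" if "j < k" for j
    using not_less_Least[of j] that unfolding k_def by (metis not_less)
  have v: "vol x \<rho> > 0" using vol_pos \<rho> by blast
  have term_le: "F k \<le> (\<Sum>k. F k)" for F :: "nat \<Rightarrow> ennreal"
    using sum_le_suminf[OF summableI, of "{k}" F] by simp
  have "(1 + d x y / \<rho>) powr (- M) \<le> 2 powr M * (2 powr (- M)) ^ k"
  proof (cases k)
    case 0
    have "(1 + d x y / \<rho>) powr (- M) \<le> 1 powr (- M)"
      using M_pos \<rho> dist_nonneg[of x y] by (intro powr_mono2') auto
    also have "1 powr (- M) \<le> 2 powr M" using ge_one_powr_ge_zero[of 2 M] M_pos by simp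
    finally show ?thesis using 0 by simp
  next
    case (Suc j)
    have "2 ^ j \<le> d x y / \<rho>" using least[of j] Suc \<rho> by (simp add: field_simps dist_sym)
    then have "(1 + d x y / \<rho>) powr (- M) \<le> (2 ^ j) powr (- M)"
      using M_pos by (intro powr_mono2') auto
    also have "\<dots> = 2 powr M * (2 powr (- M)) ^ k"
      by (simp add: Suc powr_realpow[symmetric] powr_powr powr_minus field_simps flip: powr_add)
    finally show ?thesis .
  qed
  then have "norm (a (\<rho> powr m) x y) \<le> G / vol x \<rho> * (2 powr M * (2 powr (- M)) ^ k)"
    using G_pos v by (intro order_trans[OF kernel_bound[OF \<rho>]] mult_left_mono) auto
  then have "ennreal (norm (a (\<rho> powr m) x y)) \<le>
      ennreal (G * 2 powr M / vol x \<rho> * (2 powr (- M)) ^ k) * indicator (qball d x (2 ^ k * \<rho>)) y"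
    using k by (auto intro!: ennreal_leI simp: mem_qball field_simps)
  also have "\<dots> \<le> (\<Sum>k. ennreal (G * 2 powr M / vol x \<rho> * (2 powr (- M)) ^ k) * indicator (qball d x (2 ^ k * \<rho>)) y)"
    by (rule term_le[of "\<lambda>k. ennreal (G * 2 powr M / vol x \<rho> * (2 powr (- M)) ^ k) * indicator (qball d x (2 ^ k * \<rho>)) y"])
  finally show ?thesis .
qed

definition C_kernel :: real where
  "C_kernel = G * 2 powr M / (1 - 2 powr (\<kappa> - M))"

lemma two_powr_less_1: "2 powr (\<kappa> - M) < 1"
  using \<kappa>_less_M powr_less_mono[of "\<kappa> - M" 0 2] by simp

lemma C_kernel_pos: "C_kernel > 0"
  using G_pos two_powr_less_1 by (simp add: C_kernel_def)

text \<open>The k-th dyadic ball contributes 2^(-k M) from the kernel and 2^(k \<kappa>) from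
  \<open>h\<close>. As \<kappa> < M, the ratio 2^(\<kappa> - M) gives a convergent geometric series,
  which is the denominator of \<open>C_kernel\<close>.\<close>

lemma kernel_integral_le:
  assumes \<rho>: "\<rho> > 0" and [measurable]: "h \<in> borel_measurable \<mu>" and H: "H \<ge> 0"
    and h: "\<And>k. (\<integral>\<^sup>+y\<in>qball d x (2 ^ k * \<rho>). h y \<partial>\<mu>) \<le> ennreal (H * (2 ^ k) powr \<kappa> * vol x \<rho>)"
  shows "(\<integral>\<^sup>+y. ennreal (norm (a (\<rho> powr m) x y)) * h y \<partial>\<mu>) \<le> ennreal (C_kernel * H)"
proof -
  have v: "vol x \<rho> > 0" using vol_pos \<rho> by blast
  let ?c = "\<lambda>k. G * 2 powr M / vol x \<rho> * (2 powr (- M)) ^ k"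
  have "(\<integral>\<^sup>+y. ennreal (norm (a (\<rho> powr m) x y)) * h y \<partial>\<mu>) \<le>
      (\<integral>\<^sup>+y. (\<Sum>k. ennreal (?c k) * indicator (qball d x (2 ^ k * \<rho>)) y) * h y \<partial>\<mu>)"
    by (intro nn_integral_mono mult_right_mono kernel_dyadic_le \<rho>) auto
  also have "\<dots> = (\<integral>\<^sup>+y. (\<Sum>k. ennreal (?c k) * (h y * indicator (qball d x (2 ^ k * \<rho>)) y)) \<partial>\<mu>)"
    by (simp add: ennreal_suminf_multc[symmetric] mult_ac)
  also have "\<dots> = (\<Sum>k. \<integral>\<^sup>+y. ennreal (?c k) * (h y * indicator (qball d x (2 ^ k * \<rho>)) y) \<partial>\<mu>)"
    by (intro nn_integral_suminf) auto
  also have "\<dots> = (\<Sum>k. ennreal (?c k) * (\<integral>\<^sup>+y\<in>qball d x (2 ^ k * \<rho>). h y \<partial>\<mu>))"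
    by (intro suminf_cong nn_integral_cmult) auto
  also have "\<dots> \<le> (\<Sum>k. ennreal (G * 2 powr M * H * (2 powr (\<kappa> - M)) ^ k))"
  proof (intro suminf_le allI)
    fix k :: nat
    have "ennreal (?c k) * (\<integral>\<^sup>+y\<in>qball d x (2 ^ k * \<rho>). h y \<partial>\<mu>)
        \<le> ennreal (?c k) * ennreal (H * (2 ^ k) powr \<kappa> * vol x \<rho>)"
      by (intro mult_left_mono h) auto
    also have "\<dots> = ennreal (?c k * (H * (2 ^ k) powr \<kappa> * vol x \<rho>))"
      using G_pos v H by (intro ennreal_mult[symmetric]) auto
    also have "?c k * (H * (2 ^ k) powr \<kappa> * vol x \<rho>) = G * 2 powr M * H * ((2 powr (- M)) ^ k * (2 ^ k) powr \<kappa>)"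
      using v by simp
    also have "(2 powr (- M)) ^ k * (2 ^ k) powr \<kappa> = (2 powr (\<kappa> - M)) ^ k"
    proof -
      have "(2 ^ k) powr \<kappa> = (2 powr \<kappa>) ^ k"
        by (simp add: powr_realpow[symmetric] powr_powr mult.commute)
      then show ?thesis
        by (simp add: power_mult_distrib[symmetric] powr_add[symmetric])
    qed
    finally show "ennreal (?c k) * (\<integral>\<^sup>+y\<in>qball d x (2 ^ k * \<rho>). h y \<partial>\<mu>)
        \<le> ennreal (G * 2 powr M * H * (2 powr (\<kappa> - M)) ^ k)" .
  qed auto
  also have "\<dots> = ennreal (G * 2 powr M * H * (1 / (1 - 2 powr (\<kappa> - M))))"
    using G_pos H two_powr_less_1
    by (intro suminf_ennreal_eq sums_mult geometric_sums) auto
  also have "\<dots> = ennreal (C_kernel * H)" by (simp add: C_kernel_def mult_ac)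
  finally show ?thesis .
qed

text \<open>The coarse kernel against the fine oscillation: all dyadic radii are at least \<rho>,
  hence at least s, so covering alone bounds the integral over each dyadic ball.\<close>

lemma kernel_osc_le:
  assumes f: "campanato_bounded f N" and s: "0 < s" "s \<le> \<rho>"
  shows "(\<integral>\<^sup>+y. ennreal (norm (a (\<rho> powr m) x y)) * ennreal (osc f s y) \<partial>\<mu>)
    \<le> ennreal (C_kernel * (C_cover * C\<^sub>g * N * \<psi> x \<rho>))"
proof (rule kernel_integral_le)
  have N: "N > 0" using f by (rule campanato_bounded_pos)
  show "\<rho> > 0" using s by simp
  then show "0 \<le> C_cover * C\<^sub>g * N * \<psi> x \<rho>"
    using N C_cover_pos C\<^sub>g_ge_1 \<psi>_pos[of \<rho> x] by simp
  show "(\<lambda>y. ennreal (osc f s y)) \<in> borel_measurable \<mu>"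
    using campanato_bounded_osc_measurable f s by blast
  fix k :: nat
  have "\<rho> \<le> 2 ^ k * \<rho>" using \<open>\<rho> > 0\<close> by simp
  then have "(\<integral>\<^sup>+y\<in>qball d x (2 ^ k * \<rho>). ennreal (osc f s y) \<partial>\<mu>)
      \<le> ennreal (C_cover * N * \<psi> x (2 ^ k * \<rho>) * vol x (2 ^ k * \<rho>))"
    by (intro osc_small_radius_le f s(1) order_trans[OF s(2)])
  also have "\<dots> \<le> ennreal (C_cover * C\<^sub>g * N * \<psi> x \<rho> * (2 ^ k) powr \<kappa> * vol x \<rho>)"
  proof (rule ennreal_leI)
    have "C_cover * N * (\<psi> x (2 ^ k * \<rho>) * vol x (2 ^ k * \<rho>)) \<le>
        C_cover * N * (C\<^sub>g * (2 ^ k) powr \<kappa> * (\<psi> x \<rho> * vol x \<rho>))"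
      using N C_cover_pos \<open>\<rho> > 0\<close> by (intro mult_left_mono \<psi>_growth) auto
    then show "C_cover * N * \<psi> x (2 ^ k * \<rho>) * vol x (2 ^ k * \<rho>)
        \<le> C_cover * C\<^sub>g * N * \<psi> x \<rho> * (2 ^ k) powr \<kappa> * vol x \<rho>"
      by (simp add: mult_ac)
  qed
  finally show "(\<integral>\<^sup>+y\<in>qball d x (2 ^ k * \<rho>). ennreal (osc f s y) \<partial>\<mu>) \<le> \<dots>" .
qed

text \<open>\<open>A\<^sub>t f - A\<^bsub>t + u\<^esub> f = A\<^sub>t (f - A\<^sub>u f)\<close> by the semigroup property.\<close>

lemma kernel_op_diff_le:
  assumes f: "campanato_bounded f N" and pos: "\<rho> > 0" "s > 0" and H: "H \<ge> 0"
    and bound: "(\<integral>\<^sup>+y. ennreal (norm (a (\<rho> powr m) x y)) * ennreal (osc f s y) \<partial>\<mu>) \<le> ennreal H"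
    and sg: "kernel_op \<mu> a (\<rho> powr m) (kernel_op \<mu> a (s powr m) f) x = kernel_op \<mu> a (\<rho> powr m + s powr m) f x"
  shows "norm (kernel_op \<mu> a (\<rho> powr m) f x - kernel_op \<mu> a (\<rho> powr m + s powr m) f x) \<le> H"
proof -
  let ?a = "a (\<rho> powr m) x" and ?As = "kernel_op \<mu> a (s powr m) f"
  have t: "\<rho> powr m > 0" "s powr m > 0" using pos by auto
  have [measurable]: "f \<in> borel_measurable \<mu>" using f by (rule campanato_bounded_measurable)
  note [measurable] = kernel_measurable_snd[OF t(1), of x] kernel_op_measurable[OF t(2), of f]
  have int_f: "integrable \<mu> (\<lambda>y. ?a y * f y)"
    using f t unfolding campanato_bounded_def by blast
  have eq: "(\<integral>\<^sup>+y. ennreal (norm (?a y * (f y - ?As y))) \<partial>\<mu>) =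
      (\<integral>\<^sup>+y. ennreal (norm (?a y)) * ennreal (osc f s y) \<partial>\<mu>)"
    by (intro nn_integral_cong) (simp add: norm_mult osc_def ennreal_mult)
  have int_g: "integrable \<mu> (\<lambda>y. ?a y * (f y - ?As y))"
    using bound eq by (intro integrableI_bounded) (auto simp: less_top[symmetric] top_unique)
  have "kernel_op \<mu> a (\<rho> powr m) ?As x = (\<integral>y. ?a y * ?As y \<partial>\<mu>)"
    using t by (simp add: kernel_op_def)
  \<comment> \<open>Only \<open>?a * f\<close> and \<open>?a * (f - ?As)\<close> are known to be
    integrable, so the integrand is written as their difference before the integral is
    split.\<close>
  also have "\<dots> = (\<integral>y. ?a y * f y - ?a y * (f y - ?As y) \<partial>\<mu>)"
    by (intro Bochner_Integration.integral_cong) (auto simp: algebra_simps)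
  also have "\<dots> = kernel_op \<mu> a (\<rho> powr m) f x - (\<integral>y. ?a y * (f y - ?As y) \<partial>\<mu>)"
    using t int_f int_g by (simp add: kernel_op_def)
  finally have "kernel_op \<mu> a (\<rho> powr m) f x - kernel_op \<mu> a (\<rho> powr m + s powr m) f x =
      (\<integral>y. ?a y * (f y - ?As y) \<partial>\<mu>)"
    using sg by simp
  moreover have "ennreal (norm (\<integral>y. ?a y * (f y - ?As y) \<partial>\<mu>)) \<le> ennreal H"
    using integral_norm_bound_ennreal[OF int_g] bound eq by simp
  ultimately show ?thesis using H by (simp add: ennreal_le_iff)
qed

section \<open>Comparison along stopping balls\<close>

lemma \<psi>_near:
  assumes "r > 0" "d y x < r"
  shows "\<psi> y r \<le> C\<^sub>m * C\<^sub>g * (2 * K) powr \<kappa> * \<psi> x r"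
proof -
  have "qball d y r \<subseteq> qball d x (2 * K * r)"
    using qball_subset_qball[OF assms(2), of r] by (simp add: mult_ac)
  then have "\<psi> y r \<le> C\<^sub>m * \<psi> x (2 * K * r)"
    using assms K_pos by (intro \<psi>_mono) auto
  also have "\<dots> \<le> C\<^sub>m * (C\<^sub>g * (2 * K) powr \<kappa> * \<psi> x r)"
    using assms K_ge_1 C\<^sub>m_ge_1 by (intro mult_left_mono \<psi>_dilate) auto
  finally show ?thesis by (simp add: mult_ac)
qed

lemma vol_near:
  assumes "r > 0" "d x y < r"
  shows "vol x r \<le> D * (2 * K) powr n * vol y r"
proof -
  have "qball d x r \<subseteq> qball d y (2 * K * r)"
    using qball_subset_qball[OF assms(2), of r] by (simp add: mult_ac)
  then show ?thesis using vol_mono vol_dilate[OF assms(1), of y] by (meson order_trans)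
qed

text \<open>\<open>C_top\<close> bounds the integral over the ball of radius 2 K r.
  \<open>C_stop\<close> is the stopping height in units of \<Lambda>: its volume factors put the
  averages over radii from r / (4 K^2) to r below the height, and the 2 makes the dilated stopping
  balls add up to at most half of the original volume. The summands of \<open>C_grow\<close> belong
  to radii up to r and beyond r, those of \<open>C_comp\<close> to the two kernels in the comparison
  of scales.\<close>

definition C_top :: real where "C_top = C_cover * C\<^sub>g * (2 * K) powr \<kappa>"
definition C_stop :: real where "C_stop = 2 * C_top * (D * (2 * K) powr n) * (D * (4 * K\<^sup>2) powr n)"
definition C_near :: real where "C_near = C\<^sub>m * C\<^sub>g * (2 * K) powr \<kappa>"
definition C_grow :: real where "C_grow = C_stop * D * 2 powr n + C_cover * C\<^sub>g * C_near * D"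
definition C_comp :: real where
  "C_comp = C_kernel * (C_grow * (4 * K\<^sup>2) powr \<kappa> * (D * (2 * K) powr n)) +
     C_kernel * (C_cover * C\<^sub>g * C_near)"

lemma constants_pos: "C_top > 0" "C_stop > 0" "C_near > 0" "C_grow > 0" "C_comp > 0"
  using C_cover_pos C_kernel_pos C\<^sub>m_ge_1 D_ge_1 C\<^sub>g_ge_1 K_ge_1
  by (auto simp: C_top_def C_stop_def C_near_def C_grow_def C_comp_def intro!: add_pos_pos mult_pos_pos)

text \<open>The ball of radius 2 K r contains every ball of radius at most r centred in
  \<open>qball d x r\<close>. A majorant \<Lambda> takes the place of \<open>N * \<psi> x r\<close>
  so that one value can serve all generations of the iteration.\<close>

lemma osc_top_le:
  assumes f: "campanato_bounded f N" and r: "r > 0" and \<Lambda>: "N * \<psi> x r \<le> \<Lambda>"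
  shows "(\<integral>\<^sup>+y\<in>qball d x (2 * K * r). ennreal (osc f r y) \<partial>\<mu>) \<le> ennreal (C_top * \<Lambda> * vol x r)"
proof -
  have N: "N > 0" using f by (rule campanato_bounded_pos)
  have "1 * r \<le> 2 * K * r" using r K_ge_1 by (intro mult_right_mono) auto
  then have "(\<integral>\<^sup>+y\<in>qball d x (2 * K * r). ennreal (osc f r y) \<partial>\<mu>)
      \<le> ennreal (C_cover * N * \<psi> x (2 * K * r) * vol x (2 * K * r))"
    using r by (intro osc_small_radius_le f) auto
  also have "\<dots> \<le> ennreal (C_top * \<Lambda> * vol x r)"
  proof (rule ennreal_leI)
    have "C_cover * N * (\<psi> x (2 * K * r) * vol x (2 * K * r)) \<le>
        C_cover * N * (C\<^sub>g * (2 * K) powr \<kappa> * (\<psi> x r * vol x r))"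
      using N C_cover_pos r K_ge_1 by (intro mult_left_mono \<psi>_growth) auto
    also have "\<dots> = C_top * vol x r * (N * \<psi> x r)" by (simp add: C_top_def mult_ac)
    also have "\<dots> \<le> C_top * vol x r * \<Lambda>"
      using constants_pos by (intro mult_left_mono \<Lambda>) auto
    finally show "C_cover * N * \<psi> x (2 * K * r) * vol x (2 * K * r) \<le> C_top * \<Lambda> * vol x r"
      by (simp add: mult_ac)
  qed
  finally show ?thesis .
qed

text \<open>Doubling compares the volumes of \<open>qball d x r\<close> and
  \<open>qball d y R\<close>, as R is comparable to r. The purpose is to force stopping radii below
  r / (4 K^2), so that their 2 K dilates have radius at most r / (2 K).\<close>

lemma average_large_radius_le:
  assumes f: "campanato_bounded f N" and r: "r > 0" and \<Lambda>: "N * \<psi> x r \<le> \<Lambda>" "\<Lambda> > 0"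
    and y: "d y x < r" and R: "r / (4 * K\<^sup>2) \<le> R" "R \<le> r"
  shows "(\<integral>\<^sup>+z\<in>qball d y R. ennreal (osc f r z) \<partial>\<mu>) \<le> ennreal (C_stop * \<Lambda> * vol y R)"
proof -
  have "qball d y R \<subseteq> qball d x (2 * K * r)"
    using qball_subset_qball[OF y, of r] qball_mono[OF R(2), of y] by (auto simp: mult_ac)
  then have "(\<integral>\<^sup>+z\<in>qball d y R. ennreal (osc f r z) \<partial>\<mu>) \<le> (\<integral>\<^sup>+z\<in>qball d x (2 * K * r). ennreal (osc f r z) \<partial>\<mu>)"
    by (intro nn_set_integral_set_mono)
  also have "\<dots> \<le> ennreal (C_top * \<Lambda> * vol x r)" by (rule osc_top_le[OF f r \<Lambda>(1)])
  also have "\<dots> \<le> ennreal (C_stop * \<Lambda> * vol y R)"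
  proof (rule ennreal_leI)
    have K4: "4 * K\<^sup>2 \<ge> 1" using one_le_power[OF K_ge_1, of 2] by linarith
    have "vol x r \<le> D * (2 * K) powr n * vol y r"
      using y r by (intro vol_near) (auto simp: dist_sym)
    also have "vol y r \<le> D * (4 * K\<^sup>2) powr n * vol y (r / (4 * K\<^sup>2))"
      using vol_growth[of "r / (4 * K\<^sup>2)" "4 * K\<^sup>2" y] r K4 K_pos by simp
    also have "vol y (r / (4 * K\<^sup>2)) \<le> vol y R"
      using R by (intro vol_mono qball_mono)
    finally have *: "vol x r \<le> D * (2 * K) powr n * (D * (4 * K\<^sup>2) powr n * vol y R)"
      using D_ge_1 by (simp add: mult_left_mono)
    have "C_top * \<Lambda> * vol x r \<le> C_top * \<Lambda> * (D * (2 * K) powr n * (D * (4 * K\<^sup>2) powr n * vol y R))"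
      using constants_pos \<Lambda> by (intro mult_left_mono *) auto
    also have "\<dots> \<le> 2 * \<dots>"
      using constants_pos \<Lambda> D_ge_1 by simp
    finally show "C_top * \<Lambda> * vol x r \<le> C_stop * \<Lambda> * vol y R"
      by (simp add: C_stop_def mult_ac)
  qed
  finally show ?thesis .
qed

text \<open>A radius up to r is rounded up to a dyadic radius before the stopping index, where the
  average is below the stopping height; beyond r the bound on \<open>f\<close> itself takes over.
  Both are put in the common form (R / \<rho>)^\<kappa>, using n \<le> \<kappa>, as the dyadic
  kernel sum requires.\<close>

lemma integral_after_stopping_le:
  assumes f: "campanato_bounded f N" and r: "r > 0" and \<Lambda>: "N * \<psi> x0 r \<le> \<Lambda>" "\<Lambda> > 0"
    and y: "d y x0 < r" and \<rho>: "\<rho> = r / 2 ^ k"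
    and stop: "\<And>j. j < k \<Longrightarrow>
      (\<integral>\<^sup>+z\<in>qball d y (r / 2 ^ j). ennreal (osc f r z) \<partial>\<mu>) \<le> ennreal (C_stop * \<Lambda> * vol y (r / 2 ^ j))"
    and R: "2 * \<rho> \<le> R"
  shows "(\<integral>\<^sup>+z\<in>qball d y R. ennreal (osc f r z) \<partial>\<mu>) \<le> ennreal (C_grow * \<Lambda> * (R / \<rho>) powr \<kappa> * vol y \<rho>)"
proof -
  have N: "N > 0" using f by (rule campanato_bounded_pos)
  have \<rho>_pos: "\<rho> > 0" using r by (simp add: \<rho>)
  have R_pos: "R > 0" using R \<rho>_pos by linarith
  have R1: "R / \<rho> \<ge> 1" using R \<rho>_pos by (simp add: field_simps)
  note Cpos = constants_pos C_cover_pos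
  show ?thesis
  proof (cases "R \<le> r")
    case True
    define j where "j = (LEAST j. r / 2 ^ Suc j < R)"
    have "\<exists>j. r / 2 ^ Suc j < R"
    proof -
      obtain i where "r / R < 2 ^ i" using real_arch_pow[of 2 "r / R"] by auto
      then have "r / 2 ^ i < R" using R_pos by (simp add: field_simps)
      moreover have "r / 2 ^ Suc i \<le> r / 2 ^ i" using r by (simp add: field_simps)
      ultimately show ?thesis by (meson order_le_less_trans)
    qed
    then have j1: "r / 2 ^ Suc j < R" unfolding j_def by (rule LeastI_ex)
    have j2: "R \<le> r / 2 ^ j"
    proof (cases j)
      case (Suc i)
      then have "\<not> r / 2 ^ Suc i < R"
        by (intro not_less_Least[of i "\<lambda>j. r / 2 ^ Suc j < R", folded j_def]) simp
      then show ?thesis using Suc by simp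
    qed (use True in simp)
    \<comment> \<open>The radius \<open>r / 2 ^ j\<close> is at least R, hence at least twice the
      stopping radius.\<close>
    have "j < k"
    proof -
      have "2 * (r / 2 ^ k) \<le> r / 2 ^ j" using R j2 by (simp add: \<rho>)
      then have "(2::real) ^ Suc j \<le> 2 ^ k" using r by (simp add: field_simps)
      then show ?thesis using power_le_imp_le_exp[of "2::real" "Suc j" k] by simp
    qed
    have "(\<integral>\<^sup>+z\<in>qball d y R. ennreal (osc f r z) \<partial>\<mu>)
        \<le> (\<integral>\<^sup>+z\<in>qball d y (r / 2 ^ j). ennreal (osc f r z) \<partial>\<mu>)"
      by (intro nn_set_integral_set_mono qball_mono j2)
    also have "\<dots> \<le> ennreal (C_stop * \<Lambda> * vol y (r / 2 ^ j))" using stop[OF \<open>j < k\<close>] .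
    also have "\<dots> \<le> ennreal (C_grow * \<Lambda> * (R / \<rho>) powr \<kappa> * vol y \<rho>)"
    proof (rule ennreal_leI)
      have "vol y (r / 2 ^ j) \<le> vol y (2 * (R / \<rho>) * \<rho>)"
        using j1 \<rho>_pos by (intro vol_mono qball_mono) (simp add: field_simps)
      also have "\<dots> \<le> D * (2 * (R / \<rho>)) powr n * vol y \<rho>"
        using R1 \<rho>_pos by (intro vol_growth) auto
      also have "(2 * (R / \<rho>)) powr n = 2 powr n * (R / \<rho>) powr n"
        by (rule powr_mult)
      also have "D * (2 powr n * (R / \<rho>) powr n) * vol y \<rho> \<le> D * (2 powr n * (R / \<rho>) powr \<kappa>) * vol y \<rho>"
        using D_ge_1 R1 n_le_\<kappa> by (intro mult_left_mono mult_right_mono powr_mono) auto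
      finally have "C_stop * \<Lambda> * vol y (r / 2 ^ j) \<le> C_stop * \<Lambda> * (D * (2 powr n * (R / \<rho>) powr \<kappa>) * vol y \<rho>)"
        using Cpos \<Lambda> by (intro mult_left_mono) auto
      also have "\<dots> = C_stop * D * 2 powr n * (\<Lambda> * (R / \<rho>) powr \<kappa> * vol y \<rho>)" by (simp add: mult_ac)
      also have "\<dots> \<le> C_grow * (\<Lambda> * (R / \<rho>) powr \<kappa> * vol y \<rho>)"
        using Cpos \<Lambda> C\<^sub>g_ge_1 D_ge_1 by (intro mult_right_mono) (auto simp: C_grow_def)
      finally show "C_stop * \<Lambda> * vol y (r / 2 ^ j) \<le> C_grow * \<Lambda> * (R / \<rho>) powr \<kappa> * vol y \<rho>"
        by (simp add: mult_ac)
    qed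
    finally show ?thesis .
  next
    case False
    then have "R / r \<ge> 1" using r by simp
    have "(\<integral>\<^sup>+z\<in>qball d y R. ennreal (osc f r z) \<partial>\<mu>) \<le> ennreal (C_cover * N * \<psi> y R * vol y R)"
      using False r by (intro osc_small_radius_le f) auto
    also have "\<dots> \<le> ennreal (C_grow * \<Lambda> * (R / \<rho>) powr \<kappa> * vol y \<rho>)"
    proof (rule ennreal_leI)
      have "1 \<le> r / \<rho>" using r by (simp add: \<rho>)
      have v: "vol y r \<le> D * (r / \<rho>) powr \<kappa> * vol y \<rho>"
      proof -
        have "vol y r \<le> D * (r / \<rho>) powr n * vol y \<rho>"
          using vol_growth[of \<rho> "r / \<rho>" y] \<rho>_pos \<open>1 \<le> r / \<rho>\<close> by simp
        also have "\<dots> \<le> D * (r / \<rho>) powr \<kappa> * vol y \<rho>"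
          using D_ge_1 \<open>1 \<le> r / \<rho>\<close> n_le_\<kappa> by (intro mult_left_mono mult_right_mono powr_mono) auto
        finally show ?thesis .
      qed
      have \<psi>N: "N * \<psi> y r \<le> C_near * \<Lambda>"
      proof -
        have "N * \<psi> y r \<le> N * (C_near * \<psi> x0 r)"
          using N \<psi>_near[OF r y] by (simp add: C_near_def)
        also have "\<dots> = C_near * (N * \<psi> x0 r)" by simp
        also have "\<dots> \<le> C_near * \<Lambda>" using Cpos \<Lambda> by (intro mult_left_mono) auto
        finally show ?thesis .
      qed
      have g: "\<psi> y R * vol y R \<le> C\<^sub>g * (R / r) powr \<kappa> * (\<psi> y r * vol y r)"
        using \<psi>_growth[OF r \<open>R / r \<ge> 1\<close>, of y] r by simp
      have "C_cover * N * (\<psi> y R * vol y R) \<le> C_cover * N * (C\<^sub>g * (R / r) powr \<kappa> * (\<psi> y r * vol y r))"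
        using Cpos N by (intro mult_left_mono g) auto
      also have "\<dots> = C_cover * C\<^sub>g * (R / r) powr \<kappa> * (N * \<psi> y r) * vol y r" by (simp add: mult_ac)
      also have "\<dots> \<le> C_cover * C\<^sub>g * (R / r) powr \<kappa> * (C_near * \<Lambda>) * (D * (r / \<rho>) powr \<kappa> * vol y \<rho>)"
        using Cpos C\<^sub>g_ge_1 \<Lambda> by (intro mult_mono[OF mult_left_mono[OF \<psi>N] v]) auto
      also have "\<dots> = C_cover * C\<^sub>g * C_near * D * (\<Lambda> * ((R / r) powr \<kappa> * (r / \<rho>) powr \<kappa>) * vol y \<rho>)"
        by (simp add: mult_ac)
      also have "(R / r) powr \<kappa> * (r / \<rho>) powr \<kappa> = (R / \<rho>) powr \<kappa>"
        using r R_pos \<rho>_pos by (simp add: powr_mult[symmetric])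
      also have "C_cover * C\<^sub>g * C_near * D * (\<Lambda> * (R / \<rho>) powr \<kappa> * vol y \<rho>) \<le> C_grow * (\<Lambda> * (R / \<rho>) powr \<kappa> * vol y \<rho>)"
        using Cpos \<Lambda> D_ge_1 by (intro mult_right_mono) (auto simp: C_grow_def)
      finally show "C_cover * N * \<psi> y R * vol y R \<le> C_grow * \<Lambda> * (R / \<rho>) powr \<kappa> * vol y \<rho>"
        by (simp add: mult_ac)
    qed
    finally show ?thesis .
  qed
qed

text \<open>Both operators are compared with the one at the sum of the two times. At scale \<tau>
  the kernel acts on \<open>osc f r\<close>, and balls about \<open>x\<close> are enlarged to balls
  about the stopping centre \<open>y\<close>, where the averages before stopping are known. At scale
  r it acts on \<open>osc f \<tau>\<close> with \<tau> \<le> r, where \<open>kernel_osc_le\<close>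
  applies.\<close>

lemma osc_compare:
  assumes f: "campanato_bounded f N" and r: "r > 0" and \<Lambda>: "N * \<psi> x0 r \<le> \<Lambda>" "\<Lambda> > 0"
    and y: "d y x0 < r" and \<rho>: "\<rho> = r / 2 ^ k"
    and stop: "\<And>j. j < k \<Longrightarrow>
      (\<integral>\<^sup>+z\<in>qball d y (r / 2 ^ j). ennreal (osc f r z) \<partial>\<mu>) \<le> ennreal (C_stop * \<Lambda> * vol y (r / 2 ^ j))"
    and \<tau>: "\<tau> = 2 * K * \<rho>" "\<tau> \<le> r" and x: "d x y < \<tau>" "d x x0 < r"
    and sg: "kernel_op \<mu> a (\<tau> powr m) (kernel_op \<mu> a (r powr m) f) x = kernel_op \<mu> a (\<tau> powr m + r powr m) f x"
      "kernel_op \<mu> a (r powr m) (kernel_op \<mu> a (\<tau> powr m) f) x = kernel_op \<mu> a (r powr m + \<tau> powr m) f x"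
  shows "osc f r x \<le> osc f \<tau> x + C_comp * \<Lambda>"
proof -
  have N: "N > 0" using f by (rule campanato_bounded_pos)
  have \<rho>_pos: "\<rho> > 0" using r by (simp add: \<rho>)
  have \<tau>_pos: "\<tau> > 0" using \<rho>_pos K_pos by (simp add: \<tau>)
  note Cpos = constants_pos C_cover_pos C_kernel_pos
  define H1 where "H1 = C_kernel * (C_grow * \<Lambda> * (4 * K\<^sup>2) powr \<kappa> * (D * (2 * K) powr n))"
  define H2 where "H2 = C_kernel * (C_cover * C\<^sub>g * N * \<psi> x r)"
  have H: "H1 \<ge> 0" "H2 \<ge> 0"
    using Cpos \<Lambda> D_ge_1 N C\<^sub>g_ge_1 \<psi>_pos[OF r, of x] by (auto simp: H1_def H2_def)
  have "(\<integral>\<^sup>+z. ennreal (norm (a (\<tau> powr m) x z)) * ennreal (osc f r z) \<partial>\<mu>) \<le> ennreal H1"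
    unfolding H1_def
  proof (rule kernel_integral_le[OF \<tau>_pos])
    show "(\<lambda>z. ennreal (osc f r z)) \<in> borel_measurable \<mu>"
      using campanato_bounded_osc_measurable f r by blast
    show "0 \<le> C_grow * \<Lambda> * (4 * K\<^sup>2) powr \<kappa> * (D * (2 * K) powr n)"
      using Cpos \<Lambda> D_ge_1 by simp
    fix i :: nat
    \<comment> \<open>As \<open>x\<close> is within \<tau> of \<open>y\<close>, the ball of this
      radius about \<open>y\<close> contains the ball of radius 2^i \<tau> about \<open>x\<close>.
      It equals 4 K^2 2^i \<rho>, so it is at least 2 \<rho> and the bound after stopping
      applies.\<close>
    define R where "R = 2 * K * (2 ^ i * \<tau>)"
    have "\<tau> \<le> 2 ^ i * \<tau>" using \<tau>_pos by simp
    then have "K * (2 ^ i * \<tau> + \<tau>) \<le> K * (2 * (2 ^ i * \<tau>))" using K_pos by (intro mult_left_mono) linarith+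
    then have "K * (2 ^ i * \<tau> + \<tau>) \<le> R" by (simp add: R_def mult_ac)
    then have sub: "qball d x (2 ^ i * \<tau>) \<subseteq> qball d y R"
      using qball_subset_qball[OF x(1), of "2 ^ i * \<tau>"] qball_mono by blast
    have R\<rho>: "R = 4 * K\<^sup>2 * 2 ^ i * \<rho>" by (simp add: R_def \<tau> power2_eq_square)
    have K2: "K\<^sup>2 \<ge> 1" using one_le_power[OF K_ge_1, of 2] .
    have "(1::real) * 1 \<le> K\<^sup>2 * 2 ^ i" using K2 by (intro mult_mono) auto
    then have "2 * \<rho> \<le> R" using \<rho>_pos by (simp add: R\<rho>)
    have "(\<integral>\<^sup>+z\<in>qball d x (2 ^ i * \<tau>). ennreal (osc f r z) \<partial>\<mu>) \<le> (\<integral>\<^sup>+z\<in>qball d y R. ennreal (osc f r z) \<partial>\<mu>)"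
      by (intro nn_set_integral_set_mono sub)
    also have "\<dots> \<le> ennreal (C_grow * \<Lambda> * (R / \<rho>) powr \<kappa> * vol y \<rho>)"
      using integral_after_stopping_le[OF f r \<Lambda> y \<rho> stop \<open>2 * \<rho> \<le> R\<close>] by simp
    also have "\<dots> \<le> ennreal (C_grow * \<Lambda> * (4 * K\<^sup>2) powr \<kappa> * (D * (2 * K) powr n) * (2 ^ i) powr \<kappa> * vol x \<tau>)"
    proof (rule ennreal_leI)
      have "1 * \<rho> \<le> \<tau>" unfolding \<tau> using \<rho>_pos K_ge_1 by (intro mult_right_mono) auto
      then have "vol y \<rho> \<le> vol y \<tau>" by (intro vol_mono qball_mono) simp
      also have "\<dots> \<le> D * (2 * K) powr n * vol x \<tau>"
        using x(1) \<tau>_pos by (intro vol_near) (auto simp: dist_sym)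
      finally have v: "vol y \<rho> \<le> D * (2 * K) powr n * vol x \<tau>" .
      have "(R / \<rho>) powr \<kappa> = (4 * K\<^sup>2) powr \<kappa> * (2 ^ i) powr \<kappa>"
        using \<rho>_pos by (simp add: R\<rho> powr_mult)
      then have "C_grow * \<Lambda> * (R / \<rho>) powr \<kappa> * vol y \<rho> = C_grow * \<Lambda> * ((4 * K\<^sup>2) powr \<kappa> * (2 ^ i) powr \<kappa>) * vol y \<rho>"
        by simp
      also have "\<dots> \<le> C_grow * \<Lambda> * ((4 * K\<^sup>2) powr \<kappa> * (2 ^ i) powr \<kappa>) * (D * (2 * K) powr n * vol x \<tau>)"
        using Cpos \<Lambda> by (intro mult_left_mono v) auto
      finally show "C_grow * \<Lambda> * (R / \<rho>) powr \<kappa> * vol y \<rho>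
          \<le> C_grow * \<Lambda> * (4 * K\<^sup>2) powr \<kappa> * (D * (2 * K) powr n) * (2 ^ i) powr \<kappa> * vol x \<tau>"
        by (simp add: mult_ac)
    qed
    finally show "(\<integral>\<^sup>+z\<in>qball d x (2 ^ i * \<tau>). ennreal (osc f r z) \<partial>\<mu>) \<le> \<dots>" .
  qed
  then have d1: "norm (kernel_op \<mu> a (\<tau> powr m) f x - kernel_op \<mu> a (\<tau> powr m + r powr m) f x) \<le> H1"
    using \<tau>_pos r H sg(1) by (intro kernel_op_diff_le[OF f])
  have d2: "norm (kernel_op \<mu> a (r powr m) f x - kernel_op \<mu> a (r powr m + \<tau> powr m) f x) \<le> H2"
    unfolding H2_def
    using r \<tau>_pos H(2) sg(2) \<tau>(2) by (intro kernel_op_diff_le[OF f _ _ _ kernel_osc_le[OF f]]) (auto simp: H2_def)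
  \<comment> \<open>\<open>w\<close> will be the operator at scale \<tau> and \<open>s\<close> the
    one at the sum of the times, through which \<open>v\<close> and \<open>w\<close> are
    compared.\<close>
  have tri: "norm (u - v) \<le> norm (u - w) + norm (w - s) + norm (v - s)" for u v w s :: complex
  proof -
    have "u - v = (u - w) + ((w - s) - (v - s))" by simp
    then show ?thesis
      using norm_triangle_ineq[of "u - w" "(w - s) - (v - s)"] norm_triangle_ineq4[of "w - s" "v - s"] by simp
  qed
  have "osc f r x \<le> osc f \<tau> x + H1 + H2"
    using tri[of "f x" "kernel_op \<mu> a (r powr m) f x" "kernel_op \<mu> a (\<tau> powr m) f x" "kernel_op \<mu> a (\<tau> powr m + r powr m) f x"] d1 d2
    by (simp add: osc_def add.commute[of "\<tau> powr m" "r powr m"])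
  moreover have "H1 + H2 \<le> C_comp * \<Lambda>"
  proof -
    have "N * \<psi> x r \<le> C_near * (N * \<psi> x0 r)"
      using N \<psi>_near[OF r x(2)] by (simp add: C_near_def mult_ac)
    also have "\<dots> \<le> C_near * \<Lambda>" using Cpos \<Lambda> by (intro mult_left_mono) auto
    finally have "C_kernel * C_cover * C\<^sub>g * (N * \<psi> x r) \<le> C_kernel * C_cover * C\<^sub>g * (C_near * \<Lambda>)"
      using Cpos C\<^sub>g_ge_1 by (intro mult_left_mono) auto
    then show ?thesis by (simp add: H1_def H2_def C_comp_def algebra_simps)
  qed
  ultimately show ?thesis by simp
qed

section \<open>The John--Nirenberg inequality\<close>

text \<open>Twice the stopping height, so that a point above the step has a value more than twice
  the admissible average, plus the loss in passing from one scale to the other.\<close>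

definition C_step :: real where "C_step = 2 * C_stop + C_comp"

lemma C_step_pos: "C_step > 0"
  using constants_pos by (simp add: C_step_def)

text \<open>Calderon-Zygmund stopping by dyadic averages of \<open>osc f r\<close>, at points where
  that function is large. Points of large value without a large average form a null set by
  \<open>null_if_small_averages\<close>; disjointness of the undilated balls bounds the total
  volume. The last clause gives up one step in value and changes to the scale of the stopping ball,
  which makes the result iterable.\<close>

lemma stopping_balls:
  assumes f: "campanato_bounded f N" and r: "r > 0" and \<Lambda>: "N * \<psi> x0 r \<le> \<Lambda>" "\<Lambda> > 0"
  obtains I \<tau> where "countable I" "I \<subseteq> qball d x0 r"
    "\<And>y. y \<in> I \<Longrightarrow> 0 < \<tau> y \<and> \<tau> y \<le> r / (2 * K)"
    "(\<integral>\<^sup>+y. ennreal (vol y (\<tau> y)) \<partial>count_space I) \<le> ennreal (vol x0 r / 2)"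
    "AE x in \<mu>. x \<in> qball d x0 r \<longrightarrow> osc f r x > C_step * \<Lambda> \<longrightarrow>
       (\<exists>y\<in>I. x \<in> qball d y (\<tau> y) \<and> osc f r x \<le> osc f (\<tau> y) x + C_step * \<Lambda>)"
proof -
  note [measurable] = campanato_bounded_osc_measurable[OF f r]
  have [measurable]: "osc f r \<in> borel_measurable \<mu>"
    using osc_measurable[OF r] campanato_bounded_measurable[OF f] by blast
  note Cpos = constants_pos
  define \<theta> where "\<theta> = C_stop * \<Lambda>"
  have \<theta>: "\<theta> > 0" using Cpos \<Lambda> by (simp add: \<theta>_def)
  define small where "small y j \<longleftrightarrow>
    (\<integral>\<^sup>+z\<in>qball d y (r / 2 ^ j). ennreal (osc f r z) \<partial>\<mu>) \<le> ennreal (\<theta> * vol y (r / 2 ^ j))" for y j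
  define E where "E = {x \<in> qball d x0 r. osc f r x > 2 * \<theta>}"
  define E' where "E' = {x \<in> E. \<exists>j. \<not> small x j}"
  define k where "k y = (LEAST j. \<not> small y j)" for y
  have k: "\<not> small y (k y)" if "y \<in> E'" for y
    unfolding k_def by (rule LeastI_ex) (use that in \<open>auto simp: E'_def\<close>)
  have below: "small y j" if "j < k y" for y j
    using not_less_Least[of j "\<lambda>j. \<not> small y j"] that by (auto simp: k_def)
  have E'_sub: "E' \<subseteq> qball d x0 r" by (auto simp: E'_def E_def)
  obtain I where I: "I \<subseteq> E'" "countable I" "disjoint_family_on (\<lambda>y. qball d y (r / 2 ^ k y)) I"
    "E' \<subseteq> (\<Union>y\<in>I. qball d y (2 * K * (r / 2 ^ k y)))"
    using vitali_cover[OF r E'_sub, of k] by metis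
  define \<tau> where "\<tau> y = 2 * K * (r / 2 ^ k y)" for y
  have \<tau>_pos: "\<tau> y > 0" for y using r K_pos by (simp add: \<tau>_def)
  have near: "d y x0 < r" if "y \<in> I" for y using that I(1) E'_sub by (auto simp: mem_qball)
  \<comment> \<open>At a radius of at least r / (4 K^2) the average would still be small, contrary
    to the choice of \<open>k y\<close>.\<close>
  have stop_small: "r / 2 ^ k y < r / (4 * K\<^sup>2)" if "y \<in> I" for y
  proof (rule ccontr)
    assume "\<not> ?thesis"
    moreover have "r / 2 ^ k y \<le> r" using r by (simp add: field_simps)
    ultimately have "small y (k y)"
      unfolding small_def \<theta>_def using average_large_radius_le[OF f r \<Lambda> near[OF that]] by simp
    then show False using k that I(1) by blast
  qed
  have \<tau>_le: "\<tau> y \<le> r / (2 * K)" if "y \<in> I" for y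
  proof -
    have "2 * K * (r / 2 ^ k y) \<le> 2 * K * (r / (4 * K\<^sup>2))"
      using stop_small[OF that] K_pos by (intro mult_left_mono) auto
    then show ?thesis using K_pos by (simp add: \<tau>_def power2_eq_square)
  qed
  show ?thesis
  proof (rule that[of I \<tau>])
    show "countable I" by fact
    show "I \<subseteq> qball d x0 r" using I E'_sub by blast
    show "0 < \<tau> y \<and> \<tau> y \<le> r / (2 * K)" if "y \<in> I" for y using \<tau>_le[OF that] \<tau>_pos by simp
    let ?q = "D * (2 * K) powr n"
    have q: "?q > 0" using D_ge_1 K_ge_1 by simp
    \<comment> \<open>Each undilated ball has average above \<theta>, so its volume is at most its
      integral divided by \<theta>. These integrals are over disjoint sets inside the ball of radius
      2 K r.\<close>
    have "(\<integral>\<^sup>+y. ennreal (vol y (\<tau> y)) \<partial>count_space I) \<le>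
       (\<integral>\<^sup>+y. ennreal (?q / \<theta>) * (\<integral>\<^sup>+z\<in>qball d y (r / 2 ^ k y). ennreal (osc f r z) \<partial>\<mu>) \<partial>count_space I)"
    proof (rule nn_integral_mono)
      fix y assume "y \<in> space (count_space I)"
      then have "y \<in> E'" using I(1) by auto
      have "ennreal (vol y (\<tau> y)) \<le> ennreal (?q * vol y (r / 2 ^ k y))"
        using vol_dilate[of "r / 2 ^ k y" y] r by (intro ennreal_leI) (simp add: \<tau>_def)
      also have "?q * vol y (r / 2 ^ k y) = ?q / \<theta> * (\<theta> * vol y (r / 2 ^ k y))"
        using \<theta> by simp
      also have "ennreal \<dots> = ennreal (?q / \<theta>) * ennreal (\<theta> * vol y (r / 2 ^ k y))"
        using \<theta> q by (intro ennreal_mult) auto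
      also have "\<dots> \<le> ennreal (?q / \<theta>) * (\<integral>\<^sup>+z\<in>qball d y (r / 2 ^ k y). ennreal (osc f r z) \<partial>\<mu>)"
        using k[OF \<open>y \<in> E'\<close>] unfolding small_def by (intro mult_left_mono) auto
      finally show "ennreal (vol y (\<tau> y)) \<le> \<dots>" .
    qed
    also have "\<dots> = ennreal (?q / \<theta>) *
        (\<integral>\<^sup>+y. (\<integral>\<^sup>+z\<in>qball d y (r / 2 ^ k y). ennreal (osc f r z) \<partial>\<mu>) \<partial>count_space I)"
      by (intro nn_integral_cmult) auto
    also have "\<dots> \<le> ennreal (?q / \<theta>) * (\<integral>\<^sup>+z\<in>qball d x0 (2 * K * r). ennreal (osc f r z) \<partial>\<mu>)"
    proof (intro mult_left_mono sum_disjoint_le_nn_integral I)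
      fix y assume "y \<in> I"
      have "r / 2 ^ k y \<le> r" using r by (simp add: field_simps)
      then show "qball d y (r / 2 ^ k y) \<subseteq> qball d x0 (2 * K * r)"
        using qball_subset_qball[OF near[OF \<open>y \<in> I\<close>], of r] qball_mono[of "r / 2 ^ k y" r y] by (auto simp: mult_ac)
    qed auto
    also have "\<dots> \<le> ennreal (?q / \<theta>) * ennreal (C_top * \<Lambda> * vol x0 r)"
      by (intro mult_left_mono osc_top_le[OF f r \<Lambda>(1)]) auto
    also have "\<dots> = ennreal (?q / \<theta> * (C_top * \<Lambda> * vol x0 r))"
      using q \<theta> Cpos \<Lambda> by (intro ennreal_mult[symmetric]) auto
    also have "\<dots> \<le> ennreal (vol x0 r / 2)"
    proof (rule ennreal_leI)
      have "?q * C_top * 2 * 1 \<le> ?q * C_top * 2 * (D * (4 * K\<^sup>2) powr n)"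
      proof (intro mult_left_mono)
        have "1 \<le> 4 * K\<^sup>2" using one_le_power[OF K_ge_1, of 2] by linarith
        then have "1 * 1 \<le> D * (4 * K\<^sup>2) powr n"
          using D_ge_1 n_pos by (intro mult_mono ge_one_powr_ge_zero) auto
        then show "1 \<le> D * (4 * K\<^sup>2) powr n" by simp
      qed (use q Cpos in auto)
      also have "\<dots> = C_stop" by (simp add: C_stop_def mult_ac)
      finally have "?q * C_top * 2 \<le> C_stop" by simp
      then have "?q * C_top / C_stop \<le> 1 / 2" using Cpos by (simp add: field_simps)
      then have "?q * C_top / C_stop * vol x0 r \<le> 1 / 2 * vol x0 r" by (intro mult_right_mono) auto
      then show "?q / \<theta> * (C_top * \<Lambda> * vol x0 r) \<le> vol x0 r / 2"
        using \<Lambda> by (simp add: \<theta>_def mult_ac)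
    qed
    finally show "(\<integral>\<^sup>+y. ennreal (vol y (\<tau> y)) \<partial>count_space I) \<le> ennreal (vol x0 r / 2)" .
    \<comment> \<open>The part of \<open>E\<close> missed by the dilated balls. It contains no point
      of \<open>E'\<close>, so all dyadic averages at its points are at most \<theta>, although
      \<open>osc f r\<close> exceeds 2 \<theta> there.\<close>
    define F where "F = E - (\<Union>y\<in>I. qball d y (\<tau> y))"
    have E_sets: "E \<in> sets \<mu>"
    proof -
      have "E = qball d x0 r \<inter> {x \<in> space \<mu>. osc f r x > 2 * \<theta>}" by (auto simp: E_def space_eq_UNIV)
      then show ?thesis by simp
    qed
    have F_sets: "F \<in> sets \<mu>"
      unfolding F_def using E_sets I(2) by (intro sets.Diff sets.countable_UN') auto
    have F_small: "small x j" if "x \<in> F" for x j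
      using that I(4) by (auto simp: F_def E'_def \<tau>_def)
    have "emeasure \<mu> F = 0"
    proof (rule null_if_small_averages[OF F_sets _ r r \<theta>])
      show "F \<subseteq> qball d x0 r" by (auto simp: F_def E_def)
      show "(\<lambda>x. ennreal (osc f r x)) \<in> borel_measurable \<mu>" by measurable
      show "ennreal (2 * \<theta>) \<le> ennreal (osc f r x)" if "x \<in> F" for x
        using that by (intro ennreal_leI) (auto simp: F_def E_def)
      show "(\<integral>\<^sup>+y\<in>qball d x (r / 2 ^ j). ennreal (osc f r y) \<partial>\<mu>) \<le> ennreal (\<theta> * vol x (r / 2 ^ j))"
        if "x \<in> F" for x j
        using F_small[OF that, of j] by (simp add: small_def)
    qed
    then have ae_F: "AE x in \<mu>. x \<notin> F"
      using F_sets by (intro AE_I'[of F]) (auto simp: null_sets_def)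
    have pw: "r powr m > 0" "\<tau> y powr m > 0" for y using r \<tau>_pos[of y] by auto
    \<comment> \<open>Countability of \<open>I\<close> gives one null set for all stopping
      times.\<close>
    have sg: "AE x in \<mu>. \<forall>y\<in>I.
        kernel_op \<mu> a (\<tau> y powr m) (kernel_op \<mu> a (r powr m) f) x = kernel_op \<mu> a (\<tau> y powr m + r powr m) f x \<and>
        kernel_op \<mu> a (r powr m) (kernel_op \<mu> a (\<tau> y powr m) f) x = kernel_op \<mu> a (r powr m + \<tau> y powr m) f x"
      using f pw I(2) unfolding campanato_bounded_def
      by (subst AE_ball_countable) (auto intro!: AE_conjI)
    show "AE x in \<mu>. x \<in> qball d x0 r \<longrightarrow> osc f r x > C_step * \<Lambda> \<longrightarrow>
       (\<exists>y\<in>I. x \<in> qball d y (\<tau> y) \<and> osc f r x \<le> osc f (\<tau> y) x + C_step * \<Lambda>)"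
      using ae_F sg
    proof eventually_elim
      case (elim x)
      show ?case
      proof (intro impI)
        assume x: "x \<in> qball d x0 r" "osc f r x > C_step * \<Lambda>"
        have "2 * \<theta> \<le> C_step * \<Lambda>"
          using Cpos \<Lambda> by (simp add: \<theta>_def C_step_def algebra_simps)
        then have "x \<in> E" using x by (simp add: E_def)
        then obtain y where y: "y \<in> I" "x \<in> qball d y (\<tau> y)" using elim(1) by (auto simp: F_def)
        have "r / (2 * K) \<le> r" using r K_ge_1 by (simp add: field_simps)
        then have "\<tau> y \<le> r" using \<tau>_le[OF y(1)] by simp
        then have "osc f r x \<le> osc f (\<tau> y) x + C_comp * \<Lambda>"
          using below x(1) y elim(2)
          by (intro osc_compare[OF f r \<Lambda> near[OF y(1)] refl, of "k y"])
            (auto simp: small_def \<theta>_def \<tau>_def mem_qball)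
        also have "\<dots> \<le> osc f (\<tau> y) x + C_step * \<Lambda>"
          using Cpos \<Lambda> by (simp add: C_step_def)
        finally show "\<exists>y\<in>I. x \<in> qball d y (\<tau> y) \<and> osc f r x \<le> osc f (\<tau> y) x + C_step * \<Lambda>"
          using y by blast
      qed
    qed
  qed
qed

text \<open>The side condition on the dilated ball is inherited by the
  stopping balls, which keeps \<open>\<psi>\<close> under control throughout the iteration.\<close>

lemma john_nirenberg:
  assumes f: "campanato_bounded f N" and R: "R > 0" and \<Lambda>: "\<Lambda> = N * (C\<^sub>m * \<psi> x0 R)"
    and r: "r > 0" and sub: "qball d x (2 * K * r) \<subseteq> qball d x0 R"
  shows "emeasure \<mu> {y \<in> qball d x r. osc f r y > real j * (C_step * \<Lambda>)} \<le> ennreal ((1 / 2) ^ j * vol x r)"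
  using r sub
proof (induction j arbitrary: x r)
  case 0
  have "emeasure \<mu> {y \<in> qball d x r. osc f r y > real 0 * (C_step * \<Lambda>)} \<le> emeasure \<mu> (qball d x r)"
    by (intro emeasure_mono) auto
  then show ?case by (simp add: emeasure_qball)
next
  case (Suc j)
  note r = \<open>r > 0\<close>
  have N: "N > 0" using f by (rule campanato_bounded_pos)
  have \<Lambda>_pos: "\<Lambda> > 0" using N C\<^sub>m_ge_1 \<psi>_pos[OF R] by (simp add: \<Lambda>)
  have meas: "{y \<in> qball d z s. osc f s y > c} \<in> sets \<mu>" if "s > 0" for z s c
  proof -
    have [measurable]: "osc f s \<in> borel_measurable \<mu>"
      using osc_measurable[OF that] campanato_bounded_measurable[OF f] by blast
    have "{y \<in> qball d z s. osc f s y > c} = qball d z s \<inter> {y \<in> space \<mu>. osc f s y > c}"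
      by (auto simp: space_eq_UNIV)
    then show ?thesis by simp
  qed
  have "1 * r \<le> 2 * K * r" using r K_ge_1 by (intro mult_right_mono) auto
  then have "qball d x r \<subseteq> qball d x0 R" using Suc.prems(2) qball_mono[of r "2 * K * r" x] by auto
  \<comment> \<open>Almost monotonicity is applied from the current ball directly to the top ball,
    so its constant enters once and does not accumulate over the generations.\<close>
  then have "N * \<psi> x r \<le> \<Lambda>"
    using \<psi>_mono[OF r R] N by (simp add: \<Lambda>)
  from stopping_balls[OF f r this \<Lambda>_pos] obtain I \<tau> where I: "countable I" "I \<subseteq> qball d x r"
    "\<And>y. y \<in> I \<Longrightarrow> 0 < \<tau> y \<and> \<tau> y \<le> r / (2 * K)"
    "(\<integral>\<^sup>+y. ennreal (vol y (\<tau> y)) \<partial>count_space I) \<le> ennreal (vol x r / 2)"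
    "AE z in \<mu>. z \<in> qball d x r \<longrightarrow> osc f r z > C_step * \<Lambda> \<longrightarrow>
       (\<exists>y\<in>I. z \<in> qball d y (\<tau> y) \<and> osc f r z \<le> osc f (\<tau> y) z + C_step * \<Lambda>)"
    by blast
  \<comment> \<open>A value above j + 1 steps at scale r is a value above j steps at the scale of
    some stopping ball, so these level sets cover up to a null set.\<close>
  define S where "S y = {z \<in> qball d y (\<tau> y). osc f (\<tau> y) z > real j * (C_step * \<Lambda>)}" for y
  have S_sets: "S y \<in> sets \<mu>" if "y \<in> I" for y
    using meas I(3)[OF that] by (simp add: S_def)
  have U_sets: "(\<Union>y\<in>I. S y) \<in> sets \<mu>" using I(1) S_sets by (intro sets.countable_UN') auto
  have "emeasure \<mu> {y \<in> qball d x r. osc f r y > real (Suc j) * (C_step * \<Lambda>)} \<le> emeasure \<mu> (\<Union>y\<in>I. S y)"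
  proof (rule emeasure_mono_AE[OF _ U_sets], use I(5) in eventually_elim, intro impI)
    fix z assume z: "z \<in> {y \<in> qball d x r. osc f r y > real (Suc j) * (C_step * \<Lambda>)}"
      and ex: "z \<in> qball d x r \<longrightarrow> osc f r z > C_step * \<Lambda> \<longrightarrow>
       (\<exists>y\<in>I. z \<in> qball d y (\<tau> y) \<and> osc f r z \<le> osc f (\<tau> y) z + C_step * \<Lambda>)"
    have c: "C_step * \<Lambda> > 0" using C_step_pos \<Lambda>_pos by simp
    then have "1 * (C_step * \<Lambda>) \<le> real (Suc j) * (C_step * \<Lambda>)" by (intro mult_right_mono) auto
    then have "C_step * \<Lambda> \<le> real (Suc j) * (C_step * \<Lambda>)" by simp
    then obtain y where "y \<in> I" "z \<in> qball d y (\<tau> y)" "osc f r z \<le> osc f (\<tau> y) z + C_step * \<Lambda>"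
      using z ex by auto
    then show "z \<in> (\<Union>y\<in>I. S y)" using z by (auto simp: S_def algebra_simps intro!: bexI[of _ y])
  qed
  also have "emeasure \<mu> (\<Union>y\<in>I. S y) = (\<integral>\<^sup>+z\<in>(\<Union>y\<in>I. S y). 1 \<partial>\<mu>)"
    using U_sets by simp
  also have "\<dots> \<le> (\<integral>\<^sup>+y. (\<integral>\<^sup>+z\<in>S y. 1 \<partial>\<mu>) \<partial>count_space I)"
    using I(1) S_sets by (intro nn_integral_le_sum_cover) auto
  also have "\<dots> \<le> (\<integral>\<^sup>+y. ennreal ((1 / 2) ^ j) * ennreal (vol y (\<tau> y)) \<partial>count_space I)"
  proof (rule nn_integral_mono)
    fix y assume "y \<in> space (count_space I)"
    then have y: "y \<in> I" by simp
    \<comment> \<open>The bound r / (2 K) on stopping radii is exactly what transfers the side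
      condition to the stopping ball.\<close>
    have "2 * K * \<tau> y \<le> r" using I(3)[OF y] K_pos by (simp add: field_simps)
    then have "qball d y (2 * K * \<tau> y) \<subseteq> qball d y r" by (rule qball_mono)
    also have "\<dots> \<subseteq> qball d x (K * (r + r))"
      using I(2) y by (intro qball_subset_qball) (auto simp: mem_qball)
    also have "K * (r + r) = 2 * K * r" by simp
    also have "qball d x (2 * K * r) \<subseteq> qball d x0 R" by fact
    finally have "emeasure \<mu> (S y) \<le> ennreal ((1 / 2) ^ j * vol y (\<tau> y))"
      unfolding S_def using I(3)[OF y] by (intro Suc.IH) auto
    then show "(\<integral>\<^sup>+z\<in>S y. 1 \<partial>\<mu>) \<le> ennreal ((1 / 2) ^ j) * ennreal (vol y (\<tau> y))"
      using S_sets[OF y] by (simp add: ennreal_mult)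
  qed
  also have "\<dots> = ennreal ((1 / 2) ^ j) * (\<integral>\<^sup>+y. ennreal (vol y (\<tau> y)) \<partial>count_space I)"
    by (intro nn_integral_cmult) auto
  also have "\<dots> \<le> ennreal ((1 / 2) ^ j) * ennreal (vol x r / 2)"
    by (intro mult_left_mono I) auto
  also have "\<dots> = ennreal ((1 / 2) ^ Suc j * vol x r)"
    by (simp flip: ennreal_mult)
  finally show ?case .
qed

text \<open>Layer-cake summation. The side condition of \<open>john_nirenberg\<close> is met by
  taking the ball of radius 2 K r itself as the top ball, at the cost of one use of
  \<open>\<psi>_dilate\<close>.\<close>

lemma osc_powr_integral_le:
  assumes f: "campanato_bounded f N" and r: "r > 0" and p: "p > 0"
  shows "(\<integral>\<^sup>+y\<in>qball d x r. ennreal (osc f r y powr p) \<partial>\<mu>)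
    \<le> ennreal (jn_sum p * (C_step * C\<^sub>m * C\<^sub>g * (2 * K) powr \<kappa> * N * \<psi> x r) powr p * vol x r)"
proof -
  have N: "N > 0" using f by (rule campanato_bounded_pos)
  have R: "2 * K * r > 0" using r K_pos by simp
  define b where "b = C_step * (N * (C\<^sub>m * \<psi> x (2 * K * r)))"
  have b: "b > 0" using C_step_pos N C\<^sub>m_ge_1 \<psi>_pos[OF R] by (simp add: b_def)
  have [measurable]: "osc f r \<in> borel_measurable \<mu>"
    using osc_measurable[OF r] campanato_bounded_measurable[OF f] by blast
  define S where "S j = {y \<in> qball d x r. osc f r y > real j * b}" for j
  have [measurable]: "S j \<in> sets \<mu>" for j
  proof -
    have "S j = qball d x r \<inter> {y \<in> space \<mu>. osc f r y > real j * b}" by (auto simp: S_def space_eq_UNIV)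
    then show ?thesis by simp
  qed
  have term_le: "F j \<le> (\<Sum>j. F j)" for F :: "nat \<Rightarrow> ennreal" and j
    using sum_le_suminf[OF summableI, of "{j}" F] by simp
  have "(\<integral>\<^sup>+y\<in>qball d x r. ennreal (osc f r y powr p) \<partial>\<mu>) \<le>
      (\<integral>\<^sup>+y. (\<Sum>j. ennreal (((real j + 1) * b) powr p) * indicator (S j) y) \<partial>\<mu>)"
  proof (rule nn_integral_mono)
    fix y
    show "ennreal (osc f r y powr p) * indicator (qball d x r) y \<le>
        (\<Sum>j. ennreal (((real j + 1) * b) powr p) * indicator (S j) y)"
    proof (cases "y \<in> qball d x r \<and> osc f r y > 0")
      case True
      define u where "u = osc f r y / b"
      \<comment> \<open>Rounding up and subtracting 1 gives j < u \<le> j + 1; the strict inequality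
        on the left matches the level sets \<open>S j\<close>.\<close>
      define j where "j = nat (\<lceil>u\<rceil> - 1)"
      have "u > 0" using True b by (simp add: u_def)
      then have "\<lceil>u\<rceil> \<ge> 1" by linarith
      then have j: "real j = of_int \<lceil>u\<rceil> - 1" by (simp add: j_def)
      have "real j < u" "u \<le> real j + 1" unfolding j using ceiling_correct[of u] by linarith+
      then have *: "real j * b < osc f r y" "osc f r y \<le> (real j + 1) * b"
        using b by (simp_all add: u_def field_simps)
      then have "ennreal (osc f r y powr p) * indicator (qball d x r) y
          \<le> ennreal (((real j + 1) * b) powr p) * indicator (S j) y"
        using True p by (auto simp: S_def intro!: ennreal_leI powr_mono2)
      also have "\<dots> \<le> (\<Sum>j. ennreal (((real j + 1) * b) powr p) * indicator (S j) y)"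
        by (rule term_le[of "\<lambda>j. ennreal (((real j + 1) * b) powr p) * indicator (S j) y"])
      finally show ?thesis .
    next
      case False
      then have "y \<notin> qball d x r \<or> osc f r y = 0" using osc_nonneg[of f r y] by auto
      then show ?thesis by auto
    qed
  qed
  also have "\<dots> = (\<Sum>j. \<integral>\<^sup>+y. ennreal (((real j + 1) * b) powr p) * indicator (S j) y \<partial>\<mu>)"
    by (intro nn_integral_suminf) auto
  also have "\<dots> = (\<Sum>j. ennreal (((real j + 1) * b) powr p) * emeasure \<mu> (S j))"
    by (intro suminf_cong nn_integral_cmult_indicator) auto
  also have "\<dots> \<le> (\<Sum>j. ennreal (((real j + 1) * b) powr p) * ennreal ((1 / 2) ^ j * vol x r))"
    unfolding S_def b_def
    by (intro suminf_le mult_left_mono john_nirenberg[OF f R refl r]) auto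
  also have "\<dots> = (\<Sum>j. ennreal (b powr p * vol x r * ((real j + 1) powr p * (1 / 2) ^ j)))"
    using b by (intro suminf_cong) (simp add: powr_mult mult_ac flip: ennreal_mult)
  also have "\<dots> = ennreal (b powr p * vol x r * jn_sum p)"
    unfolding jn_sum_def by (intro suminf_ennreal_eq sums_mult summable_sums summable_powr_half) auto
  also have "\<dots> \<le> ennreal (jn_sum p * (C_step * C\<^sub>m * C\<^sub>g * (2 * K) powr \<kappa> * N * \<psi> x r) powr p * vol x r)"
  proof (rule ennreal_leI)
    have "b \<le> C_step * (N * (C\<^sub>m * (C\<^sub>g * (2 * K) powr \<kappa> * \<psi> x r)))"
      unfolding b_def using C_step_pos N C\<^sub>m_ge_1 r K_ge_1 by (intro mult_left_mono \<psi>_dilate) auto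
    then have "b powr p \<le> (C_step * C\<^sub>m * C\<^sub>g * (2 * K) powr \<kappa> * N * \<psi> x r) powr p"
      using b p by (intro powr_mono2) (auto simp: mult_ac)
    then have "b powr p * (vol x r * jn_sum p) \<le>
        (C_step * C\<^sub>m * C\<^sub>g * (2 * K) powr \<kappa> * N * \<psi> x r) powr p * (vol x r * jn_sum p)"
      using jn_sum_pos[of p] by (intro mult_right_mono) auto
    then show "b powr p * vol x r * jn_sum p \<le>
        jn_sum p * (C_step * C\<^sub>m * C\<^sub>g * (2 * K) powr \<kappa> * N * \<psi> x r) powr p * vol x r"
      by (simp add: mult_ac)
  qed
  finally show ?thesis .
qed

end

section \<open>Dimensions and growth functions\<close>

context homogeneous_type_space
begin

text \<open>Doubling is iterated about log l times, with logarithms to base 2. The 1 added to the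
  exponent log C makes it positive also for C = 1. Thus \<open>dim_n0\<close> is an infimum over a
  nonempty set.\<close>

lemma cond_D_exists: "\<exists>n>0. cond_D d \<mu> n"
proof -
  obtain C where C: "C \<ge> 1" "\<And>x r. r > 0 \<Longrightarrow> emeasure \<mu> (qball d x (2 * r)) \<le> ennreal C * emeasure \<mu> (qball d x r)"
    using doubling by blast
  have step: "vol x (2 * r) \<le> C * vol x r" if "r > 0" for x r
    using C(2)[OF that, of x] C(1)
    by (simp add: emeasure_qball ennreal_le_iff flip: ennreal_mult)
  have iter: "vol x (2 ^ k * r) \<le> C ^ k * vol x r" if "r > 0" for x r k
  proof (induction k)
    case (Suc k)
    have "vol x (2 * (2 ^ k * r)) \<le> C * vol x (2 ^ k * r)" using that by (intro step) simp
    also have "\<dots> \<le> C * (C ^ k * vol x r)" using C(1) Suc by (intro mult_left_mono) auto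
    finally show ?case by (simp add: mult_ac)
  qed simp
  have "vol x (l * r) \<le> C * l powr (log 2 C + 1) * vol x r" if "r > 0" "l \<ge> 1" for x r l
  proof -
    define k where "k = nat \<lceil>log 2 l\<rceil>"
    have lg: "log 2 l \<ge> 0" using that by simp
    then have k: "log 2 l \<le> real k" "real k \<le> log 2 l + 1" by (auto simp: k_def)
    have "l = 2 powr (log 2 l)" using that by simp
    also have "\<dots> \<le> 2 powr real k" using k by (intro powr_mono) auto
    also have "\<dots> = 2 ^ k" by (simp add: powr_realpow)
    finally have "l * r \<le> 2 ^ k * r" using that by (intro mult_right_mono) auto
    then have "vol x (l * r) \<le> vol x (2 ^ k * r)" by (intro vol_mono qball_mono)
    also have "\<dots> \<le> C ^ k * vol x r" using that by (intro iter)
    also have "C ^ k = C powr real k" using C by (simp add: powr_realpow)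
    also have "C powr real k * vol x r \<le> C powr (log 2 l + 1) * vol x r"
      using C k by (intro mult_right_mono powr_mono) auto
    also have "C powr (log 2 l + 1) = C * l powr (log 2 C)"
    proof -
      have "C powr (log 2 l) = l powr (log 2 C)"
        using C that by (simp add: powr_def log_def)
      then show ?thesis using C by (simp add: powr_add)
    qed
    also have "C * l powr (log 2 C) * vol x r \<le> C * l powr (log 2 C + 1) * vol x r"
      using C that by (intro mult_left_mono mult_right_mono powr_mono) auto
    finally show ?thesis .
  qed
  then have "cond_D d \<mu> (log 2 C + 1)" unfolding cond_D_def by blast
  moreover have "log 2 C + 1 > 0" using C(1) zero_le_log_cancel_iff[of 2 C] by linarith
  ultimately show ?thesis by blast
qed

lemma dim_n0_nonneg: "dim_n0 d \<mu> \<ge> 0"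
  unfolding dim_n0_def using cond_D_exists by (intro cInf_greatest) auto

lemma dim_n0_less:
  assumes "dim_n0 d \<mu> < c"
  obtains n where "0 < n" "n < c" "cond_D d \<mu> n"
proof -
  have "\<exists>n\<in>{n. 0 < n \<and> cond_D d \<mu> n}. n < c"
    using assms cond_D_exists unfolding dim_n0_def
    by (subst (asm) cInf_less_iff) (auto intro!: bdd_belowI[of _ 0])
  then show ?thesis using that by auto
qed

text \<open>Each admissible \<alpha> is at most every admissible n, and \<alpha> = 0 is admissible,
  so the supremum is over a nonempty set. In the lower bound for \<open>M\<close> this makes n0 -
  \<alpha>0 nonnegative and leaves \<open>M\<close> above n0 p / i.\<close>

lemma dim_alpha0_le_dim_n0: "dim_alpha0 d \<mu> \<le> dim_n0 d \<mu>"
  unfolding dim_alpha0_def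
proof (rule cSup_least)
  have "cond_R d \<mu> 0"
    unfolding cond_R_def
  proof (intro exI[of _ 1] conjI allI impI)
    fix x and r l :: real
    assume "0 < r \<and> ereal r < 2 * qdiam d \<and> 1 \<le> l \<and> ereal l < 2 * qdiam d / ereal r"
    then have "r > 0" "l \<ge> 1" by auto
    then have "r \<le> l * r" by simp
    then have "vol x r \<le> vol x (l * r)" by (intro vol_mono qball_mono)
    then show "inverse 1 * l powr 0 * vol x r \<le> vol x (l * r)"
      using \<open>l \<ge> 1\<close> by simp
  qed simp
  then show "{\<alpha>. 0 \<le> \<alpha> \<and> (\<forall>n. 0 < n \<and> cond_D d \<mu> n \<longrightarrow> \<alpha> \<le> n) \<and> cond_R d \<mu> \<alpha>} \<noteq> {}"
    by (auto intro!: exI[of _ 0])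
  fix \<alpha> assume "\<alpha> \<in> {\<alpha>. 0 \<le> \<alpha> \<and> (\<forall>n. 0 < n \<and> cond_D d \<mu> n \<longrightarrow> \<alpha> \<le> n) \<and> cond_R d \<mu> \<alpha>}"
  then show "\<alpha> \<le> dim_n0 d \<mu>"
    unfolding dim_n0_def using cond_D_exists by (intro cInf_greatest) auto
qed

text \<open>The mass of a ball for the density \<phi>(y, t). It is extended valued because its
  finiteness has to be derived from the Muckenhoupt condition.\<close>

definition weight :: "('a \<Rightarrow> real \<Rightarrow> real) \<Rightarrow> 'a \<Rightarrow> real \<Rightarrow> real \<Rightarrow> ennreal" where
  "weight \<phi> x r t = (\<integral>\<^sup>+y\<in>qball d x r. ennreal (\<phi> y t) \<partial>\<mu>)"

lemma nn_integral_qball_pos: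
  fixes h :: "'a \<Rightarrow> ennreal"
  assumes "r > 0" and [measurable]: "h \<in> borel_measurable \<mu>" and "\<And>y. h y > 0"
  shows "(\<integral>\<^sup>+y\<in>qball d x r. h y \<partial>\<mu>) > 0"
proof (rule ccontr)
  assume "\<not> ?thesis"
  then have "(\<integral>\<^sup>+y\<in>qball d x r. h y \<partial>\<mu>) = 0" by simp
  then have "AE y in \<mu>. h y * indicator (qball d x r) y = 0"
    by (subst (asm) nn_integral_0_iff_AE) auto
  then have "AE y in \<mu>. y \<notin> qball d x r"
  proof eventually_elim
    case (elim y)
    then show ?case using assms(3)[of y] by (auto split: split_indicator_asm)
  qed
  then have "emeasure \<mu> (qball d x r) = 0"
    by (subst (asm) AE_iff_measurable[OF _ refl]) (auto simp: space_eq_UNIV)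
  then show False using ball_positive[OF assms(1), of x] by simp
qed

end

section \<open>Growth functions and their indices\<close>

lemma epowr_nonzero: "x \<noteq> 0 \<Longrightarrow> epowr x a \<noteq> 0"
  by (cases x) (auto simp: epowr_def)

lemma epowr_ennreal: "c \<ge> 0 \<Longrightarrow> epowr (ennreal c) a = ennreal (c powr a)"
  by (simp add: epowr_def)

lemma epowr_top: "epowr top a = top"
  by (simp add: epowr_def)

lemma growth_function_pos: "growth_function d \<mu> \<phi> \<Longrightarrow> t > 0 \<Longrightarrow> \<phi> x t > 0"
  by (simp add: growth_function_def orlicz_function_def)

lemma growth_function_0: "growth_function d \<mu> \<phi> \<Longrightarrow> \<phi> x 0 = 0"
  by (simp add: growth_function_def orlicz_function_def)

lemma growth_function_mono: "growth_function d \<mu> \<phi> \<Longrightarrow> 0 \<le> s \<Longrightarrow> s \<le> t \<Longrightarrow> \<phi> x s \<le> \<phi> x t"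
  by (auto simp: growth_function_def orlicz_function_def mono_on_def)

lemma growth_function_nonneg: "growth_function d \<mu> \<phi> \<Longrightarrow> t \<ge> 0 \<Longrightarrow> \<phi> x t \<ge> 0"
  using growth_function_mono[of d \<mu> \<phi> 0 t x] growth_function_0[of d \<mu> \<phi> x] by simp

lemma growth_function_measurable: "growth_function d \<mu> \<phi> \<Longrightarrow> t \<ge> 0 \<Longrightarrow> (\<lambda>x. \<phi> x t) \<in> borel_measurable \<mu>"
  by (simp add: growth_function_def)

text \<open>The upper type \<open>1\<close> is what forces lower types to be at most \<open>1\<close>.\<close>

lemma lower_type_le_1:
  assumes \<phi>: "growth_function d \<mu> \<phi>" and p: "uniformly_lower_type \<phi> p"
  shows "p \<le> 1"
proof (rule ccontr)
  assume "\<not> p \<le> 1"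
  obtain C where C: "\<And>x t s. t \<ge> 0 \<Longrightarrow> 0 < s \<Longrightarrow> s < 1 \<Longrightarrow> \<phi> x (s * t) \<le> C * s powr p * \<phi> x t"
    using p unfolding uniformly_lower_type_def by blast
  obtain C' where C': "\<And>x t s. t \<ge> 0 \<Longrightarrow> s \<ge> 1 \<Longrightarrow> \<phi> x (s * t) \<le> C' * s powr 1 * \<phi> x t"
    using \<phi> unfolding growth_function_def uniformly_upper_type_def by blast
  fix x
  have pos: "\<phi> x 1 > 0" using growth_function_pos[OF \<phi>] by simp
  have bound: "s powr (p - 1) \<le> C * C'" if s: "s > 1" for s
  proof -
    have 1: "\<phi> x 1 \<le> C * (1 / s) powr p * \<phi> x s" using C[of s "1 / s" x] s by simp
    have 2: "\<phi> x s \<le> C' * s * \<phi> x 1" using C'[of 1 s x] s by simp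
    have "C > 0"
    proof (rule ccontr)
      assume "\<not> C > 0"
      then have "C * ((1 / s) powr p * \<phi> x s) \<le> 0"
        using growth_function_nonneg[OF \<phi>, of s x] s by (intro mult_nonpos_nonneg) auto
      then show False using 1 pos by (simp add: mult_ac)
    qed
    have "\<phi> x 1 \<le> C * (1 / s) powr p * (C' * s * \<phi> x 1)"
      using \<open>C > 0\<close> by (intro order_trans[OF 1] mult_left_mono 2) auto
    also have "\<dots> = C * C' * ((1 / s) powr p * s) * \<phi> x 1" by simp
    also have "(1 / s) powr p * s = 1 / s powr (p - 1)"
      using s by (simp add: powr_diff powr_divide)
    finally have "1 * \<phi> x 1 \<le> C * C' * (1 / s powr (p - 1)) * \<phi> x 1" by simp
    then have "1 \<le> C * C' * (1 / s powr (p - 1))" using pos by (rule mult_right_le_imp_le)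
    then show ?thesis using s by (simp add: field_simps)
  qed
  define s where "s = (\<bar>C * C'\<bar> + 2) powr (1 / (p - 1))"
  have "s > 1" unfolding s_def using \<open>\<not> p \<le> 1\<close> by (intro gr_one_powr) auto
  moreover have "s powr (p - 1) = \<bar>C * C'\<bar> + 2"
    using \<open>\<not> p \<le> 1\<close> by (simp add: s_def powr_powr)
  ultimately show False using bound[of s] by linarith
qed

lemma index_i_pos_le_1:
  assumes "growth_function d \<mu> \<phi>"
  shows "0 < index_i \<phi>" "index_i \<phi> \<le> 1"
proof -
  obtain p where p: "0 < p" "uniformly_lower_type \<phi> p" using assms by (auto simp: growth_function_def)
  have bdd: "bdd_above {p. 0 < p \<and> uniformly_lower_type \<phi> p}"
    using lower_type_le_1[OF assms] by (intro bdd_aboveI[of _ 1]) auto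
  show "0 < index_i \<phi>"
    using cSup_upper[OF _ bdd, of p] p by (simp add: index_i_def)
  show "index_i \<phi> \<le> 1"
    unfolding index_i_def using p lower_type_le_1[OF assms] by (intro cSup_least) auto
qed

lemma less_index_i:
  assumes "growth_function d \<mu> \<phi>" "c < index_i \<phi>"
  obtains p where "0 < p" "c < p" "p \<le> 1" "uniformly_lower_type \<phi> p"
proof -
  have "\<exists>p\<in>{p. 0 < p \<and> uniformly_lower_type \<phi> p}. c < p"
    using assms by (intro less_cSupD) (auto simp: index_i_def growth_function_def)
  then show ?thesis using that lower_type_le_1[OF assms(1)] by auto
qed

lemma index_p_ge_1:
  assumes "growth_function d \<mu> \<phi>"
  shows "1 \<le> index_p d \<mu> \<phi>"
  unfolding index_p_def
  using assms by (intro cInf_greatest) (auto simp: growth_function_def class_A_infty_def)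

lemma index_p_less:
  assumes "growth_function d \<mu> \<phi>" "index_p d \<mu> \<phi> < c"
  obtains p where "1 \<le> p" "p < c" "class_A d \<mu> p \<phi>"
proof -
  have "\<exists>p\<in>{p. 1 \<le> p \<and> class_A d \<mu> p \<phi>}. p < c"
    using assms unfolding index_p_def
    by (subst (asm) cInf_less_iff)
      (auto simp: growth_function_def class_A_infty_def intro!: bdd_belowI[of _ 1])
  then show ?thesis using that by auto
qed

section \<open>Muckenhoupt weights on concentric balls\<close>

context homogeneous_type_space
begin

text \<open>The lower bound that the Hoelder inequality gives for a Muckenhoupt weight is obtained
  with a worse constant from the pointwise bound \<open>1 \<le> w / c + (c / w) powr (1 / (p - 1))\<close>.\<close>

lemma class_A_real_bound:
  assumes \<phi>: "growth_function d \<mu> \<phi>" and p: "p > 1"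
    and A: "average \<mu> (qball d x r) (\<lambda>y. ennreal (\<phi> y t)) *
      epowr (average \<mu> (qball d x r) (\<lambda>y. ennreal (\<phi> y t powr (- 1 / (p - 1))))) (p - 1) \<le> ennreal A"
    and A0: "A \<ge> 0" and pos: "t > 0" "s > 0" and sr: "s \<le> r"
  shows "weight \<phi> x r t < \<infinity>" "weight \<phi> x r t * ennreal (vol x s powr p) \<le>
    ennreal (A * 2 powr p * vol x r powr p) * weight \<phi> x s t"
proof -
  have r: "r > 0" using pos sr by simp
  define w where "w y = \<phi> y t" for y
  have w_pos: "w y > 0" for y using growth_function_pos[OF \<phi> pos(1)] by (simp add: w_def)
  have [measurable]: "w \<in> borel_measurable \<mu>"
    using growth_function_measurable[OF \<phi>] pos by (simp add: w_def[abs_def])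
  define u where "u y = w y powr (- 1 / (p - 1))" for y
  have [measurable]: "u \<in> borel_measurable \<mu>" unfolding u_def[abs_def] by measurable
  define I where "I = (\<integral>\<^sup>+y\<in>qball d x r. ennreal (w y) \<partial>\<mu>)"
  define J where "J = (\<integral>\<^sup>+y\<in>qball d x r. ennreal (u y) \<partial>\<mu>)"
  define V where "V = vol x r"
  have V: "V > 0" using r by (simp add: V_def vol_pos)
  have I0: "I > 0" unfolding I_def using w_pos by (intro nn_integral_qball_pos r) auto
  have J0: "J > 0" unfolding J_def using w_pos[THEN less_imp_neq] by (intro nn_integral_qball_pos r) (auto simp: u_def)
  have A': "I / ennreal V * epowr (J / ennreal V) (p - 1) \<le> ennreal A"
    using A by (simp add: average_def I_def J_def u_def w_def V_def emeasure_qball)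
  have IJ0: "I / ennreal V \<noteq> 0" "J / ennreal V \<noteq> 0"
    using I0 J0 V by (auto simp: ennreal_divide_eq_0_iff)
  \<comment> \<open>Both factors of the Muckenhoupt product are nonzero, so a finite product
    excludes an infinite factor.\<close>
  have I_fin: "I \<noteq> top"
  proof
    assume "I = top"
    then have "I / ennreal V = top" by (simp add: ennreal_top_divide)
    then show False using A' epowr_nonzero[OF IJ0(2)] by (simp add: ennreal_top_mult top_unique)
  qed
  have J_fin: "J \<noteq> top"
  proof
    assume "J = top"
    then have "epowr (J / ennreal V) (p - 1) = top" by (simp add: ennreal_top_divide epowr_top)
    then show False using A' IJ0(1) by (simp add: ennreal_mult_top top_unique)
  qed
  obtain i where i: "I = ennreal i" "i > 0" using I_fin I0 by (cases I) auto
  obtain j where j: "J = ennreal j" "j > 0" using J_fin J0 by (cases J) auto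
  have "i / V * (j / V) powr (p - 1) \<le> A"
    using A' i j V A0 by (simp add: divide_ennreal epowr_ennreal ennreal_le_iff flip: ennreal_mult)
  also have "i / V * (j / V) powr (p - 1) = i * j powr (p - 1) / V powr p"
    using V j by (simp add: powr_divide powr_diff field_simps)
  finally have Ai: "i * j powr (p - 1) \<le> A * V powr p"
    using V by (simp add: field_simps)
  show "weight \<phi> x r t < \<infinity>" using I_fin by (simp add: weight_def I_def w_def less_top)
  define v where "v = vol x s"
  have v: "v > 0" using pos by (simp add: v_def vol_pos)
  \<comment> \<open>With this threshold the second term of the pointwise bound integrates to v / 2
    over the large ball, so the first must account for the other half of v.\<close>
  define c where "c = (v / (2 * j)) powr (p - 1)"
  have c: "c > 0" "c powr (1 / (p - 1)) = v / (2 * j)"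
    using v j p by (auto simp: c_def powr_powr)
  have sub: "qball d x s \<subseteq> qball d x r" by (rule qball_mono[OF sr])
  define I' where "I' = (\<integral>\<^sup>+y\<in>qball d x s. ennreal (w y) \<partial>\<mu>)"
  have "I' \<le> I" unfolding I'_def I_def by (intro nn_set_integral_set_mono sub)
  then obtain i' where i': "I' = ennreal i'" "i' \<ge> 0" using i by (cases I') (auto simp: top_unique)
  have ennreal_sum_prod: "ennreal (a1 * b1 + a2 * b2) = ennreal a1 * ennreal b1 + ennreal a2 * ennreal b2"
    if "a1 \<ge> 0" "b1 \<ge> 0" "a2 \<ge> 0" "b2 \<ge> 0" for a1 b1 a2 b2
    using that by (simp add: ennreal_mult)
  have "ennreal v = (\<integral>\<^sup>+y\<in>qball d x s. 1 \<partial>\<mu>)" by (simp add: v_def emeasure_qball)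
  also have "\<dots> \<le> (\<integral>\<^sup>+y. ennreal (1 / c) * (ennreal (w y) * indicator (qball d x s) y) +
      ennreal (v / (2 * j)) * (ennreal (u y) * indicator (qball d x r) y) \<partial>\<mu>)"
  proof (rule nn_integral_mono)
    fix y
    have "1 \<le> 1 / c * w y + v / (2 * j) * u y"
    proof (cases "w y \<ge> c")
      case True
      then have "1 \<le> 1 / c * w y" using c by (simp add: field_simps)
      moreover have "0 \<le> v / (2 * j) * u y" using v j by (simp add: u_def)
      ultimately show ?thesis by linarith
    next
      case False
      have "1 = c powr (1 / (p - 1)) * c powr (- 1 / (p - 1))"
        using c(1) by (simp flip: powr_add)
      also have "\<dots> \<le> v / (2 * j) * u y"
        unfolding c(2) u_def using False w_pos[of y] v j p
        by (intro mult_left_mono powr_mono2') (auto simp: field_simps)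
      also have "\<dots> \<le> 1 / c * w y + v / (2 * j) * u y" using c w_pos[of y] by simp
      finally show ?thesis .
    qed
    then have "1 \<le> ennreal (1 / c * w y + v / (2 * j) * u y)" by simp
    also have "\<dots> = ennreal (1 / c) * ennreal (w y) + ennreal (v / (2 * j)) * ennreal (u y)"
      using c w_pos[of y] v j by (intro ennreal_sum_prod) (auto simp: u_def)
    finally show "1 * indicator (qball d x s) y \<le> ennreal (1 / c) * (ennreal (w y) * indicator (qball d x s) y) +
      ennreal (v / (2 * j)) * (ennreal (u y) * indicator (qball d x r) y)"
      using sub by (auto simp: indicator_def)
  qed
  also have "\<dots> = ennreal (1 / c) * I' + ennreal (v / (2 * j)) * J"
    unfolding I'_def J_def by (subst nn_integral_add) (auto simp: nn_integral_cmult)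
  also have "\<dots> = ennreal (1 / c * i' + v / (2 * j) * j)"
    unfolding i'(1) j(1) using i' j c v by (intro ennreal_sum_prod[symmetric]) auto
  finally have "v \<le> 1 / c * i' + v / (2 * j) * j"
    using c i' v j by (subst (asm) ennreal_le_iff) auto
  then have "v / 2 * c \<le> i'" using c j by (simp add: field_simps)
  also have "v / 2 * c = (v / 2) powr p / j powr (p - 1)"
    using v j by (simp add: c_def powr_divide powr_mult powr_diff field_simps)
  finally have "v powr p \<le> 2 powr p * i' * j powr (p - 1)"
    using j by (simp add: powr_divide field_simps)
  then have "i * v powr p \<le> i * (2 powr p * i' * j powr (p - 1))"
    using i by (intro mult_left_mono) auto
  also have "\<dots> = (i * j powr (p - 1)) * (2 powr p * i')" by simp
  also have "\<dots> \<le> A * V powr p * (2 powr p * i')" using Ai i' by (intro mult_right_mono) auto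
  finally have "ennreal (i * v powr p) \<le> ennreal (A * 2 powr p * V powr p * i')"
    by (intro ennreal_leI) (simp add: mult_ac)
  then show "weight \<phi> x r t * ennreal (vol x s powr p) \<le>
      ennreal (A * 2 powr p * vol x r powr p) * weight \<phi> x s t"
    using i i' A0 by (simp add: weight_def I_def[symmetric] I'_def[symmetric] w_def[symmetric]
        v_def[symmetric] V_def[symmetric] ennreal_mult)
qed

text \<open>For p = 1 the essential supremum of 1 / w bounds 1 by a multiple of w almost everywhere;
  integrating this over the small ball takes the place of the two-term pointwise bound.\<close>

lemma class_A1_real_bound:
  assumes \<phi>: "growth_function d \<mu> \<phi>"
    and A: "average \<mu> (qball d x r) (\<lambda>y. ennreal (\<phi> y t)) *
      esssup_on \<mu> (qball d x r) (\<lambda>y. ennreal (inverse (\<phi> y t))) \<le> ennreal A"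
    and A0: "A \<ge> 0" and pos: "t > 0" "s > 0" and sr: "s \<le> r"
  shows "weight \<phi> x r t < \<infinity>" "weight \<phi> x r t * ennreal (vol x s) \<le>
    ennreal (A * vol x r) * weight \<phi> x s t"
proof -
  have r: "r > 0" using pos sr by simp
  define w where "w y = \<phi> y t" for y
  have w_pos: "w y > 0" for y using growth_function_pos[OF \<phi> pos(1)] by (simp add: w_def)
  have [measurable]: "w \<in> borel_measurable \<mu>"
    using growth_function_measurable[OF \<phi>] pos by (simp add: w_def[abs_def])
  define I where "I = (\<integral>\<^sup>+y\<in>qball d x r. ennreal (w y) \<partial>\<mu>)"
  define e where "e = esssup_on \<mu> (qball d x r) (\<lambda>y. ennreal (inverse (w y)))"
  define V where "V = vol x r"
  have V: "V > 0" using r by (simp add: V_def vol_pos)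
  have I0: "I > 0" unfolding I_def using w_pos by (intro nn_integral_qball_pos r) auto
  have ae: "AE y in \<mu>. y \<in> qball d x r \<longrightarrow> ennreal (inverse (w y)) \<le> e"
    using esssup_AE[of "\<lambda>y. ennreal (inverse (w y))" "restrict_space \<mu> (qball d x r)"]
    unfolding e_def esssup_on_def by (subst (asm) AE_restrict_space_iff) (auto simp: space_eq_UNIV)
  have e0: "e \<noteq> 0"
  proof
    assume "e = 0"
    with ae have "AE y in \<mu>. y \<notin> qball d x r"
      by (elim eventually_mono) (use w_pos in \<open>auto simp: not_le[symmetric] ennreal_eq_0_iff\<close>)
    then have "emeasure \<mu> (qball d x r) = 0"
      by (subst (asm) AE_iff_measurable[OF _ refl]) (auto simp: space_eq_UNIV)
    then show False using ball_positive[OF r, of x] by simp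
  qed
  have A': "I / ennreal V * e \<le> ennreal A"
    using A by (simp add: average_def I_def e_def w_def V_def emeasure_qball)
  have IV0: "I / ennreal V \<noteq> 0"
    using I0 V by (auto simp: ennreal_divide_eq_0_iff)
  have I_fin: "I \<noteq> top"
  proof
    assume "I = top"
    then have "I / ennreal V = top" by (simp add: ennreal_top_divide)
    then show False using A' e0 by (simp add: ennreal_top_mult top_unique)
  qed
  have e_fin: "e \<noteq> top"
    using A' IV0 by (auto simp: ennreal_mult_top top_unique)
  obtain i where i: "I = ennreal i" "i > 0" using I_fin I0 by (cases I) auto
  obtain k where k: "e = ennreal k" "k > 0" using e_fin e0 by (cases e) auto
  have "i / V * k \<le> A"
    using A' i k V A0 by (simp add: divide_ennreal ennreal_le_iff flip: ennreal_mult)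
  then have Ai: "i * k \<le> A * V" using V by (simp add: field_simps)
  show "weight \<phi> x r t < \<infinity>" using I_fin by (simp add: weight_def I_def w_def less_top)
  have sub: "qball d x s \<subseteq> qball d x r" by (rule qball_mono[OF sr])
  define I' where "I' = (\<integral>\<^sup>+y\<in>qball d x s. ennreal (w y) \<partial>\<mu>)"
  have "I' \<le> I" unfolding I'_def I_def by (intro nn_set_integral_set_mono sub)
  then obtain i' where i': "I' = ennreal i'" "i' \<ge> 0" using i by (cases I') (auto simp: top_unique)
  have "ennreal (vol x s) = (\<integral>\<^sup>+y\<in>qball d x s. 1 \<partial>\<mu>)" by (simp add: emeasure_qball)
  also have "\<dots> \<le> (\<integral>\<^sup>+y. ennreal k * (ennreal (w y) * indicator (qball d x s) y) \<partial>\<mu>)"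
    using ae
  proof (intro nn_integral_mono_AE, elim eventually_mono)
    fix y assume y: "y \<in> qball d x r \<longrightarrow> ennreal (inverse (w y)) \<le> e"
    show "1 * indicator (qball d x s) y \<le> ennreal k * (ennreal (w y) * indicator (qball d x s) y)"
    proof (cases "y \<in> qball d x s")
      case True
      then have "inverse (w y) \<le> k" using y sub k by (auto simp: ennreal_le_iff)
      then have "1 \<le> k * w y" using w_pos[of y] by (simp add: field_simps)
      then have "1 \<le> ennreal k * ennreal (w y)" using k w_pos[of y] by (simp flip: ennreal_mult)
      then show ?thesis using True by simp
    qed simp
  qed
  also have "\<dots> = ennreal (k * i')"
    using i' k by (simp add: nn_integral_cmult I'_def[symmetric] ennreal_mult)
  finally have "vol x s \<le> k * i'" using k i' by (subst (asm) ennreal_le_iff) auto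
  then have "i * vol x s \<le> i * (k * i')" using i by (intro mult_left_mono) auto
  also have "\<dots> = (i * k) * i'" by simp
  also have "\<dots> \<le> A * V * i'" using Ai i' by (intro mult_right_mono) auto
  finally have "ennreal (i * vol x s) \<le> ennreal (A * V * i')" by (rule ennreal_leI)
  then show "weight \<phi> x r t * ennreal (vol x s) \<le> ennreal (A * vol x r) * weight \<phi> x s t"
    using i i' A0 V by (simp add: weight_def I_def[symmetric] I'_def[symmetric] w_def[symmetric]
        V_def[symmetric] ennreal_mult)
qed

text \<open>Turns the extended supremum of the class into one real constant for all balls and all t.
  The comparison of mass ratios with volume ratios is stated as a product, which avoids division in
  \<open>ennreal\<close>; the 1 added in the witness makes the constant at least 1.\<close>

lemma class_A_weight_growth:
  assumes \<phi>: "growth_function d \<mu> \<phi>" and p: "p \<ge> 1" "class_A d \<mu> p \<phi>"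
  obtains A where "A \<ge> 1" "\<And>x r t. r > 0 \<Longrightarrow> t > 0 \<Longrightarrow> weight \<phi> x r t < \<infinity>"
    "\<And>x r s t. 0 < s \<Longrightarrow> s \<le> r \<Longrightarrow> t > 0 \<Longrightarrow>
      weight \<phi> x r t * ennreal (vol x s powr p) \<le> ennreal (A * vol x r powr p) * weight \<phi> x s t"
proof -
  let ?F = "\<lambda>t x r. average \<mu> (qball d x r) (\<lambda>y. ennreal (\<phi> y t)) *
        (if p = 1 then esssup_on \<mu> (qball d x r) (\<lambda>y. ennreal (inverse (\<phi> y t)))
         else epowr (average \<mu> (qball d x r) (\<lambda>y. ennreal (\<phi> y t powr (- 1 / (p - 1))))) (p - 1))"
  have fin: "(SUP t\<in>{0<..}. SUP x. SUP r\<in>{0<..}. ?F t x r) < top"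
    using p(2) unfolding class_A_def by simp
  then obtain A0 where A0: "(SUP t\<in>{0<..}. SUP x. SUP r\<in>{0<..}. ?F t x r) = ennreal A0" "A0 \<ge> 0"
    by (rule less_top_ennreal[THEN iffD1, THEN exE]) auto
  have F_le: "?F t x r \<le> ennreal A0" if "t > 0" "r > 0" for t x r
  proof -
    have "?F t x r \<le> (SUP r\<in>{0<..}. ?F t x r)" using that by (intro SUP_upper) auto
    also have "\<dots> \<le> (SUP x. SUP r\<in>{0<..}. ?F t x r)" by (rule SUP_upper) auto
    also have "\<dots> \<le> (SUP t\<in>{0<..}. SUP x. SUP r\<in>{0<..}. ?F t x r)" using that by (intro SUP_upper) auto
    finally show ?thesis by (simp only: A0)
  qed
  have main: "weight \<phi> x r t < \<infinity> \<and> weight \<phi> x r t * ennreal (vol x s powr p) \<le>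
      ennreal (A0 * 2 powr p * vol x r powr p) * weight \<phi> x s t"
    if "0 < s" "s \<le> r" "t > 0" for x r s t
  proof (cases "p = 1")
    case True
    have "r > 0" using that by simp
    then have *: "average \<mu> (qball d x r) (\<lambda>y. ennreal (\<phi> y t)) *
      esssup_on \<mu> (qball d x r) (\<lambda>y. ennreal (inverse (\<phi> y t))) \<le> ennreal A0"
      using F_le[of t r x] that True by simp
    have "weight \<phi> x r t * ennreal (vol x s) \<le> ennreal (A0 * vol x r) * weight \<phi> x s t"
      by (rule class_A1_real_bound(2)[OF \<phi> * A0(2) that(3,1,2)])
    also have "\<dots> \<le> ennreal (A0 * 2 * vol x r) * weight \<phi> x s t"
      using A0 by (intro mult_right_mono ennreal_leI) auto
    finally show ?thesis
      using class_A1_real_bound(1)[OF \<phi> * A0(2) that(3,1,2)] True by simp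
  next
    case False
    have "r > 0" using that by simp
    then have *: "average \<mu> (qball d x r) (\<lambda>y. ennreal (\<phi> y t)) *
      epowr (average \<mu> (qball d x r) (\<lambda>y. ennreal (\<phi> y t powr (- 1 / (p - 1))))) (p - 1) \<le> ennreal A0"
      using F_le[of t r x] that False by simp
    have "p > 1" using p False by simp
    from class_A_real_bound[OF \<phi> this * A0(2) that(3,1,2)] show ?thesis by simp
  qed
  show ?thesis
  proof (rule that[of "A0 * 2 powr p + 1"])
    show "1 \<le> A0 * 2 powr p + 1" using A0 by simp
    show "weight \<phi> x r t < \<infinity>" if "r > 0" "t > 0" for x r t
      using main[of r r t x] that by simp
    show "weight \<phi> x r t * ennreal (vol x s powr p) \<le> ennreal ((A0 * 2 powr p + 1) * vol x r powr p) * weight \<phi> x s t"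
      if "0 < s" "s \<le> r" "t > 0" for x r s t
    proof -
      have "ennreal (A0 * 2 powr p * vol x r powr p) \<le> ennreal ((A0 * 2 powr p + 1) * vol x r powr p)"
        by (intro ennreal_leI mult_right_mono) auto
      then show ?thesis using main[OF that, of x] by (meson mult_right_mono order_trans zero_le)
    qed
  qed
qed

section \<open>Luxemburg norms of balls\<close>

lemma weight_scale:
  assumes \<phi>: "growth_function d \<mu> \<phi>" and C: "C \<ge> 0"
    and lower: "\<And>x t s. t \<ge> 0 \<Longrightarrow> 0 < s \<Longrightarrow> s < 1 \<Longrightarrow> \<phi> x (s * t) \<le> C * s powr p * \<phi> x t"
    and s: "0 < s" "s < 1" and t: "t > 0"
  shows "weight \<phi> x r (s * t) \<le> ennreal (C * s powr p) * weight \<phi> x r t"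
proof -
  have [measurable]: "(\<lambda>y. \<phi> y t) \<in> borel_measurable \<mu>"
    using growth_function_measurable[OF \<phi>] t by simp
  have "weight \<phi> x r (s * t) \<le> (\<integral>\<^sup>+y. ennreal (C * s powr p) * (ennreal (\<phi> y t) * indicator (qball d x r) y) \<partial>\<mu>)"
    unfolding weight_def
  proof (rule nn_integral_mono)
    fix y
    have "ennreal (\<phi> y (s * t)) \<le> ennreal (C * s powr p) * ennreal (\<phi> y t)"
      using lower[of t s y] s t C growth_function_nonneg[OF \<phi>, of t y]
      by (simp flip: ennreal_mult)
    then show "ennreal (\<phi> y (s * t)) * indicator (qball d x r) y \<le>
        ennreal (C * s powr p) * (ennreal (\<phi> y t) * indicator (qball d x r) y)"
      by (simp add: indicator_def)
  qed
  also have "\<dots> = ennreal (C * s powr p) * weight \<phi> x r t"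
    unfolding weight_def by (intro nn_integral_cmult) measurable
  finally show ?thesis .
qed

lemma weight_mono:
  assumes "growth_function d \<mu> \<phi>" "0 \<le> s" "s \<le> t"
  shows "weight \<phi> x r s \<le> weight \<phi> x r t"
  unfolding weight_def
  using growth_function_mono[OF assms] by (intro nn_integral_mono mult_right_mono ennreal_leI) auto

text \<open>Monotone convergence along integer arguments, as \<phi>(y, t) tends to infinity with t
  at every point. This is what keeps the Luxemburg norm of a ball away from 0.\<close>

lemma weight_unbounded:
  assumes \<phi>: "growth_function d \<mu> \<phi>" and r: "r > 0"
  shows "\<exists>k::nat. weight \<phi> x r (real k) > 1"
proof -
  have [measurable]: "(\<lambda>y. \<phi> y (real k)) \<in> borel_measurable \<mu>" for k
    using growth_function_measurable[OF \<phi>] by simp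
  have SUP_top: "(SUP k. ennreal (\<phi> y (real k))) = top" for y
  proof -
    have "filterlim (\<phi> y) at_top at_top" using \<phi> by (simp add: growth_function_def orlicz_function_def)
    then have lim: "filterlim (\<lambda>k. \<phi> y (real k)) at_top sequentially"
      by (rule filterlim_compose) (rule filterlim_real_sequentially)
    show ?thesis
    proof (rule ennreal_SUP_eq_top)
      fix n :: nat
      obtain k where "real n \<le> \<phi> y (real k)"
        using lim unfolding filterlim_at_top eventually_sequentially by blast
      then show "\<exists>k\<in>UNIV. of_nat n \<le> ennreal (\<phi> y (real k))"
        by (intro bexI[of _ k]) (auto simp: ennreal_of_nat_eq_real_of_nat intro: ennreal_leI)
    qed
  qed
  have "(SUP k. weight \<phi> x r (real k)) = (\<integral>\<^sup>+y. (SUP k. ennreal (\<phi> y (real k)) * indicator (qball d x r) y) \<partial>\<mu>)"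
    unfolding weight_def
  proof (intro nn_integral_monotone_convergence_SUP[symmetric])
    show "incseq (\<lambda>k y. ennreal (\<phi> y (real k)) * indicator (qball d x r) y)"
      using growth_function_mono[OF \<phi>]
      by (auto simp: incseq_def le_fun_def intro!: mult_right_mono ennreal_leI)
  qed measurable
  also have "\<dots> = (\<integral>\<^sup>+y. top * indicator (qball d x r) y \<partial>\<mu>)"
    by (intro nn_integral_cong) (simp add: SUP_top SUP_mult_right_ennreal[symmetric])
  also have "\<dots> = top"
    using vol_pos[OF r, of x] by (subst nn_integral_cmult_indicator) (auto simp: emeasure_qball ennreal_top_mult)
  finally have "(1::ennreal) < (SUP k. weight \<phi> x r (real k))" by (metis ennreal_one_less_top)
  then show ?thesis by (auto simp: less_SUP_iff)
qed

lemma chi_norm_qball: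
  assumes "growth_function d \<mu> \<phi>"
  shows "chi_norm \<mu> \<phi> (qball d x r) = Inf {ennreal l |l. l > 0 \<and> weight \<phi> x r (1 / l) \<le> 1}"
proof -
  have "(\<integral>\<^sup>+y. ennreal (\<phi> y (norm (indicator (qball d x r) y :: real) / l)) \<partial>\<mu>) = weight \<phi> x r (1 / l)" for l
    unfolding weight_def using growth_function_0[OF assms]
    by (intro nn_integral_cong) (auto simp: indicator_def)
  then show ?thesis unfolding chi_norm_def lux_norm_def by simp
qed

lemma chi_norm_le:
  assumes "growth_function d \<mu> \<phi>" "l > 0" "weight \<phi> x r (1 / l) \<le> 1"
  shows "chi_norm \<mu> \<phi> (qball d x r) \<le> ennreal l"
  unfolding chi_norm_qball[OF assms(1)] using assms by (intro Inf_lower) auto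

lemma chi_norm_less:
  assumes "growth_function d \<mu> \<phi>" "chi_norm \<mu> \<phi> (qball d x r) < c"
  obtains l where "l > 0" "ennreal l < c" "weight \<phi> x r (1 / l) \<le> 1"
proof -
  have "Inf {ennreal l |l. l > 0 \<and> weight \<phi> x r (1 / l) \<le> 1} < c"
    using assms by (simp add: chi_norm_qball)
  then obtain e where "e \<in> {ennreal l |l. l > 0 \<and> weight \<phi> x r (1 / l) \<le> 1}" "e < c"
    unfolding Inf_less_iff by blast
  then show ?thesis using that by auto
qed

lemma chi_norm_pos:
  assumes "growth_function d \<mu> \<phi>" "r > 0"
  shows "chi_norm \<mu> \<phi> (qball d x r) > 0"
proof -
  obtain k :: nat where k: "weight \<phi> x r (real k) > 1" using weight_unbounded[OF assms] by blast
  have "k > 0"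
    using k growth_function_0[OF assms(1)] by (cases k) (auto simp: weight_def)
  have "ennreal (1 / real k) \<le> chi_norm \<mu> \<phi> (qball d x r)"
    unfolding chi_norm_qball[OF assms(1)]
  proof (rule Inf_greatest)
    fix e assume "e \<in> {ennreal l |l. l > 0 \<and> weight \<phi> x r (1 / l) \<le> 1}"
    then obtain l where l: "e = ennreal l" "l > 0" "weight \<phi> x r (1 / l) \<le> 1" by blast
    have "\<not> real k \<le> 1 / l"
      using weight_mono[OF assms(1), of "real k" "1 / l" x r] k l(3) by (meson leD of_nat_0_le_iff order_trans)
    then have "1 / real k \<le> l" using l(2) \<open>k > 0\<close> by (simp add: field_simps)
    then show "ennreal (1 / real k) \<le> e" unfolding l(1) by (rule ennreal_leI)
  qed
  moreover have "ennreal (1 / real k) > 0" using \<open>k > 0\<close> by simp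
  ultimately show ?thesis by (rule less_le_trans[rotated])
qed

text \<open>If k is admissible for the small ball, the Muckenhoupt and doubling bounds give the
  large ball a mass of at most a multiple of l^(n p) at argument 1 / k; lower type i brings it down
  to 1 once the argument is divided by a multiple of l^(n p / i). Finiteness is the same reduction,
  from the finite mass at argument 1.\<close>

lemma chi_norm_finite_growth:
  assumes \<phi>: "growth_function d \<mu> \<phi>" and p: "p \<ge> 1" "class_A d \<mu> p \<phi>"
    and i: "i > 0" "uniformly_lower_type \<phi> i"
    and n: "n > 0" and D: "D \<ge> 1" "\<And>x r l. r > 0 \<Longrightarrow> l \<ge> 1 \<Longrightarrow> vol x (l * r) \<le> D * l powr n * vol x r"
  shows "\<And>x r. r > 0 \<Longrightarrow> chi_norm \<mu> \<phi> (qball d x r) < top"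
    "\<exists>C\<ge>1. \<forall>x r l. r > 0 \<longrightarrow> l \<ge> 1 \<longrightarrow>
       enn2real (chi_norm \<mu> \<phi> (qball d x (l * r))) \<le> C * l powr (n * p / i) * enn2real (chi_norm \<mu> \<phi> (qball d x r))"
proof -
  obtain c0 where c0: "\<And>x t s. t \<ge> 0 \<Longrightarrow> 0 < s \<Longrightarrow> s < 1 \<Longrightarrow> \<phi> x (s * t) \<le> c0 * s powr i * \<phi> x t"
    using i(2) unfolding uniformly_lower_type_def by blast
  \<comment> \<open>The 2 makes b, and hence \<gamma>, larger than 1, so that 1 / \<gamma> is a
    legitimate factor in the lower type bound.\<close>
  define c where "c = max c0 2"
  have c: "\<phi> x (s * t) \<le> c * s powr i * \<phi> x t" if "t \<ge> 0" "0 < s" "s < 1" for x t s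
    using c0[OF that, of x] growth_function_nonneg[OF \<phi> that(1), of x]
    by (elim order_trans) (intro mult_right_mono, auto simp: c_def)
  have c2: "c \<ge> 2" by (simp add: c_def)
  obtain A where A: "A \<ge> 1" "\<And>x r t. r > 0 \<Longrightarrow> t > 0 \<Longrightarrow> weight \<phi> x r t < \<infinity>"
    "\<And>x r s t. 0 < s \<Longrightarrow> s \<le> r \<Longrightarrow> t > 0 \<Longrightarrow>
      weight \<phi> x r t * ennreal (vol x s powr p) \<le> ennreal (A * vol x r powr p) * weight \<phi> x s t"
    using class_A_weight_growth[OF \<phi> p] by blast
  have scale: "weight \<phi> x r (s * t) \<le> ennreal (c * s powr i) * weight \<phi> x r t"
    if "0 < s" "s < 1" "t > 0" for x r s t
    using weight_scale[OF \<phi> _ c that] c2 by simp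
  show fin: "chi_norm \<mu> \<phi> (qball d x r) < top" if r: "r > 0" for x r
  proof -
    obtain w where w: "weight \<phi> x r 1 = ennreal w" "w \<ge> 0"
      using A(2)[OF r, of 1 x] by (cases "weight \<phi> x r 1") auto
    define l where "l = (c * w + 2) powr (1 / i)"
    have cw: "c * w + 2 > 1" using c2 w mult_nonneg_nonneg[of c w] by linarith
    then have l: "l > 1" unfolding l_def using i by (intro gr_one_powr) auto
    have li: "l powr i = c * w + 2" unfolding l_def using i cw by (simp add: powr_powr)
    have "weight \<phi> x r (1 / l * 1) \<le> ennreal (c * (1 / l) powr i) * weight \<phi> x r 1"
      using l by (intro scale) auto
    also have "\<dots> = ennreal (c * (1 / l) powr i * w)"
      using c2 w by (simp add: ennreal_mult)
    also have "c * (1 / l) powr i * w = c * w / (c * w + 2)"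
      using l by (simp add: powr_divide li)
    also have "ennreal (c * w / (c * w + 2)) \<le> 1"
      using cw by simp
    finally have "weight \<phi> x r (1 / l) \<le> 1" by simp
    then have "chi_norm \<mu> \<phi> (qball d x r) \<le> ennreal l" using l by (intro chi_norm_le \<phi>) auto
    then show ?thesis using ennreal_less_top le_less_trans by blast
  qed
  define b where "b = (c * A * D powr p) powr (1 / i)"
  have "c * A * D powr p \<ge> 2 * 1 * 1"
    using c2 A(1) D(1) p by (intro mult_mono ge_one_powr_ge_zero) auto
  then have cAD: "c * A * D powr p > 1" by simp
  then have b1: "b > 1" unfolding b_def using i by (intro gr_one_powr) auto
  have "enn2real (chi_norm \<mu> \<phi> (qball d x (l * r))) \<le> b * l powr (n * p / i) * enn2real (chi_norm \<mu> \<phi> (qball d x r))"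
    if r: "r > 0" and l: "l \<ge> 1" for x r l
  proof -
    define \<gamma> where "\<gamma> = b * l powr (n * p / i)"
    have "l powr (n * p / i) \<ge> 1" using l n p i by (intro ge_one_powr_ge_zero) auto
    then have "\<gamma> \<ge> b * 1" unfolding \<gamma>_def using b1 by (intro mult_left_mono) auto
    then have \<gamma>: "\<gamma> > 1" using b1 by simp
    have \<gamma>i: "\<gamma> powr i = c * A * D powr p * l powr (n * p)"
      using i cAD c2 A(1) by (simp add: \<gamma>_def b_def powr_mult powr_powr)
    define X where "X = enn2real (chi_norm \<mu> \<phi> (qball d x r))"
    have X: "chi_norm \<mu> \<phi> (qball d x r) = ennreal X" using fin[OF r, of x] by (simp add: X_def)
    have lr: "l * r > 0" "r \<le> l * r" using r l by auto
    \<comment> \<open>The infimum defining the norm need not be attained, so an admissible k is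
      taken below an arbitrary e > X, and e is sent to X at the end.\<close>
    have le: "enn2real (chi_norm \<mu> \<phi> (qball d x (l * r))) \<le> \<gamma> * e" if "e > X" for e
    proof -
      have "X \<ge> 0" by (simp add: X_def)
      then have "chi_norm \<mu> \<phi> (qball d x r) < ennreal e"
        using that by (simp add: X ennreal_less_iff)
      then obtain k where k: "k > 0" "ennreal k < ennreal e" "weight \<phi> x r (1 / k) \<le> 1"
        by (rule chi_norm_less[OF \<phi>])
      have V: "vol x r > 0" "vol x (l * r) > 0" using vol_pos r lr by auto
      have fin': "weight \<phi> x (l * r) (1 / k) < \<infinity>" using A(2)[OF lr(1), of "1 / k" x] k by simp
      then obtain w where w: "weight \<phi> x (l * r) (1 / k) = ennreal w" "w \<ge> 0"
        by (cases "weight \<phi> x (l * r) (1 / k)") auto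
      have "ennreal (w * vol x r powr p) = weight \<phi> x (l * r) (1 / k) * ennreal (vol x r powr p)"
        using w by (simp add: ennreal_mult)
      also have "\<dots> \<le> ennreal (A * vol x (l * r) powr p) * weight \<phi> x r (1 / k)"
        using r lr k by (intro A(3)) auto
      also have "\<dots> \<le> ennreal (A * vol x (l * r) powr p) * 1" by (intro mult_left_mono k) auto
      finally have "w * vol x r powr p \<le> A * vol x (l * r) powr p"
        using A by (simp add: ennreal_le_iff)
      also have "\<dots> \<le> A * (D * l powr n * vol x r) powr p"
        using A p V r l by (intro mult_left_mono powr_mono2 D(2)) auto
      also have "\<dots> = A * D powr p * l powr (n * p) * vol x r powr p"
        using D V l by (simp add: powr_mult powr_powr)
      finally have w_le: "w \<le> A * D powr p * l powr (n * p)" using V by simp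
      have "weight \<phi> x (l * r) (1 / \<gamma> * (1 / k)) \<le> ennreal (c * (1 / \<gamma>) powr i) * weight \<phi> x (l * r) (1 / k)"
        using \<gamma> k by (intro scale) auto
      also have "\<dots> = ennreal (c * (1 / \<gamma>) powr i * w)"
        using w c2 by (simp add: ennreal_mult)
      also have "c * (1 / \<gamma>) powr i * w = c * w / \<gamma> powr i" by (simp add: powr_divide)
      also have "ennreal \<dots> \<le> ennreal 1"
      proof (rule ennreal_leI)
        have "c * w \<le> c * (A * D powr p * l powr (n * p))"
          using c2 by (intro mult_left_mono w_le) auto
        then have "c * w \<le> \<gamma> powr i" by (simp add: \<gamma>i mult_ac)
        moreover have "\<gamma> powr i > 0" using \<gamma> by simp
        ultimately show "c * w / \<gamma> powr i \<le> 1" by simp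
      qed
      finally have "weight \<phi> x (l * r) (1 / (\<gamma> * k)) \<le> 1" by simp
      then have "chi_norm \<mu> \<phi> (qball d x (l * r)) \<le> ennreal (\<gamma> * k)"
        using \<gamma> k by (intro chi_norm_le \<phi>) auto
      then have "enn2real (chi_norm \<mu> \<phi> (qball d x (l * r))) \<le> \<gamma> * k"
        using \<gamma> k by (intro enn2real_leI) auto
      also have "\<gamma> * k \<le> \<gamma> * e" using k \<gamma> by (simp add: ennreal_less_iff)
      finally show ?thesis .
    qed
    have "enn2real (chi_norm \<mu> \<phi> (qball d x (l * r))) / \<gamma> \<le> e" if "e > X" for e
      using le[OF that] \<gamma> pos_divide_le_eq[of \<gamma> _ e] by (simp add: mult.commute[of \<gamma> e])
    then have "enn2real (chi_norm \<mu> \<phi> (qball d x (l * r))) / \<gamma> \<le> X" by (rule dense_ge)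
    then have "enn2real (chi_norm \<mu> \<phi> (qball d x (l * r))) \<le> \<gamma> * X"
      using \<gamma> pos_divide_le_eq[of \<gamma> _ X] by (simp add: mult.commute[of \<gamma> X])
    then show ?thesis by (simp only: X_def \<gamma>_def)
  qed
  then show "\<exists>C\<ge>1. \<forall>x r l. r > 0 \<longrightarrow> l \<ge> 1 \<longrightarrow>
       enn2real (chi_norm \<mu> \<phi> (qball d x (l * r))) \<le> C * l powr (n * p / i) * enn2real (chi_norm \<mu> \<phi> (qball d x r))"
    using b1 by (intro exI[of _ b]) auto
qed

text \<open>The strict inequality n0 p / i < M at the critical indices survives small changes, so i,
  then p, then n are replaced by admissible values one at a time. The case n0 = 0 is separate
  because the room for p is found by dividing by n0.\<close>

lemma indices_less:
  assumes \<phi>: "growth_function d \<mu> \<phi>" and M: "M > dim_n0 d \<mu> * (1 + index_p d \<mu> \<phi> / index_i \<phi>) - dim_alpha0 d \<mu>"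
  obtains n p i where "n > 0" "cond_D d \<mu> n" "p \<ge> 1" "class_A d \<mu> p \<phi>"
    "0 < i" "i \<le> 1" "uniformly_lower_type \<phi> i" "n * p / i < M"
proof -
  let ?n = "dim_n0 d \<mu>" and ?p = "index_p d \<mu> \<phi>" and ?i = "index_i \<phi>"
  have i: "?i > 0" "?i \<le> 1" using index_i_pos_le_1[OF \<phi>] by auto
  have p: "?p \<ge> 1" by (rule index_p_ge_1[OF \<phi>])
  have npi: "?n * ?p / ?i < M" using M dim_alpha0_le_dim_n0 by (simp add: algebra_simps)
  have "?n * ?p / ?i \<ge> 0" using i p dim_n0_nonneg by simp
  then have M0: "M > 0" using npi by linarith
  have "?n * ?p / M < ?i" using npi i M0 by (simp add: field_simps)
  then obtain i' where i': "0 < i'" "?n * ?p / M < i'" "i' \<le> 1" "uniformly_lower_type \<phi> i'"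
    by (rule less_index_i[OF \<phi>])
  have np: "?n * ?p < M * i'" using i' M0 by (simp add: field_simps)
  obtain p' where p': "p' \<ge> 1" "class_A d \<mu> p' \<phi>" "?n * p' < M * i'"
  proof (cases "?n = 0")
    case True
    have "?p < ?p + 1" by simp
    then obtain p' where "p' \<ge> 1" "class_A d \<mu> p' \<phi>" by (rule index_p_less[OF \<phi>])
    then show ?thesis using that True M0 i' by simp
  next
    case False
    then have n0: "?n > 0" using dim_n0_nonneg by simp
    then have "?p < M * i' / ?n" using np by (simp add: field_simps)
    then obtain p' where "p' \<ge> 1" "p' < M * i' / ?n" "class_A d \<mu> p' \<phi>" by (rule index_p_less[OF \<phi>])
    then show ?thesis using that n0 by (simp add: field_simps)
  qed
  have "?n < M * i' / p'" using p' by (simp add: field_simps)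
  then obtain n where n: "n > 0" "n < M * i' / p'" "cond_D d \<mu> n" by (rule dim_n0_less)
  have "n * p' / i' < M" using n(2) p' i' by (simp add: field_simps)
  then show ?thesis using that n p' i' by blast
qed

lemma cond_D_constant:
  assumes "cond_D d \<mu> n"
  obtains D where "D \<ge> 1" "\<And>x r l. r > 0 \<Longrightarrow> l \<ge> 1 \<Longrightarrow> vol x (l * r) \<le> D * l powr n * vol x r"
proof -
  obtain C where C: "\<And>x r l. r > 0 \<Longrightarrow> l \<ge> 1 \<Longrightarrow> vol x (l * r) \<le> C * l powr n * vol x r"
    using assms unfolding cond_D_def by blast
  show ?thesis
  proof (rule that[of "max C 1"])
    fix x and r l :: real assume rl: "r > 0" "l \<ge> 1"
    have "C * l powr n * vol x r \<le> max C 1 * l powr n * vol x r" by (intro mult_right_mono) auto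
    then show "vol x (l * r) \<le> max C 1 * l powr n * vol x r" using C[OF rl, of x] by linarith
  qed simp
qed

end

section \<open>Equivalence of the norms\<close>

text \<open>Far out the limit gives decay u^(-M), and 1 + u \<le> 2 u costs \<open>2 powr M\<close>;
  on the remaining bounded range boundedness of \<open>g\<close> is enough. In the application u is
  the distance in units of t^(1 / m).\<close>

lemma decay_bound:
  fixes g :: "real \<Rightarrow> real"
  assumes "m > 0" and g: "\<And>r. r \<ge> 0 \<Longrightarrow> g r > 0" "bounded (g ` {0..})"
    and lim: "((\<lambda>r. r powr M * g (r powr m)) \<longlongrightarrow> 0) at_top" and M: "M > 0"
  obtains G where "G > 0" "\<And>u. u \<ge> 0 \<Longrightarrow> g (u powr m) \<le> G * (1 + u) powr (- M)"
proof -
  obtain b where b: "\<And>r. r \<ge> 0 \<Longrightarrow> g r \<le> b"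
    using g(2) unfolding bounded_iff by (force simp: abs_le_iff)
  have "b > 0" using g(1)[of 0] b[of 0] by simp
  have "\<forall>\<^sub>F r in at_top. r powr M * g (r powr m) < 1" using lim by (rule order_tendstoD) simp
  then obtain R0 where R0: "\<And>r. r \<ge> R0 \<Longrightarrow> r powr M * g (r powr m) < 1"
    unfolding eventually_at_top_linorder by blast
  define R where "R = max R0 1"
  define G where "G = max (2 powr M) ((1 + R) powr M * b)"
  have "G > 0" by (simp add: G_def less_max_iff_disj)
  moreover have "g (u powr m) \<le> G * (1 + u) powr (- M)" if u: "u \<ge> 0" for u
  proof -
    have "(1 + u) powr M * g (u powr m) \<le> G"
    proof (cases "u \<ge> R")
      case True
      then have u1: "u \<ge> 1" "u \<ge> R0" by (auto simp: R_def)
      have "(1 + u) powr M \<le> (2 * u) powr M" using u1 M by (intro powr_mono2) auto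
      also have "\<dots> = 2 powr M * u powr M" by (simp add: powr_mult)
      finally have "(1 + u) powr M * g (u powr m) \<le> 2 powr M * u powr M * g (u powr m)"
        using g(1)[of "u powr m"] by (intro mult_right_mono) auto
      also have "\<dots> = 2 powr M * (u powr M * g (u powr m))" by simp
      also have "\<dots> \<le> 2 powr M * 1" using R0[OF u1(2)] by (intro mult_left_mono) auto
      finally show ?thesis by (simp add: G_def)
    next
      case False
      then have "(1 + u) powr M * g (u powr m) \<le> (1 + R) powr M * b"
        using u M b[of "u powr m"] g(1)[of "u powr m"] by (intro mult_mono powr_mono2) auto
      then show ?thesis by (simp add: G_def)
    qed
    then show ?thesis using u by (simp add: powr_minus field_simps)
  qed
  ultimately show ?thesis by (rule that)
qed

text \<open>Removes the extended arithmetic: with \<open>X\<close> the norm of the characteristic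
  function and \<open>V\<close> the volume, X / V is \<psi>, and the right side has the form used by
  the abstract argument. For infinite \<open>T\<close> both sides are false.\<close>

lemma BMO_term_le_iff:
  assumes "V > 0" "X > 0" "c \<ge> 0" "p > 0"
  shows "ennreal V / ennreal X * epowr (T / ennreal V) (1 / p) \<le> ennreal c \<longleftrightarrow>
    T \<le> ennreal ((c * (X / V)) powr p * V)"
proof (cases T)
  case top
  have "ennreal V / ennreal X * epowr (T / ennreal V) (1 / p) = top"
    using assms top by (simp add: ennreal_top_divide epowr_top divide_ennreal ennreal_mult_top)
  then show ?thesis using top by (simp add: top_unique)
next
  case (real t)
  have "ennreal V / ennreal X * epowr (T / ennreal V) (1 / p) = ennreal (V / X * (t / V) powr (1 / p))"
    using real assms by (simp add: divide_ennreal epowr_ennreal ennreal_mult[symmetric] del: times_divide_eq_left)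
  then have "?thesis \<longleftrightarrow> (V / X * (t / V) powr (1 / p) \<le> c \<longleftrightarrow> t \<le> (c * (X / V)) powr p * V)"
    using real assms by (simp add: ennreal_le_iff)
  also have "V / X * (t / V) powr (1 / p) \<le> c \<longleftrightarrow> (t / V) powr (1 / p) \<le> c * (X / V)"
    using assms by (simp add: field_simps)
  also have "\<dots> \<longleftrightarrow> t / V \<le> (c * (X / V)) powr p"
  proof
    assume "(t / V) powr (1 / p) \<le> c * (X / V)"
    then have "((t / V) powr (1 / p)) powr p \<le> (c * (X / V)) powr p" using assms by (intro powr_mono2) auto
    then show "t / V \<le> (c * (X / V)) powr p" using assms real by (simp add: powr_powr)
  next
    assume "t / V \<le> (c * (X / V)) powr p"
    then have "(t / V) powr (1 / p) \<le> ((c * (X / V)) powr p) powr (1 / p)"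
      using assms real by (intro powr_mono2) auto
    then show "(t / V) powr (1 / p) \<le> c * (X / V)" using assms by (simp add: powr_powr)
  qed
  also have "\<dots> \<longleftrightarrow> t \<le> (c * (X / V)) powr p * V" using assms by (simp add: field_simps)
  finally show ?thesis by simp
qed

context homogeneous_type_quasi_constant
begin

text \<open>The weight \<open>W\<close> of the test space grows at most like the power e0 + \<beta>
  + n of 1 + d x0 y, and \<beta> is small enough that some admissible n keeps this exponent below M.
  Hence the kernel is at most a multiple of 1 / W.\<close>

lemma test_space_integrable:
  assumes f: "f \<in> test_space d \<mu> \<phi> M"
    and a_meas: "a t x \<in> borel_measurable \<mu>" and \<rho>: "\<rho> > 0" and G: "G > 0"
    and a_bound: "\<And>y. norm (a t x y) \<le> G / vol x \<rho> * (1 + d x y / \<rho>) powr (- M)"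
    and M: "M > 0"
  shows "integrable \<mu> (\<lambda>y. a t x y * f y :: complex)"
proof -
  define e0 where "e0 = dim_n0 d \<mu> * index_p d \<mu> \<phi> / index_i \<phi> - dim_alpha0 d \<mu>"
  obtain x0 \<beta> where \<beta>: "\<beta> < M - dim_n0 d \<mu> * (1 + index_p d \<mu> \<phi> / index_i \<phi>) + dim_alpha0 d \<mu>"
    and fx0: "f \<in> test_space_at d \<mu> \<phi> x0 \<beta>"
    using f unfolding test_space_def by auto
  have [measurable]: "f \<in> borel_measurable \<mu>" "a t x \<in> borel_measurable \<mu>"
    using fx0 a_meas by (auto simp: test_space_at_def)
  define W where "W y = (1 + d x0 y) powr (e0 + \<beta>) * vol x0 (1 + d x0 y)" for y
  have fin: "(\<integral>\<^sup>+y. ennreal (norm (f y) / W y) \<partial>\<mu>) < \<infinity>"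
    using fx0 by (simp add: test_space_at_def W_def e0_def)
  have "dim_n0 d \<mu> < M - (e0 + \<beta>)" using \<beta> by (simp add: e0_def algebra_simps)
  then obtain n where n: "n > 0" "n < M - (e0 + \<beta>)" "cond_D d \<mu> n" by (rule dim_n0_less)
  obtain D where D: "D \<ge> 1" "\<And>x r l. r > 0 \<Longrightarrow> l \<ge> 1 \<Longrightarrow> vol x (l * r) \<le> D * l powr n * vol x r"
    using cond_D_constant[OF n(3)] by blast
  \<comment> \<open>Chosen to give 1 + d x0 y \<le> s (1 + d x y / \<rho>), which moves the decay
    from \<open>x\<close> to \<open>x0\<close>.\<close>
  define s where "s = 1 + K * d x0 x + K * \<rho>"
  have s: "s > 0" using K_pos \<rho> dist_nonneg[of x0 x] by (simp add: s_def add_pos_nonneg)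
  define C where "C = G / vol x \<rho> * (D * vol x0 1 * s powr M)"
  have vpos: "vol x \<rho> > 0" "vol x0 1 > 0" using vol_pos \<rho> by auto
  have C: "C > 0" using G vpos D s by (simp add: C_def)
  have bound: "norm (a t x y * f y) \<le> C * (norm (f y) / W y)" for y
  proof -
    define u q where "u = d x0 y" and "q = d x y / \<rho>"
    have uq: "u \<ge> 0" "q \<ge> 0" using dist_nonneg \<rho> by (auto simp: u_def q_def)
    have W_pos: "W y > 0" using vol_pos[of "1 + u" x0] uq by (simp add: W_def u_def)
    have "u \<le> K * (d x0 x + d x y)" unfolding u_def by (rule quasi_triangle_K)
    also have "d x y = \<rho> * q" using \<rho> by (simp add: q_def)
    finally have "1 + u \<le> 1 + K * d x0 x + K * \<rho> * q" by (simp add: algebra_simps)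
    also have "\<dots> \<le> s + (1 + K * d x0 x) * q + K * \<rho> * q"
      using K_pos \<rho> uq dist_nonneg[of x0 x] by (simp add: s_def)
    also have "\<dots> = s * (1 + q)" by (simp add: s_def algebra_simps)
    finally have u_le: "1 + u \<le> s * (1 + q)" .
    have "W y = (1 + u) powr (e0 + \<beta>) * vol x0 ((1 + u) * 1)" by (simp add: W_def u_def)
    also have "\<dots> \<le> (1 + u) powr (e0 + \<beta>) * (D * (1 + u) powr n * vol x0 1)"
      using uq by (intro mult_left_mono D) auto
    also have "\<dots> = D * vol x0 1 * (1 + u) powr (e0 + \<beta> + n)"
      using uq by (simp add: powr_add)
    also have "\<dots> \<le> D * vol x0 1 * (1 + u) powr M"
      using D n uq vpos by (intro mult_left_mono powr_mono) auto
    also have "\<dots> \<le> D * vol x0 1 * (s * (1 + q)) powr M"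
      using D uq vpos M u_le by (intro mult_left_mono powr_mono2) auto
    finally have W_le: "W y \<le> D * vol x0 1 * (s powr M * (1 + q) powr M)"
      by (simp add: powr_mult)
    have "norm (a t x y) * W y \<le> G / vol x \<rho> * (1 + q) powr (- M) * (D * vol x0 1 * (s powr M * (1 + q) powr M))"
      using a_bound[of y] W_le W_pos G vpos by (intro mult_mono) (auto simp: q_def)
    also have "\<dots> = C * ((1 + q) powr (- M) * (1 + q) powr M)"
      by (simp add: C_def)
    also have "(1 + q) powr (- M) * (1 + q) powr M = 1" using uq by (simp flip: powr_add)
    finally have "norm (a t x y) \<le> C / W y" using W_pos by (simp add: field_simps)
    then have "norm (a t x y) * norm (f y) \<le> C / W y * norm (f y)" by (intro mult_right_mono) auto
    then show ?thesis by (simp add: norm_mult)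
  qed
  have "ennreal (1 / C) * (\<integral>\<^sup>+y. ennreal (norm (a t x y * f y)) \<partial>\<mu>) =
      (\<integral>\<^sup>+y. ennreal (1 / C) * ennreal (norm (a t x y * f y)) \<partial>\<mu>)"
    by (intro nn_integral_cmult[symmetric]) measurable
  also have "\<dots> \<le> (\<integral>\<^sup>+y. ennreal (norm (f y) / W y) \<partial>\<mu>)"
  proof (rule nn_integral_mono)
    fix y
    have "1 / C * norm (a t x y * f y) \<le> norm (f y) / W y"
      using bound[of y] C by (simp add: field_simps)
    then have "ennreal (1 / C * norm (a t x y * f y)) \<le> ennreal (norm (f y) / W y)" by (rule ennreal_leI)
    then show "ennreal (1 / C) * ennreal (norm (a t x y * f y)) \<le> ennreal (norm (f y) / W y)"
      using C by (subst ennreal_mult[symmetric]) auto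
  qed
  also note fin
  finally have "(\<integral>\<^sup>+y. ennreal (norm (a t x y * f y)) \<partial>\<mu>) < \<infinity>"
    using C by (auto simp: ennreal_mult_less_top ennreal_mult_top less_top[symmetric])
  then show ?thesis by (intro integrableI_bounded) auto
qed

end

context campanato_space
begin

lemma campanato_bounded_test_space:
  assumes sem: "\<forall>s\<ge>0. \<forall>t\<ge>0. \<forall>f\<in>test_space d \<mu> \<phi> M.
        AE x in \<mu>. kernel_op \<mu> a t (kernel_op \<mu> a s f) x = kernel_op \<mu> a (t + s) f x"
    and f: "f \<in> test_space d \<mu> \<phi> M" and N: "N > 0"
    and osc: "\<And>x r. r > 0 \<Longrightarrow> (\<integral>\<^sup>+y\<in>qball d x r. ennreal (osc f r y) \<partial>\<mu>) \<le> ennreal (N * \<psi> x r * vol x r)"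
  shows "campanato_bounded f N"
  unfolding campanato_bounded_def
proof (intro conjI allI impI)
  show "f \<in> borel_measurable \<mu>" using f by (auto simp: test_space_def test_space_at_def)
  show "integrable \<mu> (\<lambda>y. a t x y * f y)" if t: "t > 0" for x t
  proof (rule test_space_integrable[OF f, where a = a and \<rho> = "t powr (1 / m)"])
    have "(t powr (1 / m)) powr m = t" using t m_pos by (simp add: powr_powr)
    then show "norm (a t x y) \<le> G / vol x (t powr (1 / m)) * (1 + d x y / t powr (1 / m)) powr - M" for y
      using kernel_bound[of "t powr (1 / m)" x y] t by simp
  qed (use t G_pos M_pos kernel_measurable_snd in auto)
qed (use assms in auto)

end

text \<open>For \<open>p \<ge> 1\<close> one has \<open>u \<le> c + c powr (1 - p) * u powr p\<close>, which replaces Hoelder's inequality.\<close>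

lemma nn_integral_le_of_powr:
  fixes h :: "'a \<Rightarrow> real"
  assumes [measurable]: "h \<in> borel_measurable M" "B \<in> sets M" and h: "\<And>y. h y \<ge> 0" and p: "p \<ge> 1"
    and c: "c > 0" and V: "V \<ge> 0" "emeasure M B = ennreal V"
    and le: "(\<integral>\<^sup>+y\<in>B. ennreal (h y powr p) \<partial>M) \<le> ennreal (c powr p * V)"
  shows "(\<integral>\<^sup>+y\<in>B. ennreal (h y) \<partial>M) \<le> ennreal (2 * c * V)"
proof -
  have pt: "h y \<le> c + c powr (1 - p) * h y powr p" for y
  proof (cases "h y \<le> c")
    case True
    then show ?thesis using c by (simp add: add_increasing2)
  next
    case False
    have "h y = h y powr (1 - p) * h y powr p" using False c by (simp flip: powr_add)
    also have "\<dots> \<le> c powr (1 - p) * h y powr p"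
      using False c p powr_mono2'[of "p - 1" c "h y"] by (intro mult_right_mono powr_mono2') auto
    finally show ?thesis using c by simp
  qed
  have "(\<integral>\<^sup>+y\<in>B. ennreal (h y) \<partial>M) \<le>
      (\<integral>\<^sup>+y. ennreal c * indicator B y + ennreal (c powr (1 - p)) * (ennreal (h y powr p) * indicator B y) \<partial>M)"
  proof (rule nn_integral_mono)
    fix y
    have "ennreal (h y) \<le> ennreal (c + c powr (1 - p) * h y powr p)" by (rule ennreal_leI[OF pt])
    also have "\<dots> = ennreal c + ennreal (c powr (1 - p)) * ennreal (h y powr p)"
      using c by (simp add: ennreal_mult)
    finally show "ennreal (h y) * indicator B y \<le>
        ennreal c * indicator B y + ennreal (c powr (1 - p)) * (ennreal (h y powr p) * indicator B y)"
      by (simp add: indicator_def)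
  qed
  also have "\<dots> = ennreal c * emeasure M B + ennreal (c powr (1 - p)) * (\<integral>\<^sup>+y\<in>B. ennreal (h y powr p) \<partial>M)"
    by (subst nn_integral_add) (auto simp: nn_integral_cmult)
  also have "\<dots> \<le> ennreal c * ennreal V + ennreal (c powr (1 - p)) * ennreal (c powr p * V)"
    using V le by (intro add_mono mult_left_mono) auto
  also have "\<dots> = ennreal (c * V + c powr (1 - p) * (c powr p * V))"
    using c V by (simp add: ennreal_mult)
  also have "c powr (1 - p) * (c powr p * V) = c * V"
    using c by (simp add: mult.assoc[symmetric] flip: powr_add)
  finally show ?thesis by (simp add: mult_ac)
qed

text \<open>Passes from \<open>p1\<close> down to exponent 1 and from there up to \<open>p2\<close>,
  for any pair in either order, so exchanging the exponents gives the reverse inequality. It holds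
  on the whole test space, infinite values included, so that finiteness is transferred as
  well.\<close>

lemma BMO_norm_equivalence:
  fixes d :: "'a \<Rightarrow> 'a \<Rightarrow> real"
  assumes X: "homogeneous_type_space d \<mu>" and \<phi>: "growth_function d \<mu> \<phi>"
    and mono: "\<exists>C>0. \<forall>x1 r1 x2 r2. r1 > 0 \<longrightarrow> r2 > 0 \<longrightarrow> qball d x1 r1 \<subseteq> qball d x2 r2 \<longrightarrow>
           chi_norm \<mu> \<phi> (qball d x1 r1) / emeasure \<mu> (qball d x1 r1)
             \<le> ennreal C * (chi_norm \<mu> \<phi> (qball d x2 r2) / emeasure \<mu> (qball d x2 r2))"
    and A: "assumption_A d \<mu> \<phi> M m g a"
    and p: "p1 \<ge> 1" "p2 \<ge> 1"
  shows "\<exists>C>0. \<forall>f\<in>test_space d \<mu> \<phi> M. BMO_norm d \<mu> \<phi> m a p2 f \<le> ennreal C * BMO_norm d \<mu> \<phi> m a p1 f"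
proof -
  interpret homogeneous_type_space d \<mu> by (rule X)
  have gai: "generalized_approximation_identity d \<mu> \<phi> M m g a"
    and sem: "\<forall>s\<ge>0. \<forall>t\<ge>0. \<forall>f\<in>test_space d \<mu> \<phi> M.
        AE x in \<mu>. kernel_op \<mu> a t (kernel_op \<mu> a s f) x = kernel_op \<mu> a (t + s) f x"
    using A unfolding assumption_A_def by blast+
  have M: "M > dim_n0 d \<mu> * (1 + index_p d \<mu> \<phi> / index_i \<phi>) - dim_alpha0 d \<mu>" and m: "m > 0"
    and g: "\<And>r. r \<ge> 0 \<Longrightarrow> g r > 0" "bounded (g ` {0..})" "((\<lambda>r. r powr M * g (r powr m)) \<longlongrightarrow> 0) at_top"
    and a_meas: "\<And>t. t > 0 \<Longrightarrow> (\<lambda>(x, y). a t x y) \<in> borel_measurable (\<mu> \<Otimes>\<^sub>M \<mu>)"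
    and a_bound: "\<And>t x y. t > 0 \<Longrightarrow> norm (a t x y) \<le>
        1 / measure \<mu> (qball d x (t powr (1 / m))) * g (d x y powr m / t)"
    using gai unfolding generalized_approximation_identity_def by blast+
  obtain n p i where npi: "n > 0" "cond_D d \<mu> n" "p \<ge> 1" "class_A d \<mu> p \<phi>"
    "0 < i" "i \<le> 1" "uniformly_lower_type \<phi> i" "n * p / i < M"
    by (rule indices_less[OF \<phi> M])
  obtain D where D: "D \<ge> 1" "\<And>x r l. r > 0 \<Longrightarrow> l \<ge> 1 \<Longrightarrow> vol x (l * r) \<le> D * l powr n * vol x r"
    using cond_D_constant[OF npi(2)] by blast
  obtain K where K: "K \<ge> 1" "\<And>x y z. d x y \<le> K * (d x z + d z y)" using quasi_triangle by blast
  \<comment> \<open>Rests on i \<le> 1 \<le> p, and lets volume growth be absorbed into the exponent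
    \<kappa> = n p / i.\<close>
  have n_le: "n \<le> n * p / i"
  proof -
    have "i * 1 \<le> p * 1" using npi by simp
    then have "n * i \<le> n * p" using npi by (intro mult_left_mono) auto
    then show ?thesis using npi by (simp add: field_simps)
  qed
  have M0: "M > 0" using n_le npi by linarith
  obtain G where G: "G > 0" "\<And>u. u \<ge> 0 \<Longrightarrow> g (u powr m) \<le> G * (1 + u) powr (- M)"
    using decay_bound[OF m g M0] by blast
  have chi_fin: "chi_norm \<mu> \<phi> (qball d x r) < top" if "r > 0" for x r
    by (rule chi_norm_finite_growth(1)[OF \<phi> npi(3,4,5,7,1) D(1) _ that]) (rule D(2))
  have "\<exists>C\<ge>1. \<forall>x r l. r > 0 \<longrightarrow> l \<ge> 1 \<longrightarrow>
       enn2real (chi_norm \<mu> \<phi> (qball d x (l * r))) \<le> C * l powr (n * p / i) * enn2real (chi_norm \<mu> \<phi> (qball d x r))"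
    by (rule chi_norm_finite_growth(2)[OF \<phi> npi(3,4,5,7,1) D(1)]) (rule D(2))
  then obtain Cg where Cg: "Cg \<ge> 1" "\<And>x r l. r > 0 \<Longrightarrow> l \<ge> 1 \<Longrightarrow>
       enn2real (chi_norm \<mu> \<phi> (qball d x (l * r))) \<le> Cg * l powr (n * p / i) * enn2real (chi_norm \<mu> \<phi> (qball d x r))"
    by blast
  obtain C0 where C0: "C0 > 0" "\<And>x1 r1 x2 r2. r1 > 0 \<Longrightarrow> r2 > 0 \<Longrightarrow> qball d x1 r1 \<subseteq> qball d x2 r2 \<Longrightarrow>
           chi_norm \<mu> \<phi> (qball d x1 r1) / emeasure \<mu> (qball d x1 r1)
             \<le> ennreal C0 * (chi_norm \<mu> \<phi> (qball d x2 r2) / emeasure \<mu> (qball d x2 r2))"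
    using mono by blast
  \<comment> \<open>Norms of balls are positive and finite, so from here on they are real
    numbers.\<close>
  define nchi where "nchi x r = enn2real (chi_norm \<mu> \<phi> (qball d x r))" for x r
  have nchi: "chi_norm \<mu> \<phi> (qball d x r) = ennreal (nchi x r)" "nchi x r > 0" if "r > 0" for x r
    using chi_fin[OF that, of x] chi_norm_pos[OF \<phi> that, of x]
    by (auto simp: nchi_def enn2real_positive_iff)
  define \<psi> where "\<psi> x r = nchi x r / vol x r" for x r
  interpret campanato_space d \<mu> K D n "n * p / i" "max C0 1" Cg \<psi> a m M G
  proof unfold_locales
    show "\<psi> x r > 0" if "r > 0" for x r
      using nchi[OF that] vol_pos[OF that] by (simp add: \<psi>_def)
    show "\<psi> x r \<le> max C0 1 * \<psi> y s" if "r > 0" "s > 0" "qball d x r \<subseteq> qball d y s" for x y r s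
    proof -
      have q: "ennreal (nchi z u) / ennreal (vol z u) = ennreal (\<psi> z u)" if "u > 0" for z u
        using nchi(2)[OF that, of z] vol_pos[OF that, of z] by (simp add: divide_ennreal \<psi>_def)
      have \<psi>0: "\<psi> y s \<ge> 0" using nchi(2)[OF that(2), of y] by (simp add: \<psi>_def)
      have "ennreal (nchi x r) / ennreal (vol x r) \<le> ennreal C0 * (ennreal (nchi y s) / ennreal (vol y s))"
        using C0(2)[OF that] that by (simp add: nchi emeasure_qball)
      then have "ennreal (\<psi> x r) \<le> ennreal C0 * ennreal (\<psi> y s)"
        by (simp only: q that)
      also have "\<dots> = ennreal (C0 * \<psi> y s)"
        using C0(1) \<psi>0 by (intro ennreal_mult[symmetric]) auto
      finally have "\<psi> x r \<le> C0 * \<psi> y s" using C0(1) \<psi>0 by (subst (asm) ennreal_le_iff) auto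
      also have "\<dots> \<le> max C0 1 * \<psi> y s" using \<psi>0 by (intro mult_right_mono) auto
      finally show ?thesis .
    qed
    show "\<psi> x (l * r) * vol x (l * r) \<le> Cg * l powr (n * p / i) * (\<psi> x r * vol x r)"
      if "r > 0" "l \<ge> 1" for x r l
      using Cg(2)[OF that, of x] vol_pos[of r x] vol_pos[of "l * r" x] that
      by (simp add: \<psi>_def nchi_def)
    show "norm (a (\<rho> powr m) x y) \<le> G / vol x \<rho> * (1 + d x y / \<rho>) powr (- M)" if "\<rho> > 0" for \<rho> x y
    proof -
      have "norm (a (\<rho> powr m) x y) \<le> 1 / vol x \<rho> * g ((d x y / \<rho>) powr m)"
        using a_bound[of "\<rho> powr m" x y] that m by (simp add: powr_powr powr_divide)
      also have "\<dots> \<le> 1 / vol x \<rho> * (G * (1 + d x y / \<rho>) powr (- M))"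
        using that dist_nonneg[of x y] by (intro mult_left_mono G(2)) auto
      finally show ?thesis by simp
    qed
  qed (use K D npi n_le m Cg G a_meas in auto)
  \<comment> \<open>The bound c for the exponent p norm in real terms; the normalising factor of the
    norm is 1 / \<psi>.\<close>
  define B where "B p c f \<longleftrightarrow> (\<forall>x. \<forall>r>0. (\<integral>\<^sup>+y\<in>qball d x r. ennreal (osc f r y powr p) \<partial>\<mu>)
      \<le> ennreal ((c * \<psi> x r) powr p * vol x r))" for p c f
  have BMO_iff: "BMO_norm d \<mu> \<phi> m a p f \<le> ennreal c \<longleftrightarrow> B p c f" if "p \<ge> 1" "c \<ge> 0" for p c f
  proof -
    have "emeasure \<mu> (qball d x r) / chi_norm \<mu> \<phi> (qball d x r) *
       epowr (average \<mu> (qball d x r) (\<lambda>y. ennreal (norm (f y - kernel_op \<mu> a (r powr m) f y) powr p))) (1 / p)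
       \<le> ennreal c \<longleftrightarrow> (\<integral>\<^sup>+y\<in>qball d x r. ennreal (osc f r y powr p) \<partial>\<mu>) \<le> ennreal ((c * \<psi> x r) powr p * vol x r)"
      if r: "r > 0" for x r
      unfolding average_def emeasure_qball nchi(1)[OF r] \<psi>_def osc_def
      using \<open>p \<ge> 1\<close> \<open>c \<ge> 0\<close> nchi(2)[OF r] vol_pos[OF r] by (intro BMO_term_le_iff) auto
    then show ?thesis unfolding BMO_norm_def B_def by (simp add: SUP_le_iff Ball_def)
  qed
  have B1: "campanato_bounded f (2 * c)"
    if f: "f \<in> test_space d \<mu> \<phi> M" and Bc: "B p1 c f" and c: "c > 0" for f c
  proof (rule campanato_bounded_test_space[OF sem f])
    show "2 * c > 0" using c by simp
    fix x and r :: real assume r: "r > 0"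
    have "f \<in> borel_measurable \<mu>" using f by (auto simp: test_space_def test_space_at_def)
    then have "(\<integral>\<^sup>+y\<in>qball d x r. ennreal (osc f r y) \<partial>\<mu>) \<le> ennreal (2 * (c * \<psi> x r) * vol x r)"
      using Bc r c p(1) \<psi>_pos[OF r, of x] osc_nonneg emeasure_qball
      by (intro nn_integral_le_of_powr[where p = p1] osc_measurable) (auto simp: B_def)
    then show "(\<integral>\<^sup>+y\<in>qball d x r. ennreal (osc f r y) \<partial>\<mu>) \<le> ennreal (2 * c * \<psi> x r * vol x r)"
      by (simp add: mult_ac)
  qed
  define L where "L = C_step * max C0 1 * Cg * (2 * K) powr (n * p / i)"
  have L: "L > 0" using C_step_pos Cg K by (simp add: L_def)
  \<comment> \<open>The 2 is lost between \<open>p1\<close> and exponent 1; the other factors are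
    the p2-th root of the constant in \<open>osc_powr_integral_le\<close>.\<close>
  define C where "C = jn_sum p2 powr (1 / p2) * L * 2"
  have C: "C > 0" using L jn_sum_pos[of p2] by (simp add: C_def)
  have B2: "B p2 (C * c) f" if f: "f \<in> test_space d \<mu> \<phi> M" and Bc: "B p1 c f" and c: "c > 0" for f c
    unfolding B_def
  proof (intro allI impI)
    fix x and r :: real assume r: "r > 0"
    have "(\<integral>\<^sup>+y\<in>qball d x r. ennreal (osc f r y powr p2) \<partial>\<mu>) \<le>
        ennreal (jn_sum p2 * (L * (2 * c) * \<psi> x r) powr p2 * vol x r)"
      using osc_powr_integral_le[OF B1[OF f Bc c] r, of p2 x] p by (simp add: L_def)
    also have "jn_sum p2 * (L * (2 * c) * \<psi> x r) powr p2 = (C * c * \<psi> x r) powr p2"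
    proof -
      have "jn_sum p2 = (jn_sum p2 powr (1 / p2)) powr p2"
        using p jn_sum_pos[of p2] by (simp add: powr_powr)
      then have "jn_sum p2 * (L * (2 * c) * \<psi> x r) powr p2 =
          (jn_sum p2 powr (1 / p2)) powr p2 * (L * (2 * c) * \<psi> x r) powr p2" by simp
      also have "\<dots> = (jn_sum p2 powr (1 / p2) * (L * (2 * c) * \<psi> x r)) powr p2"
        by (simp only: powr_mult)
      also have "jn_sum p2 powr (1 / p2) * (L * (2 * c) * \<psi> x r) = C * c * \<psi> x r"
        by (simp add: C_def mult_ac)
      finally show ?thesis .
    qed
    finally show "(\<integral>\<^sup>+y\<in>qball d x r. ennreal (osc f r y powr p2) \<partial>\<mu>) \<le> ennreal ((C * c * \<psi> x r) powr p2 * vol x r)" .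
  qed
  show ?thesis
  proof (intro exI[of _ C] conjI ballI C)
    fix f assume f: "f \<in> test_space d \<mu> \<phi> M"
    show "BMO_norm d \<mu> \<phi> m a p2 f \<le> ennreal C * BMO_norm d \<mu> \<phi> m a p1 f"
    proof (cases "BMO_norm d \<mu> \<phi> m a p1 f")
      case top
      then show ?thesis using C by (simp add: ennreal_mult_top)
    next
      case (real b)
      show ?thesis
      proof (rule ennreal_le_epsilon)
        fix e :: real assume e: "e > 0"
        \<comment> \<open>The norm b may be 0, whereas \<open>campanato_bounded\<close> asks for a
          positive constant; the slack e / C becomes e after multiplication by C.\<close>
        define c where "c = b + e / C"
        have c: "c > 0" "b \<le> c" using real e C by (auto simp: c_def add_nonneg_pos)
        have "BMO_norm d \<mu> \<phi> m a p1 f \<le> ennreal c" unfolding real using c by (intro ennreal_leI)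
        then have "B p1 c f" using BMO_iff p c by simp
        then have "B p2 (C * c) f" by (rule B2[OF f _ c(1)])
        then have "BMO_norm d \<mu> \<phi> m a p2 f \<le> ennreal (C * c)" using BMO_iff[of p2 "C * c" f] p c C by simp
        also have "C * c = C * b + e" using C by (simp add: c_def field_simps)
        finally show "BMO_norm d \<mu> \<phi> m a p2 f \<le> ennreal C * BMO_norm d \<mu> \<phi> m a p1 f + ennreal e"
          using real C e by (simp add: ennreal_mult)
      qed
    qed
  qed
qed

theorem theorem4p6:
  fixes d :: "'a \<Rightarrow> 'a \<Rightarrow> real" and \<mu> :: "'a measure" and \<phi> :: "'a \<Rightarrow> real \<Rightarrow> real"
    and M m :: real and g :: "real \<Rightarrow> real" and a :: "real \<Rightarrow> 'a \<Rightarrow> 'a \<Rightarrow> complex"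
  assumes "homogeneous_type_space d \<mu>"
    and "growth_function d \<mu> \<phi>"
    and "\<exists>C>0. \<forall>x1 r1 x2 r2. r1 > 0 \<longrightarrow> r2 > 0 \<longrightarrow> qball d x1 r1 \<subseteq> qball d x2 r2 \<longrightarrow>
           chi_norm \<mu> \<phi> (qball d x1 r1) / emeasure \<mu> (qball d x1 r1)
             \<le> ennreal C * (chi_norm \<mu> \<phi> (qball d x2 r2) / emeasure \<mu> (qball d x2 r2))"
    and "assumption_A d \<mu> \<phi> M m g a"
  shows "\<forall>p1\<ge>1. \<forall>p2\<ge>1.
           BMO_space d \<mu> \<phi> M m a p1 = BMO_space d \<mu> \<phi> M m a p2 \<and>
           (\<exists>C>0. \<forall>f\<in>BMO_space d \<mu> \<phi> M m a p1.
              BMO_norm d \<mu> \<phi> m a p1 f \<le> ennreal C * BMO_norm d \<mu> \<phi> m a p2 f \<and>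
              BMO_norm d \<mu> \<phi> m a p2 f \<le> ennreal C * BMO_norm d \<mu> \<phi> m a p1 f)"
proof (intro allI impI)
  fix p1 p2 :: real assume p: "p1 \<ge> 1" "p2 \<ge> 1"
  obtain C1 where C1: "C1 > 0"
    "\<And>f. f \<in> test_space d \<mu> \<phi> M \<Longrightarrow> BMO_norm d \<mu> \<phi> m a p2 f \<le> ennreal C1 * BMO_norm d \<mu> \<phi> m a p1 f"
    using BMO_norm_equivalence[OF assms p] by blast
  obtain C2 where C2: "C2 > 0"
    "\<And>f. f \<in> test_space d \<mu> \<phi> M \<Longrightarrow> BMO_norm d \<mu> \<phi> m a p1 f \<le> ennreal C2 * BMO_norm d \<mu> \<phi> m a p2 f"
    using BMO_norm_equivalence[OF assms p(2,1)] by blast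
  have fin: "BMO_norm d \<mu> \<phi> m a q f < \<infinity>"
    if "BMO_norm d \<mu> \<phi> m a q f \<le> ennreal C * BMO_norm d \<mu> \<phi> m a q' f" "BMO_norm d \<mu> \<phi> m a q' f < \<infinity>" for q q' C f
    using that by (auto intro!: le_less_trans[OF that(1)] simp: ennreal_mult_less_top)
  have "BMO_space d \<mu> \<phi> M m a p1 = BMO_space d \<mu> \<phi> M m a p2"
    unfolding BMO_space_def using fin C1(2) C2(2) by blast
  moreover have "\<exists>C>0. \<forall>f\<in>BMO_space d \<mu> \<phi> M m a p1.
      BMO_norm d \<mu> \<phi> m a p1 f \<le> ennreal C * BMO_norm d \<mu> \<phi> m a p2 f \<and>
      BMO_norm d \<mu> \<phi> m a p2 f \<le> ennreal C * BMO_norm d \<mu> \<phi> m a p1 f"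
  proof (intro exI[of _ "max C1 C2"] conjI ballI)
    fix f assume "f \<in> BMO_space d \<mu> \<phi> M m a p1"
    then have f: "f \<in> test_space d \<mu> \<phi> M" by (simp add: BMO_space_def)
    have "ennreal C2 * BMO_norm d \<mu> \<phi> m a p2 f \<le> ennreal (max C1 C2) * BMO_norm d \<mu> \<phi> m a p2 f"
      by (intro mult_right_mono ennreal_leI) auto
    then show "BMO_norm d \<mu> \<phi> m a p1 f \<le> ennreal (max C1 C2) * BMO_norm d \<mu> \<phi> m a p2 f"
      using C2(2)[OF f] by (rule order_trans[rotated])
    have "ennreal C1 * BMO_norm d \<mu> \<phi> m a p1 f \<le> ennreal (max C1 C2) * BMO_norm d \<mu> \<phi> m a p1 f"
      by (intro mult_right_mono ennreal_leI) auto
    then show "BMO_norm d \<mu> \<phi> m a p2 f \<le> ennreal (max C1 C2) * BMO_norm d \<mu> \<phi> m a p1 f"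
      using C1(2)[OF f] by (rule order_trans[rotated])
  qed (use C1 in auto)
  ultimately show "BMO_space d \<mu> \<phi> M m a p1 = BMO_space d \<mu> \<phi> M m a p2 \<and>
           (\<exists>C>0. \<forall>f\<in>BMO_space d \<mu> \<phi> M m a p1.
              BMO_norm d \<mu> \<phi> m a p1 f \<le> ennreal C * BMO_norm d \<mu> \<phi> m a p2 f \<and>
              BMO_norm d \<mu> \<phi> m a p2 f \<le> ennreal C * BMO_norm d \<mu> \<phi> m a p1 f)"
    by blast
qed

end
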